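(* Suppose that $(E,r)$ is a compact metric space equipped with a Borel probability measure $\mu$ such that $$C_1 \epsilon^d \le \mu(B(x,\epsilon)) \le C_2 \epsilon^d, \quad x \in E,\ 0 < \epsilon \le 1,$$ for constants $d>0$ and $0 < C_1 < C_2$, where $B(x,\epsilon)$ is the open ball of radius $\epsilon$ centered at $x$. Consider a Feller Markov process $X$ with state space $E$ that has jointly continuous transition densities $(t,x,y) \mapsto p(t,x,y)$, $t>0$, $x,y\in E$, with respect to $\mu$. Assume that $X$ is symmetric with respect to $\mu$, so that $p(t,x,y) = p(t,y,x)$. Assume further that for some $\alpha > d$ and suitable constants $0 < c_1 < c_2$, $$c_1 \left\{ t^{-d/\alpha} \wedge \frac{t}{r(x,y)^{d+\alpha}} \right\} \le p(t,x,y) \le c_2 \left\{ t^{-d/\alpha} \wedge \frac{t}{r(x,y)^{d+\alpha}} \right\}, \quad 0 < t \le 1,\ x,y\in E.$$ Let $\Xi$ be the set-valued coalescing system corresponding to $X$ (started from an arbitrary nonempty closed subset of $E$). Then, almost surely, $\Xi_t$ is a finite set for all $t>0$.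
   Context: When $r(x,y)=0$ the quantity $t/r(x,y)^{d+\alpha}$ is read as $+\infty$. Set-valued coalescing system. Let $X$ be a Feller process (with càdlàg paths) on a locally compact, second-countable, Hausdorff space $E$. Given a finite or infinite sequence $(x_1,x_2,\ldots)$ of points of $E$, let $\xi_1,\xi_2,\ldots$ be independent copies of $X$ with $\xi_i(0)=x_i$. Define paths $\zeta_1,\zeta_2,\ldots$ inductively: $\zeta_1=\xi_1$, and for $i>1$ let $T_i=\inf\{t\ge 0:\xi_i(t)\in\{\zeta_1(t),\ldots,\zeta_{i-1}(t)\}\}$ (with $\inf\emptyset=\infty$), let $J_i=\min\{j\in\{1,\dots,i-1\}:\xi_i(T_i)=\zeta_j(T_i)\}$ if $T_i<\infty$, and set $\zeta_i(t)=\xi_i(t)$ for $t<T_i$ and $\zeta_i(t)=\zeta_{J_i}(t)$ for $t\ge T_i$. Let $\Xi_t$ be the closure in $E$ of the set $\{\zeta_i(t):i\ge 1\}$. The set-valued coalescing system started from a nonempty closed set $Q\subseteq E$ is the process $\Xi=(\Xi_t)_{t\ge 0}$ obtained from any sequence $(x_i)$ for which the closure of $\{x_i\}$ is $Q$, so that $\Xi_0=Q$ (in the present setting the law of $\Xi$ does not depend on the choice of sequence). *)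

theory Defs
  imports "HOL-Probability.Probability" "HOL-Library.Extended_Nat" "HOL-Library.Extended_Real"
begin

definition C0 :: "('a::topological_space \<Rightarrow> real) set" where
  "C0 = {f. continuous_on UNIV f \<and> (\<forall>e>0. compact {x. e \<le> \<bar>f x\<bar>})}"

definition feller_semigroup :: "(real \<Rightarrow> 'a::topological_space \<Rightarrow> 'a measure) \<Rightarrow> bool" where
  "feller_semigroup P \<longleftrightarrow>
     (\<forall>t\<ge>0. P t \<in> borel \<rightarrow>\<^sub>M prob_algebra borel) \<and>
     (\<forall>x. P 0 x = return borel x) \<and>
     (\<forall>s\<ge>0. \<forall>t\<ge>0. \<forall>x. P (s + t) x = P s x \<bind> P t) \<and>
     (\<forall>t\<ge>0. \<forall>f\<in>C0. (\<lambda>x. \<integral>y. f y \<partial>P t x) \<in> C0) \<and>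
     (\<forall>f\<in>C0. uniform_limit UNIV (\<lambda>t x. \<integral>y. f y \<partial>P t x) f (at_right 0))"

definition symmetric_semigroup ::
    "'a::topological_space measure \<Rightarrow> (real \<Rightarrow> 'a \<Rightarrow> 'a measure) \<Rightarrow> bool" where
  "symmetric_semigroup \<mu> P \<longleftrightarrow>
     (\<forall>t\<ge>0. \<forall>f\<in>borel_measurable borel. \<forall>g\<in>borel_measurable borel.
        (\<integral>\<^sup>+x. f x * (\<integral>\<^sup>+y. g y \<partial>P t x) \<partial>\<mu>) = (\<integral>\<^sup>+x. g x * (\<integral>\<^sup>+y. f y \<partial>P t x) \<partial>\<mu>))"

definition transition_densities ::
    "'a::topological_space measure \<Rightarrow> (real \<Rightarrow> 'a \<Rightarrow> 'a measure) \<Rightarrow> (real \<Rightarrow> 'a \<Rightarrow> 'a \<Rightarrow> real) \<Rightarrow> bool"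
  where
  "transition_densities \<mu> P p \<longleftrightarrow>
     (\<forall>t>0. \<forall>x y. 0 \<le> p t x y) \<and>
     (\<forall>t>0. \<forall>x. P t x = density \<mu> (\<lambda>y. ennreal (p t x y)))"

definition cadlag :: "(real \<Rightarrow> 'a::topological_space) \<Rightarrow> bool" where
  "cadlag f \<longleftrightarrow>
     (\<forall>t\<ge>0. (f \<longlongrightarrow> f t) (at_right t)) \<and> (\<forall>t>0. \<exists>l. (f \<longlongrightarrow> l) (at_left t))"

definition past :: "'b measure \<Rightarrow> (real \<Rightarrow> 'b \<Rightarrow> 'a::topological_space) \<Rightarrow> real \<Rightarrow> 'b measure" where
  "past M X s = sigma (space M) {X u -` A \<inter> space M | u A. 0 \<le> u \<and> u \<le> s \<and> A \<in> sets borel}"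

text \<open>A copy of the process with transition semigroup \<open>P\<close>, started at \<open>x\<close>. Processes have time
  parameter in \<open>{0..}\<close>; their values at negative reals are irrelevant throughout.\<close>

definition process_from ::
    "'b measure \<Rightarrow> (real \<Rightarrow> 'a::topological_space \<Rightarrow> 'a measure) \<Rightarrow> 'a \<Rightarrow> (real \<Rightarrow> 'b \<Rightarrow> 'a) \<Rightarrow> bool" where
  "process_from M P x X \<longleftrightarrow>
     (\<forall>t\<ge>0. X t \<in> M \<rightarrow>\<^sub>M borel) \<and>
     (\<forall>\<omega>\<in>space M. X 0 \<omega> = x \<and> cadlag (\<lambda>t. X t \<omega>)) \<and>
     (\<forall>s\<ge>0. \<forall>t\<ge>0. \<forall>A\<in>sets borel.
        AE \<omega> in M. real_cond_exp M (past M X s) (\<lambda>\<omega>. indicat_real A (X (s + t) \<omega>)) \<omega>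
                    = measure (P t (X s \<omega>)) A)"

text \<open>The path \<open>f\<close> is followed until the first time it meets one of the paths in \<open>zs\<close>, and from then
  on the path of least index that it meets at that time. For paths that are right-continuous
  on \<open>{0..}\<close> the infimum \<open>first_meeting zs f\<close>, if finite, is attained, so that this index exists.\<close>

definition first_meeting :: "(real \<Rightarrow> 'a) list \<Rightarrow> (real \<Rightarrow> 'a) \<Rightarrow> ereal" where
  "first_meeting zs f = Inf (ereal ` {t. 0 \<le> t \<and> f t \<in> (\<lambda>z. z t) ` set zs})"

definition attach :: "(real \<Rightarrow> 'a) list \<Rightarrow> (real \<Rightarrow> 'a) \<Rightarrow> real \<Rightarrow> 'a" where
  "attach zs f t =
     (let T = first_meeting zs f;
          J = (LEAST j. j < length zs \<and> f (real_of_ereal T) = (zs ! j) (real_of_ereal T))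
      in if ereal t < T then f t else (zs ! J) t)"

text \<open>Particles are numbered from \<open>0\<close>.\<close>

fun coalesced :: "(nat \<Rightarrow> real \<Rightarrow> 'a) \<Rightarrow> nat \<Rightarrow> real \<Rightarrow> 'a" where
  "coalesced \<xi> i = attach (map (coalesced \<xi>) [0..<i]) (\<xi> i)"

declare coalesced.simps [simp del]

text \<open>\<open>N\<close> is the number of starting points, \<open>\<infinity>\<close> for an infinite sequence.\<close>

definition coalescing_set ::
    "enat \<Rightarrow> (nat \<Rightarrow> real \<Rightarrow> 'a::topological_space) \<Rightarrow> real \<Rightarrow> 'a set" where
  "coalescing_set N \<xi> t = closure {coalesced \<xi> i t | i. enat i < N}"

text \<open>\<open>\<Xi>\<close> is a set-valued coalescing system on the probability space \<open>M\<close>, started from \<open>Q\<close>, for the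
  process with semigroup \<open>P\<close>. Independence of the copies is independence of whole paths, as random
  elements of the product space over \<open>{0..}\<close>.\<close>

definition coalescing_system ::
    "'b measure \<Rightarrow> (real \<Rightarrow> 'a::topological_space \<Rightarrow> 'a measure) \<Rightarrow> 'a set \<Rightarrow> (real \<Rightarrow> 'b \<Rightarrow> 'a set) \<Rightarrow> bool"
  where
  "coalescing_system M P Q \<Xi> \<longleftrightarrow>
     (\<exists>N x \<xi>.
        closure {x i | i. enat i < N} = Q \<and>
        (\<forall>i. enat i < N \<longrightarrow> process_from M P (x i) (\<xi> i)) \<and>
        prob_space.indep_vars M (\<lambda>i. \<Pi>\<^sub>M t\<in>{0..}. borel) (\<lambda>i \<omega>. \<lambda>t\<in>{0..}. \<xi> i t \<omega>) {i. enat i < N} \<and>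
        (\<forall>t\<ge>0. \<forall>\<omega>\<in>space M. \<Xi> t \<omega> = coalescing_set N (\<lambda>i s. \<xi> i s \<omega>) t))"

text \<open>\<open>t powr (- d / \<alpha>) \<and> t / r powr (d + \<alpha>)\<close>, where the second term is \<open>+\<infinity>\<close> for \<open>r = 0\<close> (in HOL the
  quotient would be \<open>0\<close>).\<close>

definition profile :: "real \<Rightarrow> real \<Rightarrow> real \<Rightarrow> real \<Rightarrow> real" where
  "profile d \<alpha> t r =
     (if r = 0 then t powr (- d / \<alpha>) else min (t powr (- d / \<alpha>)) (t / r powr (d + \<alpha>)))"

end

theory Submission
  imports Defs
begin

text \<open>A system of finitely many particles is observed through its active particles, those not yet
  attached to a particle of smaller index. Their number at time \<open>t\<close> is the number of points that
  \<open>\<Xi>\<close> would contain at that time if the sequence of starting points stopped there. It suffices to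
  bound its expectation, for each \<open>t > 0\<close>, uniformly in the number \<open>n\<close> of particles
  (\<open>AE_finite_active\<close>): then almost surely only finitely many particles are active at each of the times
  \<open>1 / Suc n\<close>, and activity only decreases.

  The bound rests on the fact that two particles at distance at most \<open>2 * \<epsilon>\<close> meet within time
  \<open>\<epsilon> powr \<alpha>\<close> with probability at least some \<open>\<beta> > 0\<close>, given the past of all particles and uniformly in \<open>\<epsilon>\<close>.
  The number of times of a fine grid at which they are closer than \<open>\<eta>\<close> has first moment bounded below
  by the lower heat kernel bound. By the upper bound, and because \<open>w powr (- (d / \<alpha>))\<close> is
  integrable at \<open>0\<close> for \<open>d < \<alpha>\<close>, its second moment is at most a constant times the square of the
  first (\<open>second_moment_close\<close>). Hence the particles come within distance \<open>\<eta>\<close> with a probability bounded below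
  independently of \<open>\<eta>\<close>, and so with positive probability arbitrarily close (\<open>prob_near_ge\<close>).

  Coming arbitrarily close amounts to meeting, unless the two paths have a common left limit that one
  of them jumps away from. This almost surely does not happen (\<open>AE_no_jump_off\<close>): the paths are
  independent, one path has countably many jumps, and the other one has a bounded density at each
  positive time. As a further consequence, meeting and activity are, up to null sets, determined by
  the positions at countably many times and thus events of the past (\<open>active_measurable\<close>).

  The space is covered by at most \<open>K * \<epsilon> powr (- d)\<close> cells of diameter at most \<open>2 * \<epsilon>\<close>. Each active particle,
  except the first one of each cell, is paired with its predecessor in its cell. A meeting of a
  pair deactivates one of its members, and each particle belongs to at most two pairs. Therefore,
  within time \<open>\<epsilon> powr \<alpha>\<close>, the expected number of active particles loses a fixed proportion of its
  excess over \<open>K * \<epsilon> powr (- d)\<close> (\<open>mean_active_step\<close>). When this is used with \<open>\<epsilon>\<close> adapted to the present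
  number of particles, the times needed to pass between successive levels of a geometric
  sequence are themselves summable geometrically, so that the expected number comes down from any
  initial value to a fixed level by time \<open>T\<close> (\<open>comes_down_from_infinity\<close>).\<close>

section \<open>Coalescence along fixed paths\<close>

text \<open>Particle \<open>i\<close> is active at time \<open>t\<close> if it has not yet been attached to a particle of smaller
  index.\<close>

definition active :: "(nat \<Rightarrow> real \<Rightarrow> 'a) \<Rightarrow> nat \<Rightarrow> real \<Rightarrow> bool" where
  "active \<xi> i t \<longleftrightarrow> ereal t < first_meeting (map (coalesced \<xi>) [0..<i]) (\<xi> i)"

lemma first_meeting_le:
  assumes "0 \<le> u" "j < i" "\<xi> i u = coalesced \<xi> j u"
  shows "first_meeting (map (coalesced \<xi>) [0..<i]) (\<xi> i) \<le> ereal u"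
  unfolding first_meeting_def by (rule Inf_lower) (use assms in auto)

lemma coalesced_active:
  assumes "active \<xi> i t"
  shows "coalesced \<xi> i t = \<xi> i t"
  using assms by (subst coalesced.simps) (simp add: attach_def active_def Let_def)

lemma active_mono:
  assumes "active \<xi> i t" "u \<le> t"
  shows "active \<xi> i u"
  using assms unfolding active_def by (meson ereal_less_eq(3) le_less_trans)

lemma active_not_meeting:
  assumes "active \<xi> i t" "0 \<le> u" "u \<le> t" "j < i"
  shows "\<xi> i u \<noteq> coalesced \<xi> j u"
proof
  assume "\<xi> i u = coalesced \<xi> j u"
  then have "first_meeting (map (coalesced \<xi>) [0..<i]) (\<xi> i) \<le> ereal u"
    using first_meeting_le assms by blast
  moreover have "ereal u \<le> ereal t" using assms by simp
  ultimately show False using assms(1) unfolding active_def by (meson dual_order.strict_trans1 not_le)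
qed

text \<open>Right-continuity on \<open>{0..}\<close>.\<close>

definition right_cont :: "(real \<Rightarrow> 'a::topological_space) \<Rightarrow> bool" where
  "right_cont f \<longleftrightarrow> (\<forall>t\<ge>0. (f \<longlongrightarrow> f t) (at_right t))"

lemma first_meeting_attained:
  fixes f :: "real \<Rightarrow> 'a::t2_space"
  assumes rc: "right_cont f" "\<And>z. z \<in> set zs \<Longrightarrow> right_cont z"
    and le: "first_meeting zs f \<le> ereal t"
  obtains T j where "first_meeting zs f = ereal T" "0 \<le> T" "j < length zs" "f T = (zs ! j) T"
proof -
  define S where "S = {t. 0 \<le> t \<and> f t \<in> (\<lambda>z. z t) ` set zs}"
  have fm: "first_meeting zs f = Inf (ereal ` S)"
    by (simp add: first_meeting_def S_def)
  have ne: "S \<noteq> {}"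
    using le unfolding fm by (auto simp: top_ereal_def)
  have bdd: "bdd_below S" by (rule bdd_belowI[of _ 0]) (simp add: S_def)
  define T where "T = Inf S"
  have T: "first_meeting zs f = ereal T"
    unfolding fm T_def using ereal_Inf'[OF bdd ne] by simp
  have T0: "0 \<le> T" unfolding T_def by (rule cInf_greatest[OF ne]) (simp add: S_def)
  have "T \<in> S"
  proof (rule ccontr)
    assume nT: "T \<notin> S"
    have ev: "eventually (\<lambda>u. f u \<noteq> z u) (at_right T)" if "z \<in> set zs" for z
    proof -
      have "f T \<noteq> z T" using nT T0 that by (auto simp: S_def)
      then obtain U V where UV: "open U" "open V" "f T \<in> U" "z T \<in> V" "U \<inter> V = {}"
        using hausdorff[of "f T" "z T"] by auto
      have lim: "(f \<longlongrightarrow> f T) (at_right T)" "(z \<longlongrightarrow> z T) (at_right T)"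
        using rc T0 that unfolding right_cont_def by auto
      have "eventually (\<lambda>u. f u \<in> U) (at_right T)" "eventually (\<lambda>u. z u \<in> V) (at_right T)"
        using topological_tendstoD[OF lim(1) UV(1,3)] topological_tendstoD[OF lim(2) UV(2,4)] by auto
      then show ?thesis by (rule eventually_elim2) (use UV(5) in auto)
    qed
    have "eventually (\<lambda>u. \<forall>z\<in>set zs. f u \<noteq> z u) (at_right T)"
      using ev by (intro eventually_ball_finite) auto
    then obtain b where b: "T < b" "\<And>u. T < u \<Longrightarrow> u < b \<Longrightarrow> \<forall>z\<in>set zs. f u \<noteq> z u"
      unfolding eventually_at_right_field by blast
    from cInf_lessD[OF ne, of b] b(1) obtain u where u: "u \<in> S" "u < b" unfolding T_def by auto
    moreover have "T \<le> u" unfolding T_def using u(1) bdd by (rule cInf_lower)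
    ultimately show False using b(2)[of u] nT by (cases "u = T") (auto simp: S_def)
  qed
  then obtain z where "z \<in> set zs" "f T = z T" by (auto simp: S_def)
  then show ?thesis using that T T0 by (metis in_set_conv_nth)
qed

text \<open>An inactive particle sits with a particle of smaller index that its own free path has met
  before. The induction also carries the right-continuity of the coalesced paths, by which first
  meeting times are attained.\<close>

lemma inactive_coalesced:
  fixes \<xi> :: "nat \<Rightarrow> real \<Rightarrow> 'a::t2_space"
  assumes rc: "\<forall>i. right_cont (\<xi> i)"
  shows "\<not> active \<xi> i t \<Longrightarrow> \<exists>j<i. coalesced \<xi> i t = coalesced \<xi> j t \<and>
           (\<exists>u. 0 \<le> u \<and> u \<le> t \<and> \<xi> i u = coalesced \<xi> j u)"
proof -
  have main: "right_cont (coalesced \<xi> i) \<and> (\<forall>t. \<not> active \<xi> i t \<longrightarrow>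
     (\<exists>j<i. coalesced \<xi> i t = coalesced \<xi> j t \<and> (\<exists>u. 0 \<le> u \<and> u \<le> t \<and> \<xi> i u = coalesced \<xi> j u)))" for i
  proof (induction i rule: less_induct)
    case (less i)
    let ?zs = "map (coalesced \<xi>) [0..<i]"
    let ?F = "first_meeting ?zs (\<xi> i)"
    have rcz: "\<And>z. z \<in> set ?zs \<Longrightarrow> right_cont z" using less by auto
    show ?case
    proof (cases "?F = \<infinity>")
      case True
      then have "coalesced \<xi> i = \<xi> i" "\<And>t. active \<xi> i t"
        by (auto simp: coalesced.simps[of \<xi> i] attach_def active_def Let_def)
      then show ?thesis using rc by auto
    next
      case False
      then obtain t0 where "?F \<le> ereal t0" by (cases ?F) auto
      from first_meeting_attained[OF rc[rule_format] rcz this] obtain T j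
        where T: "?F = ereal T" "0 \<le> T" "j < i" "\<xi> i T = coalesced \<xi> j T"
        by auto
      define J where "J = (LEAST j. j < length ?zs \<and> \<xi> i T = (?zs ! j) T)"
      have "J < length ?zs \<and> \<xi> i T = (?zs ! J) T"
        unfolding J_def by (rule LeastI[of _ j]) (use T in auto)
      then have J: "J < i" "\<xi> i T = coalesced \<xi> J T" by auto
      have eq: "coalesced \<xi> i t = (if t < T then \<xi> i t else coalesced \<xi> J t)" for t
        unfolding coalesced.simps[of \<xi> i] attach_def Let_def T(1) real_of_ereal.simps J_def[symmetric]
        using J(1) by simp
      have "right_cont (coalesced \<xi> i)" unfolding right_cont_def
      proof safe
        fix t :: real assume "0 \<le> t"
        show "(coalesced \<xi> i \<longlongrightarrow> coalesced \<xi> i t) (at_right t)"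
        proof (cases "t < T")
          case True
          have "(\<xi> i \<longlongrightarrow> \<xi> i t) (at_right t)" using rc \<open>0 \<le> t\<close> by (auto simp: right_cont_def)
          moreover have "eventually (\<lambda>u. \<xi> i u = coalesced \<xi> i u) (at_right t)"
            using True by (auto simp: eventually_at_right_field eq intro!: exI[of _ T])
          ultimately have "(coalesced \<xi> i \<longlongrightarrow> \<xi> i t) (at_right t)"
            using Lim_transform_eventually by blast
          then show ?thesis using True by (simp add: eq)
        next
          case False
          have "(coalesced \<xi> J \<longlongrightarrow> coalesced \<xi> J t) (at_right t)"
            using less[OF J(1)] \<open>0 \<le> t\<close> by (auto simp: right_cont_def)
          moreover have "eventually (\<lambda>u. coalesced \<xi> J u = coalesced \<xi> i u) (at_right t)"
            using False by (auto simp: eventually_at_right_field eq intro!: exI[of _ "t + 1"])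
          ultimately have "(coalesced \<xi> i \<longlongrightarrow> coalesced \<xi> J t) (at_right t)"
            using Lim_transform_eventually by blast
          then show ?thesis using False by (simp add: eq)
        qed
      qed
      moreover have "\<exists>j<i. coalesced \<xi> i t = coalesced \<xi> j t \<and>
          (\<exists>u. 0 \<le> u \<and> u \<le> t \<and> \<xi> i u = coalesced \<xi> j u)" if "\<not> active \<xi> i t" for t
      proof -
        have "T \<le> t" using that T(1) by (simp add: active_def)
        then show ?thesis using J T(2) eq by (intro exI[of _ J]) auto
      qed
      ultimately show ?thesis by blast
    qed
  qed
  show "\<not> active \<xi> i t \<Longrightarrow> \<exists>j<i. coalesced \<xi> i t = coalesced \<xi> j t \<and>
           (\<exists>u. 0 \<le> u \<and> u \<le> t \<and> \<xi> i u = coalesced \<xi> j u)" using main by blast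
qed

lemma coalesced_eq_active:
  fixes \<xi> :: "nat \<Rightarrow> real \<Rightarrow> 'a::t2_space"
  assumes rc: "\<forall>i. right_cont (\<xi> i)"
  shows "\<exists>l\<le>i. active \<xi> l t \<and> coalesced \<xi> i t = \<xi> l t"
proof (induction i rule: less_induct)
  case (less i)
  show ?case
  proof (cases "active \<xi> i t")
    case True
    then show ?thesis using coalesced_active by blast
  next
    case False
    then obtain j where "j < i" "coalesced \<xi> i t = coalesced \<xi> j t"
      using inactive_coalesced[OF rc] by blast
    moreover obtain l where "l \<le> j" "active \<xi> l t" "coalesced \<xi> j t = \<xi> l t"
      using less[OF \<open>j < i\<close>] by blast
    ultimately show ?thesis by (intro exI[of _ l]) auto
  qed
qed

text \<open>Deactivation is expressed by meetings of the free paths alone.\<close>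

lemma not_active_iff:
  fixes \<xi> :: "nat \<Rightarrow> real \<Rightarrow> 'a::t2_space"
  assumes rc: "\<forall>i. right_cont (\<xi> i)"
  shows "\<not> active \<xi> i t \<longleftrightarrow> (\<exists>j<i. \<exists>u. 0 \<le> u \<and> u \<le> t \<and> \<xi> i u = \<xi> j u \<and> active \<xi> j u)"
proof
  assume "\<not> active \<xi> i t"
  then obtain j u where j: "j < i" "0 \<le> u" "u \<le> t" "\<xi> i u = coalesced \<xi> j u"
    using inactive_coalesced[OF rc] by blast
  moreover obtain l where "l \<le> j" "active \<xi> l u" "coalesced \<xi> j u = \<xi> l u"
    using coalesced_eq_active[OF rc] by blast
  ultimately show "\<exists>j<i. \<exists>u. 0 \<le> u \<and> u \<le> t \<and> \<xi> i u = \<xi> j u \<and> active \<xi> j u"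
    by (metis le_less_trans)
next
  assume "\<exists>j<i. \<exists>u. 0 \<le> u \<and> u \<le> t \<and> \<xi> i u = \<xi> j u \<and> active \<xi> j u"
  then obtain j u where "j < i" "0 \<le> u" "u \<le> t" "\<xi> i u = \<xi> j u" "active \<xi> j u" by blast
  then show "\<not> active \<xi> i t" using active_not_meeting coalesced_active by metis
qed

lemma active_pair_not_meeting:
  fixes \<xi> :: "nat \<Rightarrow> real \<Rightarrow> 'a::t2_space"
  assumes rc: "\<forall>i. right_cont (\<xi> i)"
    and "active \<xi> i t" "active \<xi> j t" "i \<noteq> j" "0 \<le> u" "u \<le> t"
  shows "\<xi> i u \<noteq> \<xi> j u"
proof
  assume eq: "\<xi> i u = \<xi> j u"
  have "active \<xi> i u" "active \<xi> j u" using assms active_mono by blast+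
  show False
  proof (cases "j < i")
    case True
    then have "\<not> active \<xi> i t"
      unfolding not_active_iff[OF rc] using eq assms(5,6) \<open>active \<xi> j u\<close> by blast
    then show False using assms(2) by blast
  next
    case False
    then have "i < j" using \<open>i \<noteq> j\<close> by simp
    then have "\<not> active \<xi> j t"
      unfolding not_active_iff[OF rc] using eq[symmetric] assms(5,6) \<open>active \<xi> i u\<close> by blast
    then show False using assms(3) by blast
  qed
qed

lemma not_active_iff_rat:
  fixes \<xi> :: "nat \<Rightarrow> real \<Rightarrow> 'a::t2_space"
  assumes rc: "\<forall>i. right_cont (\<xi> i)" and "0 \<le> t"
  shows "\<not> active \<xi> i t \<longleftrightarrow>
    (\<exists>j<i. \<exists>q\<in>insert t (\<rat> \<inter> {0..t}). (\<exists>u\<in>{0..q}. \<xi> i u = \<xi> j u) \<and> active \<xi> j q)"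
proof
  assume "\<not> active \<xi> i t"
  then obtain j u where j: "j < i" "0 \<le> u" "u \<le> t" "\<xi> i u = \<xi> j u" "active \<xi> j u"
    using not_active_iff[OF rc] by blast
  have "\<exists>q\<in>insert t (\<rat> \<inter> {0..t}). u \<le> q \<and> active \<xi> j q"
  proof (cases "u = t")
    case True
    then show ?thesis using j by auto
  next
    case False
    let ?F = "first_meeting (map (coalesced \<xi>) [0..<j]) (\<xi> j)"
    have "ereal u < min (ereal t) ?F" using False j by (auto simp: active_def)
    then obtain s where s: "ereal u < ereal s" "ereal s < min (ereal t) ?F"
      using ereal_dense2 by blast
    then have "u < s" by simp
    then obtain q where q: "q \<in> \<rat>" "u < q" "q < s" using Rats_dense_in_real by blast
    then have "ereal q < min (ereal t) ?F" using s by (meson less_ereal.simps(1) less_trans)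
    then show ?thesis using q j by (intro bexI[of _ q]) (auto simp: active_def)
  qed
  then show "\<exists>j<i. \<exists>q\<in>insert t (\<rat> \<inter> {0..t}). (\<exists>u\<in>{0..q}. \<xi> i u = \<xi> j u) \<and> active \<xi> j q"
    using j by (meson atLeastAtMost_iff)
next
  assume "\<exists>j<i. \<exists>q\<in>insert t (\<rat> \<inter> {0..t}). (\<exists>u\<in>{0..q}. \<xi> i u = \<xi> j u) \<and> active \<xi> j q"
  then obtain j q u where "j < i" "q \<le> t" "0 \<le> u" "u \<le> q" "\<xi> i u = \<xi> j u" "active \<xi> j q"
    using \<open>0 \<le> t\<close> by fastforce
  then show "\<not> active \<xi> i t"
    using not_active_iff[OF rc, of i t] active_mono[of \<xi> j q u] by (meson order_trans)
qed

lemma finite_coalescing_set: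
  fixes \<xi> :: "nat \<Rightarrow> real \<Rightarrow> 'a::t2_space"
  assumes rc: "\<forall>i. right_cont (\<xi> i)" and "finite {i. active \<xi> i s}" "s \<le> t"
  shows "finite (coalescing_set \<infinity> \<xi> t)"
proof -
  have "{coalesced \<xi> i t |i. enat i < \<infinity>} \<subseteq> (\<lambda>l. \<xi> l t) ` {i. active \<xi> i s}"
  proof safe
    fix i
    obtain l where "active \<xi> l t" "coalesced \<xi> i t = \<xi> l t"
      using coalesced_eq_active[OF rc] by blast
    then show "coalesced \<xi> i t \<in> (\<lambda>l. \<xi> l t) ` {i. active \<xi> i s}"
      using active_mono[OF _ assms(3)] by auto
  qed
  then have "finite {coalesced \<xi> i t |i. enat i < \<infinity>}"
    using assms(2) by (meson finite_imageI finite_subset)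
  then show ?thesis unfolding coalescing_set_def
    by (simp add: finite_imp_closed)
qed

section \<open>Meetings of right-continuous paths with left limits\<close>

lemma cadlag_right_cont: "cadlag f \<Longrightarrow> right_cont f"
  by (simp add: cadlag_def right_cont_def)

text \<open>Two paths never jump away from a common left limit.\<close>

definition no_jump_off :: "(real \<Rightarrow> 'a::topological_space) \<Rightarrow> (real \<Rightarrow> 'a) \<Rightarrow> bool" where
  "no_jump_off f g \<longleftrightarrow>
     (\<forall>u>0. \<forall>l. (f \<longlongrightarrow> l) (at_left u) \<and> (g \<longlongrightarrow> l) (at_left u) \<longrightarrow> f u = g u)"

lemma close_at_rational:
  fixes f g :: "real \<Rightarrow> 'a::metric_space"
  assumes "right_cont f" "right_cont g" "0 \<le> u" "a \<le> u" "u \<le> b" "dist (f u) (g u) < e"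
  shows "\<exists>v\<in>insert b (\<rat> \<inter> {a..b}). dist (f v) (g v) < e"
proof (cases "u = b")
  case True
  then show ?thesis using assms by auto
next
  case False
  have "((\<lambda>v. dist (f v) (g v)) \<longlongrightarrow> dist (f u) (g u)) (at_right u)"
    using assms unfolding right_cont_def by (intro tendsto_dist) blast+
  then have "eventually (\<lambda>v. dist (f v) (g v) < e) (at_right u)"
    by (rule order_tendstoD) (use assms in auto)
  then obtain c where c: "u < c" "\<And>v. u < v \<Longrightarrow> v < c \<Longrightarrow> dist (f v) (g v) < e"
    unfolding eventually_at_right_field by blast
  have "u < min b c" using False assms c by auto
  then obtain q where "q \<in> \<rat>" "u < q" "q < min b c" using Rats_dense_in_real by blast
  then show ?thesis using c assms by (intro bexI[of _ q]) auto
qed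

lemma meeting_iff_close:
  fixes f g :: "real \<Rightarrow> 'a::metric_space"
  assumes "cadlag f" "cadlag g" and good: "no_jump_off f g" and ab: "0 \<le> a" "a \<le> b"
  shows "(\<exists>u\<in>{a..b}. f u = g u) \<longleftrightarrow>
    (\<forall>m. \<exists>v\<in>insert b (\<rat> \<inter> {a..b}). dist (f v) (g v) < 1 / real (Suc m))"
proof
  assume "\<exists>u\<in>{a..b}. f u = g u"
  then obtain u where u: "a \<le> u" "u \<le> b" "f u = g u" by auto
  then show "\<forall>m. \<exists>v\<in>insert b (\<rat> \<inter> {a..b}). dist (f v) (g v) < 1 / real (Suc m)"
    using close_at_rational[OF cadlag_right_cont[OF assms(1)] cadlag_right_cont[OF assms(2)], of u a b] ab
    by auto
next
  assume close: "\<forall>m. \<exists>v\<in>insert b (\<rat> \<inter> {a..b}). dist (f v) (g v) < 1 / real (Suc m)"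
  show "\<exists>u\<in>{a..b}. f u = g u"
  proof (rule ccontr)
    assume no: "\<not> (\<exists>u\<in>{a..b}. f u = g u)"
    define sep where "sep c d \<longleftrightarrow> (\<exists>\<delta>>0. \<forall>v\<in>{a..b}. c \<le> v \<and> v \<le> d \<longrightarrow> \<delta> \<le> dist (f v) (g v))" for c d
    have "sep a b"
    proof (rule Bolzano[OF ab(2), of sep])
      fix c d e assume "sep c d" "sep d e" "c \<le> d" "d \<le> e"
      then obtain \<delta>1 \<delta>2 where "\<delta>1 > 0" "\<forall>v\<in>{a..b}. c \<le> v \<and> v \<le> d \<longrightarrow> \<delta>1 \<le> dist (f v) (g v)"
         "\<delta>2 > 0" "\<forall>v\<in>{a..b}. d \<le> v \<and> v \<le> e \<longrightarrow> \<delta>2 \<le> dist (f v) (g v)"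
        unfolding sep_def by blast
      then have "\<forall>v\<in>{a..b}. c \<le> v \<and> v \<le> e \<longrightarrow> min \<delta>1 \<delta>2 \<le> dist (f v) (g v)"
        by (meson linorder_le_cases min.coboundedI1 min.coboundedI2)
      then show "sep c e" unfolding sep_def using \<open>\<delta>1 > 0\<close> \<open>\<delta>2 > 0\<close>
        by (intro exI[of _ "min \<delta>1 \<delta>2"]) simp
    next
      fix u assume u: "a \<le> u" "u \<le> b"
      then have u0: "0 \<le> u" using ab by simp
      have ne: "0 < dist (f u) (g u)" using no u by auto
      have "((\<lambda>v. dist (f v) (g v)) \<longlongrightarrow> dist (f u) (g u)) (at_right u)"
        using assms(1,2) u0 unfolding cadlag_def by (intro tendsto_dist) blast+
      then have "eventually (\<lambda>v. dist (f u) (g u) / 2 < dist (f v) (g v)) (at_right u)"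
        by (rule order_tendstoD) (use ne in auto)
      then obtain r where r: "u < r" "\<And>v. u < v \<Longrightarrow> v < r \<Longrightarrow> dist (f u) (g u) / 2 < dist (f v) (g v)"
        unfolding eventually_at_right_field by blast
      have "\<exists>l<u. \<exists>\<delta>>0. \<forall>v. l < v \<longrightarrow> v < u \<longrightarrow> 0 \<le> v \<longrightarrow> \<delta> \<le> dist (f v) (g v)"
      proof (cases "u = 0")
        case True
        then show ?thesis by (intro exI[of _ "-1"]) (auto intro!: exI[of _ 1])
      next
        case False
        then have up: "u > 0" using u0 by simp
        then obtain lf lg where l: "(f \<longlongrightarrow> lf) (at_left u)" "(g \<longlongrightarrow> lg) (at_left u)"
          using assms(1,2) unfolding cadlag_def by blast
        have "lf \<noteq> lg" using good up l ne unfolding no_jump_off_def by auto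
        then have pos: "0 < dist lf lg" by simp
        have "((\<lambda>v. dist (f v) (g v)) \<longlongrightarrow> dist lf lg) (at_left u)"
          using l by (intro tendsto_dist)
        then have "eventually (\<lambda>v. dist lf lg / 2 < dist (f v) (g v)) (at_left u)"
          by (rule order_tendstoD) (use pos in auto)
        then obtain l where "l < u" "\<And>v. l < v \<Longrightarrow> v < u \<Longrightarrow> dist lf lg / 2 < dist (f v) (g v)"
          unfolding eventually_at_left_field by blast
        then show ?thesis using pos
          by (intro exI[of _ l] conjI exI[of _ "dist lf lg / 2"]) (auto intro: less_imp_le)
      qed
      then obtain l \<delta> where l: "l < u" "\<delta> > 0"
          "\<And>v. l < v \<Longrightarrow> v < u \<Longrightarrow> 0 \<le> v \<Longrightarrow> \<delta> \<le> dist (f v) (g v)" by blast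
      show "\<exists>h>0. \<forall>c d. c \<le> u \<and> u \<le> d \<and> d - c < h \<longrightarrow> sep c d"
      proof (intro exI[of _ "min (u - l) (r - u)"] conjI allI impI)
        show "0 < min (u - l) (r - u)" using l r by simp
        fix c d assume cd: "c \<le> u \<and> u \<le> d \<and> d - c < min (u - l) (r - u)"
        show "sep c d" unfolding sep_def
        proof (intro exI[of _ "min \<delta> (dist (f u) (g u) / 2)"] conjI ballI impI)
          show "0 < min \<delta> (dist (f u) (g u) / 2)" using l ne by simp
          fix v assume v: "v \<in> {a..b}" "c \<le> v \<and> v \<le> d"
          have "l < v" "v < r" "0 \<le> v" using cd v ab by auto
          then show "min \<delta> (dist (f u) (g u) / 2) \<le> dist (f v) (g v)"
            using l(3)[of v] r(2)[of v] ne by (cases v u rule: linorder_cases) (auto simp: min_le_iff_disj)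
        qed
      qed
    qed
    then obtain \<delta> where \<delta>: "\<delta> > 0" "\<forall>v\<in>{a..b}. \<delta> \<le> dist (f v) (g v)" unfolding sep_def by auto
    obtain m where m: "1 / real (Suc m) < \<delta>" by (rule nat_approx_posE[OF \<delta>(1)])
    obtain v where v: "v \<in> insert b (\<rat> \<inter> {a..b})" "dist (f v) (g v) < 1 / real (Suc m)"
      using close by blast
    from v(1) have "v \<in> {a..b}" using ab by auto
    with \<delta>(2) have "\<delta> \<le> dist (f v) (g v)" by blast
    with v(2) m show False by simp
  qed
qed

section \<open>The Markov property in the presence of independent particles\<close>

lemma nn_integral_indep_event:
  assumes "prob_space M" and sub: "subalgebra M F" and C: "C \<in> sets M"
    and indep: "\<And>B. B \<in> sets F \<Longrightarrow> emeasure M (B \<inter> C) = emeasure M B * emeasure M C"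
    and f: "f \<in> borel_measurable F"
  shows "(\<integral>\<^sup>+\<omega>. f \<omega> * indicator C \<omega> \<partial>M) = emeasure M C * (\<integral>\<^sup>+\<omega>. f \<omega> \<partial>M)"
proof -
  interpret prob_space M by fact
  let ?D = "density M (indicator C)"
  have subD: "subalgebra ?D F" using sub by (simp add: subalgebra_def)
  have FM: "\<And>B. B \<in> sets F \<Longrightarrow> B \<in> sets M" using sub by (auto simp: subalgebra_def)
  have fM: "f \<in> borel_measurable M" by (rule measurable_from_subalg[OF sub f])
  have eq: "restr_to_subalg ?D F = scale_measure (emeasure M C) (restr_to_subalg M F)"
  proof (rule measure_eqI)
    show "sets (restr_to_subalg ?D F) = sets (scale_measure (emeasure M C) (restr_to_subalg M F))"
      using sub subD by (simp add: sets_restr_to_subalg)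
    fix B assume "B \<in> sets (restr_to_subalg ?D F)"
    then have B: "B \<in> sets F" using subD by (simp add: sets_restr_to_subalg)
    have "emeasure (restr_to_subalg ?D F) B = emeasure M (C \<inter> B)"
      using B FM[OF B] C by (simp add: emeasure_restr_to_subalg[OF subD] emeasure_density nn_integral_set_ennreal
        flip: indicator_inter_arith)
    then show "emeasure (restr_to_subalg ?D F) B = emeasure (scale_measure (emeasure M C) (restr_to_subalg M F)) B"
      using indep[OF B] B by (simp add: emeasure_restr_to_subalg[OF sub] Int_commute mult.commute)
  qed
  have "(\<integral>\<^sup>+\<omega>. f \<omega> * indicator C \<omega> \<partial>M) = (\<integral>\<^sup>+\<omega>. f \<omega> \<partial>?D)"
    using fM C by (simp add: nn_integral_density mult.commute)
  also have "\<dots> = (\<integral>\<^sup>+\<omega>. f \<omega> \<partial>restr_to_subalg ?D F)"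
    by (rule nn_integral_subalgebra2[symmetric, OF subD f])
  also have "\<dots> = emeasure M C * (\<integral>\<^sup>+\<omega>. f \<omega> \<partial>restr_to_subalg M F)"
    unfolding eq by (rule nn_integral_scale_measure) (simp add: f measurable_in_subalg sub)
  also have "(\<integral>\<^sup>+\<omega>. f \<omega> \<partial>restr_to_subalg M F) = (\<integral>\<^sup>+\<omega>. f \<omega> \<partial>M)"
    by (rule nn_integral_subalgebra2[OF sub f])
  finally show ?thesis .
qed

text \<open>A kernel that gives the conditional law of \<open>V\<close> given \<open>H\<close> on rectangles also gives it on
  jointly measurable sets.\<close>

lemma kernel_disintegration:
  assumes "prob_space M" and sub: "subalgebra M H"
    and V[measurable]: "V \<in> M \<rightarrow>\<^sub>M N" and kap[measurable]: "\<kappa> \<in> H \<rightarrow>\<^sub>M prob_algebra N"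
    and rect: "\<And>B A. B \<in> sets H \<Longrightarrow> A \<in> sets N \<Longrightarrow>
      emeasure M (B \<inter> V -` A) = (\<integral>\<^sup>+\<omega>. emeasure (\<kappa> \<omega>) A * indicator B \<omega> \<partial>M)"
    and G: "G \<in> sets (H \<Otimes>\<^sub>M N)"
  shows "emeasure M {\<omega>\<in>space M. (\<omega>, V \<omega>) \<in> G} = (\<integral>\<^sup>+\<omega>. emeasure (\<kappa> \<omega>) (Pair \<omega> -` G) \<partial>M)"
proof -
  interpret prob_space M by fact
  have sp: "space H = space M" using sub by (simp add: subalgebra_def)
  have idm: "(\<lambda>\<omega>. \<omega>) \<in> M \<rightarrow>\<^sub>M H" using measurable_id[of H] by (simp add: id_def measurable_from_subalg[OF sub])
  have map: "(\<lambda>\<omega>. (\<omega>, V \<omega>)) \<in> M \<rightarrow>\<^sub>M H \<Otimes>\<^sub>M N" using idm V by (rule measurable_Pair)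
  have meas: "{\<omega>\<in>space M. (\<omega>, V \<omega>) \<in> G} \<in> sets M" if "G \<in> sets (H \<Otimes>\<^sub>M N)" for G
    using measurable_sets[OF map that] by (simp add: vimage_def Int_def conj_commute)
  have kapp: "prob_space (\<kappa> \<omega>)" "sets (\<kappa> \<omega>) = sets N" if "\<omega> \<in> space M" for \<omega>
    using measurable_space[OF kap, of \<omega>] that sp by (auto simp: space_prob_algebra)
  have kmeas: "(\<lambda>\<omega>. emeasure (\<kappa> \<omega>) (Pair \<omega> -` G)) \<in> borel_measurable M" if "G \<in> sets (H \<Otimes>\<^sub>M N)" for G
  proof -
    have "(SIGMA \<omega>:space H. Pair \<omega> -` G) = G"
      using sets.sets_into_space[OF that] by (auto simp: space_pair_measure)
    then have "(\<lambda>\<omega>. emeasure (\<kappa> \<omega>) (Pair \<omega> -` G)) \<in> borel_measurable H"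
      using that by (intro emeasure_measurable_subprob_algebra2[OF _ measurable_prob_algebraD[OF kap]]) simp
    then show ?thesis by (rule measurable_from_subalg[OF sub])
  qed
  have sG: "Pair \<omega> -` G \<in> sets N" if "G \<in> sets (H \<Otimes>\<^sub>M N)" for G \<omega>
    using that by (rule sets_Pair1)
  have gen: "G \<in> sigma_sets (space H \<times> space N) {a \<times> b |a b. a \<in> sets H \<and> b \<in> sets N}"
    using G by (simp add: sets_pair_measure)
  have inP: "{a \<times> b |a b. a \<in> sets H \<and> b \<in> sets N} \<subseteq> Pow (space H \<times> space N)"
    using sets.sets_into_space[of _ H] sets.sets_into_space[of _ N] by fast
  show ?thesis using Int_stable_pair_measure_generator inP gen
  proof (induct rule: sigma_sets_induct_disjoint)
    case (basic G)
    then obtain B A where G: "G = B \<times> A" "B \<in> sets H" "A \<in> sets N" by auto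
    have "{\<omega>\<in>space M. (\<omega>, V \<omega>) \<in> G} = B \<inter> V -` A"
      using sets.sets_into_space[OF G(2)] sp G(1) by auto
    moreover have "emeasure (\<kappa> \<omega>) (Pair \<omega> -` G) = emeasure (\<kappa> \<omega>) A * indicator B \<omega>" for \<omega>
      by (auto simp: G(1) indicator_def)
    ultimately show ?case using rect[OF G(2,3)] by simp
  next
    case empty
    then show ?case by simp
  next
    case (compl G)
    then have G: "G \<in> sets (H \<Otimes>\<^sub>M N)" by (simp add: sets_pair_measure)
    have "{\<omega>\<in>space M. (\<omega>, V \<omega>) \<in> space H \<times> space N - G} = space M - {\<omega>\<in>space M. (\<omega>, V \<omega>) \<in> G}"
      using measurable_space[OF V] sp by auto
    then have "emeasure M {\<omega>\<in>space M. (\<omega>, V \<omega>) \<in> space H \<times> space N - G}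
        = 1 - emeasure M {\<omega>\<in>space M. (\<omega>, V \<omega>) \<in> G}"
      using emeasure_compl[OF meas[OF G]] by (simp add: emeasure_space_1)
    also have "\<dots> = (\<integral>\<^sup>+\<omega>. 1 \<partial>M) - (\<integral>\<^sup>+\<omega>. emeasure (\<kappa> \<omega>) (Pair \<omega> -` G) \<partial>M)"
      using compl by (simp add: emeasure_space_1)
    also have "\<dots> = (\<integral>\<^sup>+\<omega>. 1 - emeasure (\<kappa> \<omega>) (Pair \<omega> -` G) \<partial>M)"
    proof (rule nn_integral_diff[symmetric])
      show "(\<integral>\<^sup>+ \<omega>. emeasure (\<kappa> \<omega>) (Pair \<omega> -` G) \<partial>M) \<noteq> \<infinity>"
        using compl(2)[symmetric] by simp
      show "AE \<omega> in M. emeasure (\<kappa> \<omega>) (Pair \<omega> -` G) \<le> 1"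
        using prob_space.measure_le_1[OF kapp(1)] by (auto simp: prob_space.emeasure_le_1 kapp)
    qed (use kmeas[OF G] in auto)
    also have "\<dots> = (\<integral>\<^sup>+\<omega>. emeasure (\<kappa> \<omega>) (Pair \<omega> -` (space H \<times> space N - G)) \<partial>M)"
    proof (rule nn_integral_cong)
      fix \<omega> assume w: "\<omega> \<in> space M"
      interpret K: prob_space "\<kappa> \<omega>" using kapp w by simp
      have "Pair \<omega> -` (space H \<times> space N - G) = space (\<kappa> \<omega>) - Pair \<omega> -` G"
        using w sp sets_eq_imp_space_eq[OF kapp(2)[OF w]] by auto
      then show "1 - emeasure (\<kappa> \<omega>) (Pair \<omega> -` G) = emeasure (\<kappa> \<omega>) (Pair \<omega> -` (space H \<times> space N - G))"
        using emeasure_compl[of "Pair \<omega> -` G" "\<kappa> \<omega>"] sG[OF G] kapp(2)[OF w] by (simp add: K.emeasure_space_1)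
    qed
    finally show ?case .
  next
    case (union A)
    then have A: "\<And>i. A i \<in> sets (H \<Otimes>\<^sub>M N)" by (auto simp: sets_pair_measure)
    have "{\<omega>\<in>space M. (\<omega>, V \<omega>) \<in> (\<Union>i. A i)} = (\<Union>i. {\<omega>\<in>space M. (\<omega>, V \<omega>) \<in> A i})" by auto
    moreover have "disjoint_family (\<lambda>i. {\<omega>\<in>space M. (\<omega>, V \<omega>) \<in> A i})"
      using union(1) by (auto simp: disjoint_family_on_def set_eq_iff)
    ultimately have "emeasure M {\<omega>\<in>space M. (\<omega>, V \<omega>) \<in> (\<Union>i. A i)}
        = (\<Sum>i. emeasure M {\<omega>\<in>space M. (\<omega>, V \<omega>) \<in> A i})"
      using meas[OF A] suminf_emeasure[of "\<lambda>i. {\<omega>\<in>space M. (\<omega>, V \<omega>) \<in> A i}" M]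
      by (simp add: image_subset_iff)
    also have "\<dots> = (\<Sum>i. \<integral>\<^sup>+\<omega>. emeasure (\<kappa> \<omega>) (Pair \<omega> -` A i) \<partial>M)" using union(3) by simp
    also have "\<dots> = (\<integral>\<^sup>+\<omega>. (\<Sum>i. emeasure (\<kappa> \<omega>) (Pair \<omega> -` A i)) \<partial>M)"
      using kmeas[OF A] by (simp add: nn_integral_suminf)
    also have "\<dots> = (\<integral>\<^sup>+\<omega>. emeasure (\<kappa> \<omega>) (Pair \<omega> -` (\<Union>i. A i)) \<partial>M)"
    proof (rule nn_integral_cong)
      fix \<omega> assume w: "\<omega> \<in> space M"
      show "(\<Sum>i. emeasure (\<kappa> \<omega>) (Pair \<omega> -` A i)) = emeasure (\<kappa> \<omega>) (Pair \<omega> -` (\<Union>i. A i))"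
        unfolding vimage_UN
        using sG[OF A] union(1) kapp(2)[OF w]
        by (intro suminf_emeasure) (auto simp: disjoint_family_on_def set_eq_iff)
    qed
    finally show ?case .
  qed
qed

text \<open>Countably many independent copies of the process, particle \<open>i\<close> being started at \<open>x i\<close>.\<close>

locale independent_copies = prob_space M for M :: "'b measure" +
  fixes P :: "real \<Rightarrow> 'a::polish_space \<Rightarrow> 'a measure" and x :: "nat \<Rightarrow> 'a"
    and \<xi> :: "nat \<Rightarrow> real \<Rightarrow> 'b \<Rightarrow> 'a"
  assumes kernel: "\<And>t. 0 \<le> t \<Longrightarrow> P t \<in> borel \<rightarrow>\<^sub>M prob_algebra borel"
    and process: "\<And>i. process_from M P (x i) (\<xi> i)"
    and independent: "indep_vars (\<lambda>i. \<Pi>\<^sub>M t\<in>{0..}. borel) (\<lambda>i \<omega>. \<lambda>t\<in>{0..}. \<xi> i t \<omega>) UNIV"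
begin

text \<open>The information carried by the positions of particle \<open>l\<close> at time \<open>u\<close>, for \<open>(l, u) \<in> K\<close>.\<close>

definition info :: "(nat \<times> real) set \<Rightarrow> 'b measure" where
  "info K = sigma (space M) {\<xi> l u -` A \<inter> space M | l u A. (l, u) \<in> K \<and> A \<in> sets borel}"

lemma measurable_\<xi>[measurable]: "0 \<le> t \<Longrightarrow> \<xi> i t \<in> M \<rightarrow>\<^sub>M borel"
  using process unfolding process_from_def by blast

lemma cadlag_\<xi>: "\<omega> \<in> space M \<Longrightarrow> cadlag (\<lambda>t. \<xi> i t \<omega>)"
  using process unfolding process_from_def by blast

lemma space_info[simp]: "space (info K) = space M"
  by (simp add: info_def space_measure_of_conv)

lemma sets_info:
  "sets (info K) = sigma_sets (space M) {\<xi> l u -` A \<inter> space M | l u A. (l, u) \<in> K \<and> A \<in> sets borel}"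
  unfolding info_def by (rule sets_measure_of) auto

lemma info_mono: "K \<subseteq> K' \<Longrightarrow> B \<in> sets (info K) \<Longrightarrow> B \<in> sets (info K')"
  unfolding sets_info by (rule sigma_sets_mono'[THEN subsetD]) auto

lemma measurable_info: "(l, u) \<in> K \<Longrightarrow> \<xi> l u \<in> info K \<rightarrow>\<^sub>M borel"
  by (rule measurableI) (auto simp: sets_info intro!: sigma_sets.Basic)

lemma subalgebra_info: "K \<subseteq> UNIV \<times> {0..} \<Longrightarrow> subalgebra M (info K)"
  unfolding subalgebra_def sets_info
  by (auto intro!: sets.sigma_sets_subset measurable_sets[OF measurable_\<xi>])

lemma sets_past: "sets (past M (\<xi> i) s) = sets (info ({i} \<times> {0..s}))"
proof -
  have "sets (past M (\<xi> i) s)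
      = sigma_sets (space M) {\<xi> i u -` A \<inter> space M |u A. 0 \<le> u \<and> u \<le> s \<and> A \<in> sets borel}"
    unfolding past_def by (rule sets_measure_of) auto
  also have "{\<xi> i u -` A \<inter> space M |u A. 0 \<le> u \<and> u \<le> s \<and> A \<in> sets borel}
      = {\<xi> l u -` A \<inter> space M | l u A. (l, u) \<in> {i} \<times> {0..s} \<and> A \<in> sets borel}"
    by auto
  finally show ?thesis unfolding sets_info .
qed

lemma indep_info:
  assumes K: "K \<subseteq> {i} \<times> {0..}" and L: "L \<subseteq> (-{i}) \<times> {0..}"
    and B: "B \<in> sets (info K)" and C: "C \<in> sets (info L)"
  shows "prob (B \<inter> C) = prob B * prob C"
proof -
  let ?X = "\<lambda>i \<omega>. \<lambda>t\<in>{0..}. \<xi> i t \<omega>"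
  let ?N = "(\<Pi>\<^sub>M t\<in>{0..}. borel) :: (real \<Rightarrow> 'a) measure"
  define E where "E l = {?X l -` A \<inter> space M | A. A \<in> sets ?N}" for l
  have indE: "indep_sets E UNIV"
    using independent unfolding indep_vars_def2 E_def by auto
  define I where "I = case_bool {i} (-{i})"
  have "indep_sets (\<lambda>b. sigma_sets (space M) (\<Union>l\<in>I b. E l)) UNIV"
  proof (rule indep_sets_collect_sigma)
    have "(\<Union>b\<in>UNIV. I b) = UNIV" by (auto simp: I_def UNIV_bool)
    then show "indep_sets E (\<Union>b\<in>UNIV. I b)" using indE by simp
    show "disjoint_family_on I UNIV" by (auto simp: disjoint_family_on_def I_def split: bool.splits)
    fix l show "Int_stable (E l)"
    proof (rule Int_stableI)
      fix a b assume "a \<in> E l" "b \<in> E l"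
      then obtain A A' where "a = ?X l -` A \<inter> space M" "b = ?X l -` A' \<inter> space M" "A \<in> sets ?N" "A' \<in> sets ?N"
        unfolding E_def by blast
      then show "a \<inter> b \<in> E l" unfolding E_def
        by (intro CollectI exI[of _ "A \<inter> A'"]) auto
    qed
  qed
  then have ind: "indep_set (sigma_sets (space M) (E i)) (sigma_sets (space M) (\<Union>l\<in>-{i}. E l))"
    unfolding indep_set_def
    by (rule indep_sets_mono_sets) (auto simp: I_def split: bool.splits)
  have inE: "\<xi> l u -` A \<inter> space M \<in> E l" if "0 \<le> u" "A \<in> sets borel" for l u A
  proof -
    have "(\<lambda>f. f u) -` A \<inter> space ?N \<in> sets ?N"
      using that by (intro measurable_sets[OF measurable_component_singleton]) auto
    moreover have "\<xi> l u -` A \<inter> space M = ?X l -` ((\<lambda>f. f u) -` A \<inter> space ?N) \<inter> space M"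
      using that by (auto simp: space_PiM)
    ultimately show ?thesis unfolding E_def by blast
  qed
  have "{\<xi> l u -` A \<inter> space M |l u A. (l, u) \<in> K \<and> A \<in> sets borel} \<subseteq> E i"
    using inE K by auto
  then have "B \<in> sigma_sets (space M) (E i)"
    using B unfolding sets_info by (rule sigma_sets_mono'[THEN subsetD])
  moreover have "{\<xi> l u -` A \<inter> space M |l u A. (l, u) \<in> L \<and> A \<in> sets borel} \<subseteq> (\<Union>l\<in>-{i}. E l)"
  proof
    fix D assume "D \<in> {\<xi> l u -` A \<inter> space M |l u A. (l, u) \<in> L \<and> A \<in> sets borel}"
    then obtain l u A where "D = \<xi> l u -` A \<inter> space M" "(l, u) \<in> L" "A \<in> sets borel" by blast
    moreover from this have "l \<in> -{i}" "0 \<le> u" using L by auto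
    ultimately show "D \<in> (\<Union>l\<in>-{i}. E l)" using inE by blast
  qed
  then have "C \<in> sigma_sets (space M) (\<Union>l\<in>-{i}. E l)"
    using C unfolding sets_info by (rule sigma_sets_mono'[THEN subsetD])
  ultimately show ?thesis using indep_setD[OF ind] by blast
qed

text \<open>All positions of the other particles, at all times, together with the past of particle \<open>i\<close> up
  to time \<open>s\<close>.\<close>

abbreviation H :: "nat \<Rightarrow> real \<Rightarrow> 'b measure" where
  "H i s \<equiv> info {(l, u). 0 \<le> u \<and> (l = i \<longrightarrow> u \<le> s)}"

lemma subalgebra_H: "subalgebra M (H i s)"
  by (rule subalgebra_info) auto

lemma prob_kernel: "0 \<le> t \<Longrightarrow> prob_space (P t y)" "0 \<le> t \<Longrightarrow> sets (P t y) = sets borel"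
  using measurable_space[OF kernel, of t y] by (auto simp: space_prob_algebra)

text \<open>The Markov property of one particle, first with respect to its own past, then with respect to
  \<open>H i s\<close> by independence, and finally for sets that also depend on the conditioning information.\<close>

lemma markov_past:
  assumes s: "0 \<le> s" and w: "0 \<le> w" and A: "A \<in> sets borel" and B: "B \<in> sets (past M (\<xi> i) s)"
  shows "emeasure M (B \<inter> \<xi> i (s + w) -` A)
    = (\<integral>\<^sup>+\<omega>. emeasure (P w (\<xi> i s \<omega>)) A * indicator B \<omega> \<partial>M)"
proof -
  have sub: "subalgebra M (past M (\<xi> i) s)"
    using subalgebra_info[of "{i} \<times> {0..s}"] unfolding subalgebra_def sets_past
    by (simp add: past_def space_measure_of_conv Sigma_mono)
  interpret F: finite_measure_subalgebra M "past M (\<xi> i) s"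
    by unfold_locales (rule sub)
  have BM: "B \<in> sets M" using B sub by (auto simp: subalgebra_def)
  have Ps: "(\<lambda>y. measure (P w y) A) \<in> borel_measurable borel"
    using kernel[OF w] A by measurable
  have Pm[measurable]: "(\<lambda>\<omega>. measure (P w (\<xi> i s \<omega>)) A) \<in> borel_measurable M"
    using measurable_compose[OF measurable_\<xi>[OF s] Ps] by simp
  have [measurable]: "\<xi> i (s + w) \<in> M \<rightarrow>\<^sub>M borel" using s w by simp
  have [measurable]: "A \<in> sets borel" "B \<in> sets M" by fact+
  have ev: "B \<inter> \<xi> i (s + w) -` A \<in> sets M"
  proof -
    have "B \<inter> \<xi> i (s + w) -` A = B \<inter> (\<xi> i (s + w) -` A \<inter> space M)"
      using sets.sets_into_space[OF BM] by auto
    then show ?thesis by simp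
  qed
  have AE: "AE \<omega> in M. real_cond_exp M (past M (\<xi> i) s) (\<lambda>\<omega>. indicat_real A (\<xi> i (s + w) \<omega>)) \<omega>
                    = measure (P w (\<xi> i s \<omega>)) A"
    using process[of i] s w A unfolding process_from_def by blast
  have int: "integrable M (\<lambda>\<omega>. indicat_real A (\<xi> i (s + w) \<omega>))"
    by (rule integrable_const_bound[where B=1]) (auto simp: indicator_def)
  have "prob (B \<inter> \<xi> i (s + w) -` A) = (\<integral>\<omega>\<in>B. indicat_real A (\<xi> i (s + w) \<omega>) \<partial>M)"
  proof -
    have "(\<integral>\<omega>\<in>B. indicat_real A (\<xi> i (s + w) \<omega>) \<partial>M) = (\<integral>\<omega>. indicat_real (B \<inter> \<xi> i (s + w) -` A) \<omega> \<partial>M)"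
      unfolding set_lebesgue_integral_def by (intro Bochner_Integration.integral_cong) (auto simp: indicator_def)
    then show ?thesis using ev by simp
  qed
  also have "\<dots> = (\<integral>\<omega>\<in>B. real_cond_exp M (past M (\<xi> i) s) (\<lambda>\<omega>. indicat_real A (\<xi> i (s + w) \<omega>)) \<omega> \<partial>M)"
    by (rule F.real_cond_exp_intA[OF int B])
  also have "\<dots> = (\<integral>\<omega>. measure (P w (\<xi> i s \<omega>)) A * indicator B \<omega> \<partial>M)"
    unfolding set_lebesgue_integral_def
    by (rule integral_cong_AE) (use AE in \<open>auto simp: mult.commute\<close>)
  finally have eq: "prob (B \<inter> \<xi> i (s + w) -` A) = (\<integral>\<omega>. measure (P w (\<xi> i s \<omega>)) A * indicator B \<omega> \<partial>M)" .
  have "integrable M (\<lambda>\<omega>. measure (P w (\<xi> i s \<omega>)) A * indicator B \<omega>)"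
    by (rule integrable_const_bound[where B=1])
       (auto simp: indicator_def prob_space.prob_le_1[OF prob_kernel(1)[OF w]])
  then have "(\<integral>\<^sup>+\<omega>. ennreal (measure (P w (\<xi> i s \<omega>)) A * indicator B \<omega>) \<partial>M)
     = ennreal (\<integral>\<omega>. measure (P w (\<xi> i s \<omega>)) A * indicator B \<omega> \<partial>M)"
    by (rule nn_integral_eq_integral) (auto simp: indicator_def)
  also have "\<dots> = emeasure M (B \<inter> \<xi> i (s + w) -` A)"
    using eq by (simp add: emeasure_eq_measure)
  finally show ?thesis
    by (simp add: ennreal_mult' ennreal_indicator
        finite_measure.emeasure_eq_measure[OF prob_space.finite_measure[OF prob_kernel(1)[OF w]]])
qed

lemma markov_rectangle:
  assumes s: "0 \<le> s" and w: "0 \<le> w" and A: "A \<in> sets borel" and B: "B \<in> sets (H i s)"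
  shows "emeasure M (B \<inter> \<xi> i (s + w) -` A)
    = (\<integral>\<^sup>+\<omega>. emeasure (P w (\<xi> i s \<omega>)) A * indicator B \<omega> \<partial>M)"
proof -
  let ?L = "(-{i}) \<times> {0::real..}"
  let ?F = "info ({i} \<times> {0..s})"
  define G where "G = {B \<inter> C | B C. B \<in> sets ?F \<and> C \<in> sets (info ?L)}"
  have subF: "subalgebra M ?F" and subL: "subalgebra M (info ?L)"
    by (rule subalgebra_info, auto)+
  then have FM: "\<And>B. B \<in> sets ?F \<Longrightarrow> B \<in> sets M" and LM: "\<And>B. B \<in> sets (info ?L) \<Longrightarrow> B \<in> sets M"
    by (auto simp: subalgebra_def)
  have stable: "Int_stable G"
  proof (rule Int_stableI)
    fix a b assume "a \<in> G" "b \<in> G"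
    then obtain B C B' C' where "a = B \<inter> C" "b = B' \<inter> C'" "B \<in> sets ?F" "C \<in> sets (info ?L)"
      "B' \<in> sets ?F" "C' \<in> sets (info ?L)" unfolding G_def by blast
    then show "a \<inter> b \<in> G" unfolding G_def
      by (intro CollectI exI[of _ "B \<inter> B'"] exI[of _ "C \<inter> C'"]) auto
  qed
  have pow: "G \<subseteq> Pow (space M)" using FM sets.sets_into_space by (fastforce simp: G_def)
  have "{\<xi> l u -` A \<inter> space M |l u A. (l, u) \<in> {(l, u). 0 \<le> u \<and> (l = i \<longrightarrow> u \<le> s)} \<and> A \<in> sets borel} \<subseteq> G"
  proof
    fix E assume "E \<in> {\<xi> l u -` A \<inter> space M |l u A. (l, u) \<in> {(l, u). 0 \<le> u \<and> (l = i \<longrightarrow> u \<le> s)} \<and> A \<in> sets borel}"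
    then obtain l u A where u: "0 \<le> u" "l = i \<longrightarrow> u \<le> s" and A: "A \<in> sets borel"
      and E: "E = \<xi> l u -` A \<inter> space M" by auto
    have "\<xi> l u -` A \<inter> space M \<in> G"
    proof (cases "l = i")
      case True
      then have "\<xi> l u -` A \<inter> space M \<in> sets ?F"
        using u A by (auto simp: sets_info intro!: sigma_sets.Basic)
      moreover have "space M \<in> sets (info ?L)" using sets.top[of "info ?L"] by simp
      ultimately show ?thesis unfolding G_def by blast
    next
      case False
      then have "\<xi> l u -` A \<inter> space M \<in> sets (info ?L)"
        using u A by (auto simp: sets_info intro!: sigma_sets.Basic)
      moreover have "space M \<in> sets ?F" using sets.top[of ?F] by simp
      ultimately show ?thesis unfolding G_def by blast
    qed
    then show "E \<in> G" by (simp add: E)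
  qed
  then have BG: "B \<in> sigma_sets (space M) G"
    using B unfolding sets_info by (rule sigma_sets_mono'[THEN subsetD])
  have Gsets: "sigma_sets (space M) G \<subseteq> sets M"
    using FM LM by (intro sets.sigma_sets_subset) (auto simp: G_def)
  let ?h = "\<lambda>\<omega>. emeasure (P w (\<xi> i s \<omega>)) A"
  let ?V = "\<xi> i (s + w) -` A"
  have [measurable]: "A \<in> sets borel" by fact
  have hb: "(\<lambda>y. emeasure (P w y) A) \<in> borel_measurable borel"
    by (rule measurable_compose[OF measurable_prob_algebraD[OF kernel[OF w]] measurable_emeasure_subprob_algebra[OF A]])
  have hF: "?h \<in> borel_measurable ?F"
    by (rule measurable_compose[OF measurable_info hb]) (use s in auto)
  then have hM[measurable]: "?h \<in> borel_measurable M"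
    using measurable_from_subalg[OF subF] by blast
  have h1: "?h \<omega> \<le> 1" for \<omega> using prob_space.measure_le_1[OF prob_kernel(1)[OF w]]
    by (simp add: prob_space.emeasure_le_1 prob_kernel(1)[OF w])
  have Vm: "B \<inter> ?V \<in> sets M" if "B \<in> sets M" for B
  proof -
    have "B \<inter> ?V = B \<inter> (?V \<inter> space M)" using sets.sets_into_space[OF that] by auto
    then show ?thesis using that measurable_sets[OF measurable_\<xi> A, of "s + w" i] s w by simp
  qed
  show ?thesis using stable pow BG
  proof (induct rule: sigma_sets_induct_disjoint)
    case (basic D)
    then obtain B C where D: "D = B \<inter> C" "B \<in> sets ?F" "C \<in> sets (info ?L)" unfolding G_def by blast
    have ind: "emeasure M (B' \<inter> C) = emeasure M B' * emeasure M C" if "B' \<in> sets (info ({i} \<times> {0..}))" for B'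
      using indep_info[OF order.refl order.refl that D(3)] by (simp add: emeasure_eq_measure ennreal_mult'')
    have "B \<inter> (?V \<inter> space M) \<in> sets (info ({i} \<times> {0..}))"
    proof (rule sets.Int)
      show "B \<in> sets (info ({i} \<times> {0..}))" using D(2) by (rule info_mono[rotated]) auto
      show "?V \<inter> space M \<in> sets (info ({i} \<times> {0..}))"
        using measurable_sets[OF measurable_info A, of i "s + w" "{i} \<times> {0..}"] s w by simp
    qed
    moreover have "B \<inter> (?V \<inter> space M) = B \<inter> ?V" using sets.sets_into_space[OF FM[OF D(2)]] by auto
    ultimately have "emeasure M (D \<inter> ?V) = emeasure M (B \<inter> ?V) * emeasure M C"
      using ind[of "B \<inter> ?V"] by (simp add: D(1) Int_ac)
    also have "emeasure M (B \<inter> ?V) = (\<integral>\<^sup>+\<omega>. ?h \<omega> * indicator B \<omega> \<partial>M)"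
      by (rule markov_past[OF s w A]) (use D(2) in \<open>simp add: sets_past\<close>)
    also have "(\<integral>\<^sup>+\<omega>. ?h \<omega> * indicator B \<omega> \<partial>M) * emeasure M C
        = (\<integral>\<^sup>+\<omega>. (?h \<omega> * indicator B \<omega>) * indicator C \<omega> \<partial>M)"
    proof (subst nn_integral_indep_event[OF prob_space_axioms subF LM[OF D(3)]])
      show "emeasure M (B' \<inter> C) = emeasure M B' * emeasure M C" if "B' \<in> sets ?F" for B'
        by (rule ind) (use that in \<open>rule info_mono[rotated], auto\<close>)
      show "(\<lambda>\<omega>. ?h \<omega> * indicator B \<omega>) \<in> borel_measurable ?F" using hF D(2) by measurable
    qed (simp add: mult.commute)
    finally show ?case by (simp add: D(1) indicator_inter_arith mult.assoc)
  next
    case empty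
    then show ?case by simp
  next
    case (compl D)
    then have D: "D \<in> sets M" using Gsets by auto
    have "(space M - D) \<inter> ?V = (space M \<inter> ?V) - (D \<inter> ?V)" by auto
    moreover have "D \<inter> ?V \<subseteq> space M \<inter> ?V" using sets.sets_into_space[OF D] by auto
    ultimately have "emeasure M ((space M - D) \<inter> ?V) = emeasure M (space M \<inter> ?V) - emeasure M (D \<inter> ?V)"
      using Vm[OF D] Vm[OF sets.top] by (simp add: emeasure_Diff)
    also have "emeasure M (space M \<inter> ?V) = (\<integral>\<^sup>+\<omega>. ?h \<omega> * indicator (space M) \<omega> \<partial>M)"
      by (rule markov_past[OF s w A]) (use sets.top[of ?F] in \<open>simp add: sets_past\<close>)
    also have "\<dots> - emeasure M (D \<inter> ?V)
       = (\<integral>\<^sup>+\<omega>. ?h \<omega> * indicator (space M) \<omega> - ?h \<omega> * indicator D \<omega> \<partial>M)"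
      unfolding compl(2)
    proof (rule nn_integral_diff[symmetric])
      show "(\<integral>\<^sup>+ \<omega>. ?h \<omega> * indicator D \<omega> \<partial>M) \<noteq> \<infinity>"
        using compl(2)[symmetric] by simp
      show "AE \<omega> in M. ?h \<omega> * indicator D \<omega> \<le> ?h \<omega> * indicator (space M) \<omega>"
        by (auto simp: indicator_def)
    qed (use D in measurable)
    also have "\<dots> = (\<integral>\<^sup>+\<omega>. ?h \<omega> * indicator (space M - D) \<omega> \<partial>M)"
      by (rule nn_integral_cong) (use h1 in \<open>auto simp: indicator_def diff_eq_0_iff_ennreal intro: le_less_trans[OF _ ennreal_one_less_top]\<close>)
    finally show ?case .
  next
    case (union D)
    then have D: "\<And>n. D n \<in> sets M" using Gsets by auto
    have "emeasure M ((\<Union>n. D n) \<inter> ?V) = (\<Sum>n. emeasure M (D n \<inter> ?V))"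
      unfolding UN_simps(4)[symmetric]
      using Vm[OF D] union(1) by (subst suminf_emeasure) (auto simp: disjoint_family_on_def)
    also have "\<dots> = (\<Sum>n. \<integral>\<^sup>+\<omega>. ?h \<omega> * indicator (D n) \<omega> \<partial>M)" using union(3) by simp
    also have "\<dots> = (\<integral>\<^sup>+\<omega>. (\<Sum>n. ?h \<omega> * indicator (D n) \<omega>) \<partial>M)"
      using D hM by (intro nn_integral_suminf[symmetric] borel_measurable_times_ennreal) auto
    also have "\<dots> = (\<integral>\<^sup>+\<omega>. ?h \<omega> * indicator (\<Union>n. D n) \<omega> \<partial>M)"
      by (rule nn_integral_cong) (simp add: suminf_indicator[OF union(1)])
    finally show ?case .
  qed
qed

lemma markov:
  assumes s: "0 \<le> s" and w: "0 \<le> w" and G: "G \<in> sets (H i s \<Otimes>\<^sub>M borel)"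
  shows "emeasure M {\<omega>\<in>space M. (\<omega>, \<xi> i (s + w) \<omega>) \<in> G}
    = (\<integral>\<^sup>+\<omega>. emeasure (P w (\<xi> i s \<omega>)) (Pair \<omega> -` G) \<partial>M)"
proof (rule kernel_disintegration[OF prob_space_axioms subalgebra_H _ _ _ G])
  show "\<xi> i (s + w) \<in> M \<rightarrow>\<^sub>M borel" using s w by simp
  show "(\<lambda>\<omega>. P w (\<xi> i s \<omega>)) \<in> H i s \<rightarrow>\<^sub>M prob_algebra borel"
    by (rule measurable_compose[OF measurable_info kernel[OF w]]) (use s in auto)
qed (rule markov_rectangle[OF s w])

end

section \<open>Heat kernel bounds and collisions of two particles\<close>

text \<open>The consequences of the heat kernel and volume bounds that the argument uses: an upper bound
  for the transition probabilities of balls at all times in \<open>(0, 1]\<close>, and a lower bound in the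
  space-time scaling regime \<open>w \<approx> \<epsilon> powr \<alpha>\<close>.\<close>

locale stable_like_copies = independent_copies M P x \<xi>
  for M :: "'b measure" and P :: "real \<Rightarrow> 'a::polish_space \<Rightarrow> 'a measure" and x \<xi> +
  fixes d \<alpha> U L :: real
  assumes d_pos: "0 < d" and d_less: "d < \<alpha>" and U_pos: "0 < U" and L_pos: "0 < L"
    and upper: "\<And>w \<eta> y z. 0 < w \<Longrightarrow> w \<le> 1 \<Longrightarrow> 0 < \<eta> \<Longrightarrow> \<eta> \<le> 1 \<Longrightarrow>
      measure (P w y) (ball z \<eta>) \<le> U * w powr (- (d / \<alpha>)) * \<eta> powr d"
    and lower: "\<And>w \<epsilon> \<eta> y z. 0 < \<epsilon> \<Longrightarrow> \<epsilon> \<le> 1 \<Longrightarrow> \<epsilon> powr \<alpha> / 2 \<le> w \<Longrightarrow> w \<le> \<epsilon> powr \<alpha> \<Longrightarrow>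
      0 < \<eta> \<Longrightarrow> \<eta> \<le> \<epsilon> \<Longrightarrow> dist y z \<le> 3 * \<epsilon> \<Longrightarrow> L * (\<eta> / \<epsilon>) powr d \<le> measure (P w y) (ball z \<eta>)"
begin

text \<open>The past of all particles up to time \<open>t\<close>.\<close>

abbreviation F :: "real \<Rightarrow> 'b measure" where
  "F t \<equiv> info (UNIV \<times> {0..t})"

lemma F_H: "B \<in> sets (F t) \<Longrightarrow> B \<in> sets (H i t)"
  by (rule info_mono[rotated]) auto

lemma F_mono: "s \<le> t \<Longrightarrow> B \<in> sets (F s) \<Longrightarrow> B \<in> sets (F t)"
  by (rule info_mono[rotated]) auto

lemma H_events: "B \<in> sets (H i t) \<Longrightarrow> B \<in> sets M"
  using subalgebra_H by (auto simp: subalgebra_def)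

lemma F_events: "B \<in> sets (F t) \<Longrightarrow> B \<in> sets M"
  using F_H H_events by blast

text \<open>Particles \<open>i\<close> and \<open>j\<close> are at distance less than \<open>\<eta>\<close> at time \<open>u\<close>.\<close>

definition close :: "nat \<Rightarrow> nat \<Rightarrow> real \<Rightarrow> real \<Rightarrow> 'b set" where
  "close i j \<eta> u = {\<omega>\<in>space M. dist (\<xi> i u \<omega>) (\<xi> j u \<omega>) < \<eta>}"

lemma info_dist_less:
  assumes "(i, u) \<in> K" "(j, v) \<in> K"
  shows "{\<omega>\<in>space M. dist (\<xi> i u \<omega>) (\<xi> j v \<omega>) < \<eta>} \<in> sets (info K)"
proof -
  have [measurable]: "\<xi> i u \<in> info K \<rightarrow>\<^sub>M borel" "\<xi> j v \<in> info K \<rightarrow>\<^sub>M borel"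
    using assms by (auto intro: measurable_info)
  have "{\<omega>\<in>space (info K). dist (\<xi> i u \<omega>) (\<xi> j v \<omega>) < \<eta>} \<in> sets (info K)" by measurable
  then show ?thesis by simp
qed

lemma close_info: "(i, u) \<in> K \<Longrightarrow> (j, u) \<in> K \<Longrightarrow> close i j \<eta> u \<in> sets (info K)"
  unfolding close_def by (rule info_dist_less)

lemma close_F: "0 \<le> u \<Longrightarrow> u \<le> t \<Longrightarrow> close i j \<eta> u \<in> sets (F t)"
  by (rule close_info) auto

lemma markov_dist:
  assumes "0 \<le> s" "0 \<le> w" and B: "B \<in> sets (H i s)" and jv: "j \<noteq> i \<and> 0 \<le> v \<or> j = i \<and> 0 \<le> v \<and> v \<le> s"
  shows "emeasure M (B \<inter> {\<omega>\<in>space M. dist (\<xi> i (s + w) \<omega>) (\<xi> j v \<omega>) < \<eta>})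
    = (\<integral>\<^sup>+\<omega>. ennreal (measure (P w (\<xi> i s \<omega>)) (ball (\<xi> j v \<omega>) \<eta>)) * indicator B \<omega> \<partial>M)"
proof -
  let ?G = "{z\<in>space (H i s \<Otimes>\<^sub>M borel). fst z \<in> B \<and> dist (snd z) (\<xi> j v (fst z)) < \<eta>}"
  have [measurable]: "\<xi> j v \<in> H i s \<rightarrow>\<^sub>M borel" by (rule measurable_info) (use jv in auto)
  have [measurable]: "B \<in> sets (H i s)" by fact
  have "?G \<in> sets (H i s \<Otimes>\<^sub>M borel)" by measurable
  from markov[OF assms(1,2) this]
  have "emeasure M {\<omega>\<in>space M. (\<omega>, \<xi> i (s + w) \<omega>) \<in> ?G}
    = (\<integral>\<^sup>+\<omega>. emeasure (P w (\<xi> i s \<omega>)) (Pair \<omega> -` ?G) \<partial>M)" .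
  moreover have "{\<omega>\<in>space M. (\<omega>, \<xi> i (s + w) \<omega>) \<in> ?G}
      = B \<inter> {\<omega>\<in>space M. dist (\<xi> i (s + w) \<omega>) (\<xi> j v \<omega>) < \<eta>}"
    by (auto simp: space_pair_measure)
  moreover have "(\<integral>\<^sup>+\<omega>. emeasure (P w (\<xi> i s \<omega>)) (Pair \<omega> -` ?G) \<partial>M)
    = (\<integral>\<^sup>+\<omega>. ennreal (measure (P w (\<xi> i s \<omega>)) (ball (\<xi> j v \<omega>) \<eta>)) * indicator B \<omega> \<partial>M)"
  proof (rule nn_integral_cong)
    fix \<omega> assume "\<omega> \<in> space M"
    then have "Pair \<omega> -` ?G = (if \<omega> \<in> B then ball (\<xi> j v \<omega>) \<eta> else {})"
      by (auto simp: space_pair_measure dist_commute)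
    then show "emeasure (P w (\<xi> i s \<omega>)) (Pair \<omega> -` ?G)
        = ennreal (measure (P w (\<xi> i s \<omega>)) (ball (\<xi> j v \<omega>) \<eta>)) * indicator B \<omega>"
      using finite_measure.emeasure_eq_measure[OF prob_space.finite_measure[OF prob_kernel(1)[OF assms(2)]]]
      by (simp add: indicator_def)
  qed
  ultimately show ?thesis by simp
qed

lemma prob_dist_le:
  assumes "0 \<le> s" "0 \<le> w" "B \<in> sets (H i s)" "j \<noteq> i \<and> 0 \<le> v \<or> j = i \<and> 0 \<le> v \<and> v \<le> s"
    and le: "\<And>\<omega>. \<omega> \<in> B \<Longrightarrow> measure (P w (\<xi> i s \<omega>)) (ball (\<xi> j v \<omega>) \<eta>) \<le> c" and "0 \<le> c"
  shows "prob (B \<inter> {\<omega>\<in>space M. dist (\<xi> i (s + w) \<omega>) (\<xi> j v \<omega>) < \<eta>}) \<le> c * prob B"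
proof -
  have "emeasure M (B \<inter> {\<omega>\<in>space M. dist (\<xi> i (s + w) \<omega>) (\<xi> j v \<omega>) < \<eta>})
     \<le> (\<integral>\<^sup>+\<omega>. ennreal c * indicator B \<omega> \<partial>M)"
    unfolding markov_dist[OF assms(1-4)]
    by (rule nn_integral_mono) (use le in \<open>auto simp: indicator_def intro!: ennreal_leI\<close>)
  also have "\<dots> = ennreal c * emeasure M B"
    by (rule nn_integral_cmult_indicator) (rule H_events[OF assms(3)])
  finally show ?thesis using \<open>0 \<le> c\<close>
    by (simp add: emeasure_eq_measure flip: ennreal_mult)
qed

lemma prob_dist_ge:
  assumes "0 \<le> s" "0 \<le> w" "B \<in> sets (H i s)" "j \<noteq> i \<and> 0 \<le> v \<or> j = i \<and> 0 \<le> v \<and> v \<le> s"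
    and ge: "\<And>\<omega>. \<omega> \<in> B \<Longrightarrow> c \<le> measure (P w (\<xi> i s \<omega>)) (ball (\<xi> j v \<omega>) \<eta>)" and "0 \<le> c"
  shows "c * prob B \<le> prob (B \<inter> {\<omega>\<in>space M. dist (\<xi> i (s + w) \<omega>) (\<xi> j v \<omega>) < \<eta>})"
proof -
  have "ennreal c * emeasure M B = (\<integral>\<^sup>+\<omega>. ennreal c * indicator B \<omega> \<partial>M)"
    by (rule nn_integral_cmult_indicator[symmetric]) (rule H_events[OF assms(3)])
  also have "\<dots> \<le> emeasure M (B \<inter> {\<omega>\<in>space M. dist (\<xi> i (s + w) \<omega>) (\<xi> j v \<omega>) < \<eta>})"
    unfolding markov_dist[OF assms(1-4)]
    by (rule nn_integral_mono) (use ge in \<open>auto simp: indicator_def intro!: ennreal_leI\<close>)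
  finally show ?thesis using \<open>0 \<le> c\<close>
    by (simp add: emeasure_eq_measure flip: ennreal_mult)
qed

lemma prob_close_le:
  assumes "0 \<le> s" "0 < w" "w \<le> 1" "0 < \<eta>" "\<eta> \<le> 1" "B \<in> sets (H i s)" "j \<noteq> i"
  shows "prob (B \<inter> close i j \<eta> (s + w)) \<le> U * w powr (- (d / \<alpha>)) * \<eta> powr d * prob B"
  unfolding close_def by (rule prob_dist_le) (use assms upper U_pos in auto)

text \<open>Particle \<open>j\<close> stays within \<open>\<epsilon>\<close> of its position with probability at least \<open>L\<close>, and given its new
  position, particle \<open>i\<close> is within \<open>\<eta>\<close> of it with probability at least \<open>L * (\<eta> / \<epsilon>) powr d\<close>.\<close>

lemma prob_close_ge:
  assumes "0 \<le> s" "0 < \<epsilon>" "\<epsilon> \<le> 1" "\<epsilon> powr \<alpha> / 2 \<le> w" "w \<le> \<epsilon> powr \<alpha>" "0 < \<eta>" "\<eta> \<le> \<epsilon>"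
    and B: "B \<in> sets (F s)" and "j \<noteq> i"
    and near: "\<And>\<omega>. \<omega> \<in> B \<Longrightarrow> dist (\<xi> i s \<omega>) (\<xi> j s \<omega>) \<le> 2 * \<epsilon>"
  shows "L\<^sup>2 * (\<eta> / \<epsilon>) powr d * prob B \<le> prob (B \<inter> close i j \<eta> (s + w))"
proof -
  have w: "0 \<le> w" using assms(2,4) by (smt (verit) powr_ge_zero divide_nonneg_nonneg)
  let ?R = "{\<omega>\<in>space M. dist (\<xi> j (s + w) \<omega>) (\<xi> j s \<omega>) < \<epsilon>}"
  let ?B = "B \<inter> ?R"
  have L1: "L * (\<epsilon> / \<epsilon>) powr d \<le> measure (P w y) (ball y \<epsilon>)" for y
    by (rule lower) (use assms in auto)
  have "L * prob B \<le> prob ?B"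
    by (rule prob_dist_ge) (use assms(1) w F_H[OF B] L1 L_pos assms(2) in auto)
  have BH: "?B \<in> sets (H i s)"
    by (intro sets.Int F_H[OF B] info_dist_less) (use assms w in auto)
  have "L * (\<eta> / \<epsilon>) powr d * prob ?B \<le> prob (?B \<inter> close i j \<eta> (s + w))"
    unfolding close_def
  proof (rule prob_dist_ge)
    fix \<omega> assume w: "\<omega> \<in> ?B"
    have "dist (\<xi> i s \<omega>) (\<xi> j (s + w) \<omega>) \<le> dist (\<xi> i s \<omega>) (\<xi> j s \<omega>) + dist (\<xi> j s \<omega>) (\<xi> j (s + w) \<omega>)"
      by (rule dist_triangle)
    then have "dist (\<xi> i s \<omega>) (\<xi> j (s + w) \<omega>) \<le> 3 * \<epsilon>"
      using near[of \<omega>] w by (auto simp: dist_commute)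
    then show "L * (\<eta> / \<epsilon>) powr d \<le> measure (P w (\<xi> i s \<omega>)) (ball (\<xi> j (s + w) \<omega>) \<eta>)"
      by (intro lower) (use assms in auto)
  qed (use assms w BH L_pos in auto)
  also have "\<dots> \<le> prob (B \<inter> close i j \<eta> (s + w))"
    by (rule finite_measure_mono)
       (use F_events[OF B] F_events[OF close_F[of "s + w" "s + w"]] assms w in auto)
  finally have 1: "L * (\<eta> / \<epsilon>) powr d * prob ?B \<le> prob (B \<inter> close i j \<eta> (s + w))" .
  have "L * (\<eta> / \<epsilon>) powr d * (L * prob B) \<le> L * (\<eta> / \<epsilon>) powr d * prob ?B"
    using \<open>L * prob B \<le> prob ?B\<close> L_pos by (intro mult_left_mono) auto
  then show ?thesis using 1 by (simp add: power2_eq_square mult_ac)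
qed

end

lemma sum_powr_le:
  fixes g :: real
  assumes "0 < g" "g < 1"
  shows "(\<Sum>h=1..n. real h powr (- g)) \<le> real n powr (1 - g) / (1 - g)"
proof (induction n)
  case 0
  then show ?case by simp
next
  case (Suc n)
  have "(1 - g) * real (Suc n) powr (- g) \<le> real (Suc n) powr (1 - g) - real n powr (1 - g)"
  proof (cases "n = 0")
    case True
    then show ?thesis using assms by simp
  next
    case False
    have "\<exists>z>real n. z < real (Suc n) \<and> real (Suc n) powr (1 - g) - real n powr (1 - g)
        = (real (Suc n) - real n) * ((1 - g) * z powr (- g))"
    proof (rule MVT2)
      fix z :: real assume "real n \<le> z"
      then have "((\<lambda>z. z powr (1 - g)) has_real_derivative (1 - g) * z powr (1 - g - 1)) (at z)"
        using False by (intro has_real_derivative_powr) auto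
      then show "((\<lambda>z. z powr (1 - g)) has_real_derivative (1 - g) * z powr - g) (at z)" by simp
    qed simp
    then obtain z where z: "real n < z" "z < real (Suc n)"
      "real (Suc n) powr (1 - g) - real n powr (1 - g) = (1 - g) * z powr (- g)" by auto
    have "real (Suc n) powr (- g) \<le> z powr (- g)"
      by (rule powr_mono2') (use z assms in auto)
    then show ?thesis using z(3) assms by simp
  qed
  then have "real (Suc n) powr (- g) \<le> (real (Suc n) powr (1 - g) - real n powr (1 - g)) / (1 - g)"
    using assms by (simp add: field_simps)
  then show ?case using Suc by (simp add: diff_divide_distrib)
qed

lemma sum_dist_powr_le:
  fixes g :: real
  assumes g: "0 < g" "g < 1" and k: "k < m"
  shows "(\<Sum>l\<in>{..<m} - {k}. (\<bar>real k - real l\<bar> / real m) powr (- g)) \<le> 2 * real m / (1 - g)"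
proof -
  have m: "real m > 0" using k by simp
  have part: "(\<Sum>h=1..n. (real h / real m) powr (- g)) \<le> real m / (1 - g)" if "n \<le> m" for n
  proof -
    have "(\<Sum>h=1..n. (real h / real m) powr (- g)) = real m powr g * (\<Sum>h=1..n. real h powr (- g))"
      unfolding sum_distrib_left
      by (rule sum.cong) (use m in \<open>auto simp: powr_divide powr_minus field_simps\<close>)
    also have "\<dots> \<le> real m powr g * (real n powr (1 - g) / (1 - g))"
      by (intro mult_left_mono sum_powr_le g) auto
    also have "\<dots> \<le> real m powr g * (real m powr (1 - g) / (1 - g))"
      using that g by (intro mult_left_mono divide_right_mono powr_mono2) auto
    also have "\<dots> = real m / (1 - g)" using m by (simp flip: powr_add)
    finally show ?thesis .
  qed
  have "(\<Sum>l\<in>{..<m} - {k}. (\<bar>real k - real l\<bar> / real m) powr (- g))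
     = (\<Sum>l\<in>{..<k}. (\<bar>real k - real l\<bar> / real m) powr (- g))
       + (\<Sum>l\<in>{k<..<m}. (\<bar>real k - real l\<bar> / real m) powr (- g))"
    using k by (subst sum.union_disjoint[symmetric]) (auto intro!: sum.cong)
  also have "(\<Sum>l\<in>{..<k}. (\<bar>real k - real l\<bar> / real m) powr (- g))
      = (\<Sum>h=1..k. (real h / real m) powr (- g))"
    by (rule sum.reindex_bij_witness[of _ "\<lambda>h. k - h" "\<lambda>l. k - l"]) auto
  also have "(\<Sum>l\<in>{k<..<m}. (\<bar>real k - real l\<bar> / real m) powr (- g))
      = (\<Sum>h=1..m - 1 - k. (real h / real m) powr (- g))"
    by (rule sum.reindex_bij_witness[of _ "\<lambda>h. k + h" "\<lambda>l. l - k"]) (use k in auto)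
  finally show ?thesis using part[of k] part[of "m - 1 - k"] k by simp
qed

text \<open>With \<open>N\<close> the number of the events \<open>A k\<close> that occur, \<open>2 * lam * N - lam\<^sup>2 * N\<^sup>2\<close> is at most \<open>1\<close>, and it is
  \<open>0\<close> when \<open>N = 0\<close>.\<close>

lemma (in prob_space) second_moment_bound:
  fixes lam e S :: real
  assumes A: "\<And>k. k < m \<Longrightarrow> A k \<in> events" and B: "B \<in> events" and "0 \<le> lam"
    and e: "\<And>k. k < m \<Longrightarrow> e \<le> prob (B \<inter> A k)"
    and S: "(\<Sum>k<m. \<Sum>l<m. prob (B \<inter> A k \<inter> A l)) \<le> S"
  shows "2 * lam * real m * e - lam\<^sup>2 * S \<le> prob (B \<inter> (\<Union>k<m. A k))"
proof -
  let ?N = "\<lambda>\<omega>. \<Sum>k<m. indicat_real (A k) \<omega>"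
  have ev: "B \<inter> (\<Union>k<m. A k) \<in> events" "\<And>k. k < m \<Longrightarrow> B \<inter> A k \<in> events"
    "\<And>k l. k < m \<Longrightarrow> l < m \<Longrightarrow> B \<inter> A k \<inter> A l \<in> events"
    using A B by auto
  have int: "integrable M (indicat_real E)" if "E \<in> events" for E
    using that by (auto simp: integrable_indicator_iff emeasure_eq_measure less_top[symmetric])
  have intsum: "integrable M (\<lambda>\<omega>. \<Sum>k<m. indicat_real (B \<inter> A k) \<omega>)"
      "integrable M (\<lambda>\<omega>. \<Sum>k<m. \<Sum>l<m. indicat_real (B \<inter> A k \<inter> A l) \<omega>)"
    using ev int by (auto intro!: Bochner_Integration.integrable_sum)
  have "2 * lam * (\<Sum>k<m. prob (B \<inter> A k)) - lam\<^sup>2 * (\<Sum>k<m. \<Sum>l<m. prob (B \<inter> A k \<inter> A l))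
    = (\<integral>\<omega>. 2 * lam * (\<Sum>k<m. indicat_real (B \<inter> A k) \<omega>)
        - lam\<^sup>2 * (\<Sum>k<m. \<Sum>l<m. indicat_real (B \<inter> A k \<inter> A l) \<omega>) \<partial>M)"
  proof -
    have 2: "(\<integral>\<omega>. (\<Sum>k<m. indicat_real (B \<inter> A k) \<omega>) \<partial>M) = (\<Sum>k<m. prob (B \<inter> A k))"
      using ev int by (subst Bochner_Integration.integral_sum) auto
    have "(\<integral>\<omega>. (\<Sum>k<m. \<Sum>l<m. indicat_real (B \<inter> A k \<inter> A l) \<omega>) \<partial>M)
        = (\<Sum>k<m. \<integral>\<omega>. (\<Sum>l<m. indicat_real (B \<inter> A k \<inter> A l) \<omega>) \<partial>M)"
      using ev int by (intro Bochner_Integration.integral_sum Bochner_Integration.integrable_sum) auto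
    also have "\<dots> = (\<Sum>k<m. \<Sum>l<m. prob (B \<inter> A k \<inter> A l))"
    proof (rule sum.cong[OF refl])
      fix k assume "k \<in> {..<m}"
      then show "(\<integral>\<omega>. (\<Sum>l<m. indicat_real (B \<inter> A k \<inter> A l) \<omega>) \<partial>M) = (\<Sum>l<m. prob (B \<inter> A k \<inter> A l))"
        using ev int by (subst Bochner_Integration.integral_sum) auto
    qed
    finally show ?thesis using intsum 2 by simp
  qed
  also have "\<dots> \<le> (\<integral>\<omega>. indicat_real (B \<inter> (\<Union>k<m. A k)) \<omega> \<partial>M)"
  proof (rule integral_mono)
    fix \<omega>
    have N: "(\<Sum>k<m. indicat_real (B \<inter> A k) \<omega>) = indicat_real B \<omega> * ?N \<omega>"
      by (simp add: indicator_inter_arith sum_distrib_left)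
    have N2: "(\<Sum>k<m. \<Sum>l<m. indicat_real (B \<inter> A k \<inter> A l) \<omega>) = indicat_real B \<omega> * (?N \<omega>)\<^sup>2"
      unfolding indicator_inter_arith power2_eq_square sum_product
      by (subst sum_distrib_left, rule sum.cong[OF refl], subst sum_distrib_left) (simp only: mult.assoc)
    have sq: "2 * lam * ?N \<omega> - lam\<^sup>2 * (?N \<omega>)\<^sup>2 \<le> 1"
      using zero_le_power2[of "1 - lam * ?N \<omega>"] by (simp add: power2_diff power_mult_distrib)
    show "2 * lam * (\<Sum>k<m. indicat_real (B \<inter> A k) \<omega>)
        - lam\<^sup>2 * (\<Sum>k<m. \<Sum>l<m. indicat_real (B \<inter> A k \<inter> A l) \<omega>) \<le> indicat_real (B \<inter> (\<Union>k<m. A k)) \<omega>"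
    proof (cases "\<omega> \<in> B \<inter> (\<Union>k<m. A k)")
      case True
      then show ?thesis unfolding N N2 using sq by simp
    next
      case False
      then have "indicat_real B \<omega> * ?N \<omega> = 0" by (auto simp: indicator_def)
      then have "indicat_real B \<omega> = 0 \<or> ?N \<omega> = 0" by simp
      then show ?thesis unfolding N N2 using False by auto
    qed
  qed (use ev int intsum in auto)
  also have "\<dots> = prob (B \<inter> (\<Union>k<m. A k))" using ev by simp
  finally have 1: "2 * lam * (\<Sum>k<m. prob (B \<inter> A k)) - lam\<^sup>2 * (\<Sum>k<m. \<Sum>l<m. prob (B \<inter> A k \<inter> A l))
    \<le> prob (B \<inter> (\<Union>k<m. A k))" .
  have "real m * e \<le> (\<Sum>k<m. prob (B \<inter> A k))"
    using sum_mono[of "{..<m}" "\<lambda>_. e"] e by simp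
  then have "2 * lam * (real m * e) \<le> 2 * lam * (\<Sum>k<m. prob (B \<inter> A k))"
    using \<open>0 \<le> lam\<close> by (intro mult_left_mono) auto
  moreover have "lam\<^sup>2 * (\<Sum>k<m. \<Sum>l<m. prob (B \<inter> A k \<inter> A l)) \<le> lam\<^sup>2 * S"
    using S by (intro mult_left_mono) auto
  ultimately show ?thesis using 1 by (simp add: mult.assoc)
qed

context stable_like_copies begin

text \<open>Particles \<open>i\<close> and \<open>j\<close> come arbitrarily close during \<open>{a..b}\<close>. The countably many times make
  this an event.\<close>

definition near :: "nat \<Rightarrow> nat \<Rightarrow> real \<Rightarrow> real \<Rightarrow> 'b set" where
  "near i j a b = {\<omega>\<in>space M. \<forall>n. \<exists>v\<in>insert b (\<rat> \<inter> {a..b}).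
     dist (\<xi> i v \<omega>) (\<xi> j v \<omega>) < 1 / real (Suc n)}"

lemma near_altdef: "near i j a b = (\<Inter>n. \<Union>v\<in>insert b (\<rat> \<inter> {a..b}). close i j (1 / real (Suc n)) v)"
  unfolding near_def close_def by auto

lemma near_F:
  assumes "0 \<le> a" "a \<le> b"
  shows "near i j a b \<in> sets (F b)"
  unfolding near_altdef
proof (rule sets.countable_INT)
  have "countable (insert b (\<rat> \<inter> {a..b}))" using countable_rat by (auto intro: countable_subset)
  then have "(\<Union>v\<in>insert b (\<rat> \<inter> {a..b}). close i j (1 / real (Suc n)) v) \<in> sets (F b)" for n
    by (rule sets.countable_UN'') (use assms in \<open>auto intro!: close_F\<close>)
  then show "(\<lambda>n. \<Union>v\<in>insert b (\<rat> \<inter> {a..b}). close i j (1 / real (Suc n)) v) ` UNIV \<subseteq> sets (F b)"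
    by auto
qed simp

text \<open>The constant in the second moment bound below.\<close>

definition second_moment_const :: real where
  "second_moment_const = U * 2 powr (d / \<alpha>) + 2 * (U * 2 powr (d / \<alpha>))\<^sup>2 / (1 - d / \<alpha>)"

lemma exponent: "0 < \<alpha>" "0 < d / \<alpha>" "d / \<alpha> < 1"
  using d_pos d_less by auto

lemma second_moment_const_pos: "0 < second_moment_const"
  unfolding second_moment_const_def using U_pos exponent by (intro add_pos_nonneg) auto

text \<open>For grid times \<open>t k < t l\<close>, the upper bound makes the conditional probability that the pair is close
  at \<open>t l\<close>, given that it is close at \<open>t k\<close>, of order \<open>(\<eta> / \<epsilon>) powr d * ((l - k) / m) powr (- (d / \<alpha>))\<close>.
  As \<open>d < \<alpha>\<close>, the last factors sum to order \<open>m\<close> over \<open>l\<close>. The condition on \<open>m\<close> absorbs the diagonal terms.\<close>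

lemma second_moment_close:
  assumes s: "0 \<le> s" and \<epsilon>: "0 < \<epsilon>" "\<epsilon> \<le> 1" and \<eta>: "0 < \<eta>" "\<eta> \<le> \<epsilon>"
    and m: "1 \<le> real m * (\<eta> / \<epsilon>) powr d"
    and B: "B \<in> sets (F s)" and "j \<noteq> i"
  defines "t \<equiv> \<lambda>k. s + \<epsilon> powr \<alpha> / 2 + real (Suc k) * (\<epsilon> powr \<alpha> / (2 * real m))"
  shows "(\<Sum>k<m. \<Sum>l<m. prob (B \<inter> close i j \<eta> (t k) \<inter> close i j \<eta> (t l)))
    \<le> (real m * (\<eta> / \<epsilon>) powr d)\<^sup>2 * second_moment_const * prob B"
proof -
  define g where "g = d / \<alpha>"
  have g: "0 < g" "g < 1" using exponent by (auto simp: g_def)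
  define \<tau> where "\<tau> = \<epsilon> powr \<alpha>"
  define \<theta> where "\<theta> = (\<eta> / \<epsilon>) powr d"
  define b where "b = U * 2 powr g"
  have \<tau>: "0 < \<tau>" "\<tau> \<le> 1"
    using \<epsilon> exponent powr_le1[of \<alpha> \<epsilon>] by (auto simp: \<tau>_def)
  have m0: "0 < real m" using m by (cases "m = 0") auto
  have \<theta>0: "0 \<le> \<theta>" by (simp add: \<theta>_def)
  have b0: "0 < b" using U_pos by (simp add: b_def)
  have \<eta>1: "\<eta> \<le> 1" using \<eta> \<epsilon> by simp
  \<comment> \<open>the scaling \<open>\<tau> powr g = \<epsilon> powr d\<close>\<close>
  have scale: "U * (r * (\<tau> / 2)) powr (- g) * \<eta> powr d = b * \<theta> * r powr (- g)" if "0 < r" for r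
  proof -
    have "\<tau> powr (- g) = \<epsilon> powr (- d)"
      using exponent(1) by (simp add: \<tau>_def g_def powr_powr)
    moreover have "\<eta> powr d = \<theta> * \<epsilon> powr d"
      using \<epsilon> \<eta> by (simp add: \<theta>_def powr_divide)
    ultimately show ?thesis
      using that \<tau> \<epsilon> by (simp add: powr_mult powr_divide b_def powr_minus field_simps)
  qed
  let ?A = "\<lambda>k. close i j \<eta> (t k)"
  have t: "0 \<le> t k" "s \<le> t k" for k using s \<tau> m0 by (auto simp: t_def \<tau>_def)
  have AF: "?A k \<in> sets (F (t l))" if "k \<le> l" for k l
    by (rule close_F) (use t that in \<open>auto simp: t_def intro!: divide_right_mono mult_right_mono\<close>)
  have BF: "B \<in> sets (F (t k))" for k using B F_mono[OF t(2)] by blast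
  have ev: "B \<in> events" "?A k \<in> events" for k using B AF[of k k] F_events by auto
  have tk: "s + (1 + real (Suc k) / real m) * (\<tau> / 2) = t k" for k
    using m0 by (simp add: t_def \<tau>_def field_simps)
  have first: "prob (B \<inter> ?A k) \<le> b * \<theta> * prob B" if "k < m" for k
  proof -
    let ?r = "1 + real (Suc k) / real m"
    have r: "1 \<le> ?r" "?r \<le> 2" using that m0 by (auto simp: divide_le_eq)
    have r0: "0 < ?r" using r(1) by linarith
    have "?r * (\<tau> / 2) \<le> 2 * (1 / 2)" using r \<tau> by (intro mult_mono) auto
    moreover have "0 < ?r * (\<tau> / 2)" using r0 \<tau> by (intro mult_pos_pos) auto
    ultimately have w: "0 < ?r * (\<tau> / 2)" "?r * (\<tau> / 2) \<le> 1" by auto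
    have "prob (B \<inter> close i j \<eta> (s + ?r * (\<tau> / 2))) \<le> U * (?r * (\<tau> / 2)) powr (- (d / \<alpha>)) * \<eta> powr d * prob B"
      by (rule prob_close_le[OF s w \<eta>(1) \<eta>1 F_H[OF B] \<open>j \<noteq> i\<close>])
    also have "\<dots> = b * \<theta> * ?r powr (- g) * prob B"
      using scale[OF r0] by (simp only: g_def)
    also have "?r powr (- g) \<le> 1 powr (- g)" by (rule powr_mono2') (use r g in auto)
    finally have "prob (B \<inter> close i j \<eta> (s + ?r * (\<tau> / 2))) \<le> b * \<theta> * 1 powr (- g) * prob B"
      using b0 \<theta>0 by (auto simp: mult_left_mono mult_right_mono)
    then show ?thesis unfolding tk by simp
  qed
  have later: "prob (B \<inter> ?A k \<inter> ?A l) \<le> b\<^sup>2 * \<theta>\<^sup>2 * prob B * (\<bar>real k - real l\<bar> / real m) powr (- g)"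
    if kl: "k < l" "l < m" for k l
  proof -
    let ?r = "(real l - real k) / real m"
    have r: "0 < ?r" "?r \<le> 1" using kl m0 by (auto simp: divide_le_eq)
    have "?r * (\<tau> / 2) \<le> 1 * (1 / 2)" using r \<tau> by (intro mult_mono) auto
    then have w: "0 < ?r * (\<tau> / 2)" "?r * (\<tau> / 2) \<le> 1" using mult_pos_pos[OF r(1), of "\<tau> / 2"] \<tau> by linarith+
    have "B \<inter> ?A k \<in> sets (H i (t k))" using BF AF[of k k] by (intro F_H sets.Int) auto
    then have "prob (B \<inter> ?A k \<inter> close i j \<eta> (t k + ?r * (\<tau> / 2)))
        \<le> U * (?r * (\<tau> / 2)) powr (- (d / \<alpha>)) * \<eta> powr d * prob (B \<inter> ?A k)"
      by (rule prob_close_le[OF t(1) w \<eta>(1) \<eta>1 _ \<open>j \<noteq> i\<close>])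
    also have "t k + ?r * (\<tau> / 2) = t l" using m0 by (simp add: t_def \<tau>_def field_simps)
    also have "U * (?r * (\<tau> / 2)) powr (- (d / \<alpha>)) * \<eta> powr d * prob (B \<inter> ?A k)
        = b * \<theta> * ?r powr (- g) * prob (B \<inter> ?A k)"
      using scale[OF r(1)] by (simp only: g_def)
    also have "\<dots> \<le> b * \<theta> * ?r powr (- g) * (b * \<theta> * prob B)"
      using first[of k] kl b0 \<theta>0 by (intro mult_left_mono) auto
    also have "\<dots> = b\<^sup>2 * \<theta>\<^sup>2 * prob B * (\<bar>real k - real l\<bar> / real m) powr (- g)"
      using kl by (simp add: power2_eq_square mult_ac)
    finally show ?thesis .
  qed
  have off: "prob (B \<inter> ?A k \<inter> ?A l) \<le> b\<^sup>2 * \<theta>\<^sup>2 * prob B * (\<bar>real k - real l\<bar> / real m) powr (- g)"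
    if kl: "k < m" "l < m" "k \<noteq> l" for k l
  proof (cases "k < l")
    case False
    then have "l < k" using kl by simp
    from later[OF this kl(1)] show ?thesis by (simp add: Int_ac abs_minus_commute)
  qed (use later kl in auto)
  have row: "(\<Sum>l<m. prob (B \<inter> ?A k \<inter> ?A l))
      \<le> b * \<theta> * prob B + b\<^sup>2 * \<theta>\<^sup>2 * prob B * (2 * real m / (1 - g))" if "k < m" for k
  proof -
    have "(\<Sum>l<m. prob (B \<inter> ?A k \<inter> ?A l))
        = prob (B \<inter> ?A k) + (\<Sum>l\<in>{..<m} - {k}. prob (B \<inter> ?A k \<inter> ?A l))"
      using that by (subst sum.remove[of _ k]) (auto simp: Int_assoc)
    also have "(\<Sum>l\<in>{..<m} - {k}. prob (B \<inter> ?A k \<inter> ?A l))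
        \<le> (\<Sum>l\<in>{..<m} - {k}. b\<^sup>2 * \<theta>\<^sup>2 * prob B * (\<bar>real k - real l\<bar> / real m) powr (- g))"
      using off that by (intro sum_mono) auto
    also have "\<dots> = b\<^sup>2 * \<theta>\<^sup>2 * prob B * (\<Sum>l\<in>{..<m} - {k}. (\<bar>real k - real l\<bar> / real m) powr (- g))"
      by (simp add: sum_distrib_left)
    also have "\<dots> \<le> b\<^sup>2 * \<theta>\<^sup>2 * prob B * (2 * real m / (1 - g))"
      by (intro mult_left_mono sum_dist_powr_le g that) auto
    finally show ?thesis using first[OF that] by simp
  qed
  have "(\<Sum>k<m. \<Sum>l<m. prob (B \<inter> ?A k \<inter> ?A l))
      \<le> (\<Sum>k<m. b * \<theta> * prob B + b\<^sup>2 * \<theta>\<^sup>2 * prob B * (2 * real m / (1 - g)))"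
    using row by (intro sum_mono) auto
  also have "\<dots> = b * (real m * \<theta>) * prob B + (2 * b\<^sup>2 / (1 - g)) * (real m * \<theta>)\<^sup>2 * prob B"
    by (simp add: power2_eq_square algebra_simps)
  also have "b * (real m * \<theta>) * prob B \<le> b * (real m * \<theta>)\<^sup>2 * prob B"
    using m b0 by (intro mult_right_mono mult_left_mono self_le_power) (auto simp: \<theta>_def)
  finally have "(\<Sum>k<m. \<Sum>l<m. prob (B \<inter> ?A k \<inter> ?A l))
      \<le> b * (real m * \<theta>)\<^sup>2 * prob B + (2 * b\<^sup>2 / (1 - g)) * (real m * \<theta>)\<^sup>2 * prob B" by simp
  also have "\<dots> = (real m * \<theta>)\<^sup>2 * second_moment_const * prob B"
    by (simp add: second_moment_const_def b_def g_def algebra_simps)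
  finally show ?thesis by (simp add: \<theta>_def)
qed

text \<open>Two particles within distance \<open>2 * \<epsilon>\<close> come arbitrarily close within time \<open>\<epsilon> powr \<alpha>\<close> with
  probability bounded below, given the past. The number of grid times in the second half of that
  period at which they are closer than \<open>\<eta>\<close> has a second moment comparable with the square of its
  mean, uniformly in \<open>\<eta>\<close>.\<close>

lemma prob_near_ge:
  assumes s: "0 \<le> s" and \<epsilon>: "0 < \<epsilon>" "\<epsilon> \<le> 1" and B: "B \<in> sets (F s)" and "j \<noteq> i"
    and dist: "\<And>\<omega>. \<omega> \<in> B \<Longrightarrow> dist (\<xi> i s \<omega>) (\<xi> j s \<omega>) \<le> 2 * \<epsilon>"
  shows "L ^ 4 / second_moment_const * prob B \<le> prob (B \<inter> near i j s (s + \<epsilon> powr \<alpha>))"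
proof -
  define \<tau> where "\<tau> = \<epsilon> powr \<alpha>"
  have \<tau>: "0 < \<tau>" using \<epsilon> by (simp add: \<tau>_def)
  let ?I = "insert (s + \<tau>) (\<rat> \<inter> {s..s + \<tau>})"
  let ?W = "\<lambda>\<eta>. \<Union>v\<in>?I. close i j \<eta> v"
  have cI: "countable ?I" using countable_rat by (auto intro: countable_subset)
  have Wev: "?W \<eta> \<in> events" for \<eta>
    using s \<tau> cI by (intro sets.countable_UN'' F_events[OF close_F[of _ "s + \<tau>"]]) auto
  have BM: "B \<in> events" using B F_events by blast
  have bound: "L ^ 4 / second_moment_const * prob B \<le> prob (B \<inter> ?W \<eta>)" if \<eta>: "0 < \<eta>" "\<eta> \<le> \<epsilon>" for \<eta>
  proof -
    define \<theta> where "\<theta> = (\<eta> / \<epsilon>) powr d"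
    have \<theta>0: "0 < \<theta>" using \<eta> \<epsilon> by (simp add: \<theta>_def)
    obtain m where m: "1 / \<theta> \<le> real m" using real_arch_simple by blast
    then have m\<theta>: "1 \<le> real m * \<theta>" using \<theta>0 by (simp add: divide_le_eq)
    then have m0: "0 < real m" by (cases "m = 0") auto
    define t where "t k = s + \<epsilon> powr \<alpha> / 2 + real (Suc k) * (\<epsilon> powr \<alpha> / (2 * real m))" for k
    have t: "s \<le> t k" "t k \<le> s + \<tau>" "t k - s \<in> {\<tau> / 2..\<tau>}" if "k < m" for k
    proof -
      define X where "X = real (Suc k) * (\<tau> / (2 * real m))"
      have "X \<le> real m * (\<tau> / (2 * real m))"
        unfolding X_def using that \<tau> by (intro mult_right_mono) auto
      then have "X \<le> \<tau> / 2" using m0 by simp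
      moreover have "0 \<le> X" using \<tau> by (simp add: X_def)
      ultimately show "s \<le> t k" "t k \<le> s + \<tau>" "t k - s \<in> {\<tau> / 2..\<tau>}"
        unfolding t_def \<tau>_def[symmetric] X_def[symmetric] using \<tau> by auto
    qed
    let ?A = "\<lambda>k. close i j \<eta> (t k)"
    have Aev: "?A k \<in> events" if "k < m" for k
      by (rule F_events[OF close_F[of _ "t k"]]) (use t[OF that] s in auto)
    have e: "L\<^sup>2 * \<theta> * prob B \<le> prob (B \<inter> ?A k)" if "k < m" for k
      using prob_close_ge[OF s \<epsilon>, of "t k - s" \<eta> B j i] t[OF that] \<eta> B \<open>j \<noteq> i\<close> dist
      by (simp add: \<tau>_def \<theta>_def)
    have S: "(\<Sum>k<m. \<Sum>l<m. prob (B \<inter> ?A k \<inter> ?A l)) \<le> (real m * \<theta>)\<^sup>2 * second_moment_const * prob B"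
      using second_moment_close[OF s \<epsilon> \<eta> _ B \<open>j \<noteq> i\<close>, of m] m\<theta> by (simp add: t_def \<theta>_def)
    \<comment> \<open>the value that maximises the lower bound of the second moment estimate\<close>
    define lam where "lam = L\<^sup>2 / (real m * \<theta> * second_moment_const)"
    have lam0: "0 \<le> lam" using \<theta>0 second_moment_const_pos by (simp add: lam_def)
    have "2 * lam * real m * (L\<^sup>2 * \<theta> * prob B) - lam\<^sup>2 * ((real m * \<theta>)\<^sup>2 * second_moment_const * prob B)
        \<le> prob (B \<inter> (\<Union>k<m. ?A k))"
      by (rule second_moment_bound[OF Aev BM lam0 e S])
    moreover have "2 * lam * real m * (L\<^sup>2 * \<theta> * prob B) = 2 * (L ^ 4 / second_moment_const * prob B)"
      using m0 \<theta>0 second_moment_const_pos by (simp add: lam_def field_simps power2_eq_square power4_eq_xxxx)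
    moreover have "lam\<^sup>2 * ((real m * \<theta>)\<^sup>2 * second_moment_const * prob B) = L ^ 4 / second_moment_const * prob B"
      using m0 \<theta>0 second_moment_const_pos by (simp add: lam_def field_simps power2_eq_square power4_eq_xxxx)
    ultimately have "L ^ 4 / second_moment_const * prob B \<le> prob (B \<inter> (\<Union>k<m. ?A k))" by linarith
    also have "\<dots> \<le> prob (B \<inter> ?W \<eta>)"
    proof (rule finite_measure_mono)
      show "B \<inter> (\<Union>k<m. ?A k) \<subseteq> B \<inter> ?W \<eta>"
      proof
        fix \<omega> assume "\<omega> \<in> B \<inter> (\<Union>k<m. ?A k)"
        then obtain k where k: "\<omega> \<in> B" "k < m" "\<omega> \<in> ?A k" by auto
        then have "\<omega> \<in> space M" "dist (\<xi> i (t k) \<omega>) (\<xi> j (t k) \<omega>) < \<eta>" by (auto simp: close_def)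
        then have "\<exists>v\<in>?I. dist (\<xi> i v \<omega>) (\<xi> j v \<omega>) < \<eta>"
          using t[OF k(2)] s
          by (intro close_at_rational[of "\<lambda>t. \<xi> i t \<omega>" "\<lambda>t. \<xi> j t \<omega>" "t k"]
              cadlag_right_cont cadlag_\<xi>) auto
        then show "\<omega> \<in> B \<inter> ?W \<eta>" using k \<open>\<omega> \<in> space M\<close> by (auto simp: close_def)
      qed
    qed (use BM Wev in auto)
    finally show ?thesis .
  qed
  define D where "D n = B \<inter> ?W (1 / real (Suc n))" for n
  have "decseq D"
  proof (rule decseq_SucI)
    fix n
    have "1 / real (Suc (Suc n)) \<le> 1 / real (Suc n)" by (simp add: field_simps)
    then show "D (Suc n) \<subseteq> D n" unfolding D_def close_def by (blast intro: less_le_trans)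
  qed
  moreover have "range D \<subseteq> events" using BM Wev by (auto simp: D_def)
  ultimately have "(\<lambda>n. prob (D n)) \<longlonglongrightarrow> prob (\<Inter>n. D n)"
    by (intro finite_Lim_measure_decseq)
  moreover have "\<forall>\<^sub>F n in sequentially. L ^ 4 / second_moment_const * prob B \<le> prob (D n)"
  proof -
    obtain n0 where n0: "1 / real (Suc n0) < \<epsilon>" by (rule nat_approx_posE[OF \<epsilon>(1)])
    show ?thesis
    proof (rule eventually_sequentiallyI[of n0])
      fix n assume "n0 \<le> n"
      then have "1 / real (Suc n) \<le> 1 / real (Suc n0)" by (simp add: field_simps)
      then show "L ^ 4 / second_moment_const * prob B \<le> prob (D n)" unfolding D_def using n0 by (intro bound) auto
    qed
  qed
  ultimately have "L ^ 4 / second_moment_const * prob B \<le> prob (\<Inter>n. D n)"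
    by (rule tendsto_lowerbound) simp
  also have "(\<Inter>n. D n) = B \<inter> near i j s (s + \<epsilon> powr \<alpha>)"
    unfolding near_altdef D_def \<tau>_def by auto
  finally show ?thesis .
qed

end

section \<open>Independent particles do not jump away from a common left limit\<close>

text \<open>The steps of the grid of mesh \<open>1 / Suc k\<close> inside \<open>{q1<..<q2}\<close> on which \<open>f\<close> moves by more
  than \<open>\<delta>\<close>.\<close>

definition grid_jumps :: "(real \<Rightarrow> 'a::metric_space) \<Rightarrow> real \<Rightarrow> real \<Rightarrow> real \<Rightarrow> nat \<Rightarrow> nat set" where
  "grid_jumps f q1 q2 \<delta> k = {r. q1 < real r / real (Suc k) \<and> real (Suc r) / real (Suc k) < q2 \<and>
     \<delta> < dist (f (real r / real (Suc k))) (f (real (Suc r) / real (Suc k)))}"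

text \<open>A jump of \<open>f\<close> is isolated by rational bounds within which, on every fine grid, exactly one step
  is large; if \<open>g\<close> has the same left limit there, then \<open>g\<close> is close to \<open>f\<close> at the start of this
  step.\<close>

lemma jump_on_grid:
  fixes f g :: "real \<Rightarrow> 'a::metric_space"
  assumes f: "cadlag f" and u: "0 < u" and lf: "(f \<longlongrightarrow> l) (at_left u)" and lg: "(g \<longlongrightarrow> l) (at_left u)"
    and ne: "f u \<noteq> l"
  shows "\<exists>q1\<in>\<rat>. \<exists>q2\<in>\<rat>. \<exists>p. 0 < q1 \<and> (\<forall>n. \<exists>K. \<forall>k\<ge>K. \<exists>r.
    grid_jumps f q1 q2 (1 / real (Suc p)) k = {r} \<and>
    dist (f (real r / real (Suc k))) (g (real r / real (Suc k))) < 1 / real (Suc n))"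
proof -
  have "0 < dist l (f u) / 3" using ne by simp
  then obtain p where p: "1 / real (Suc p) < dist l (f u) / 3" by (rule nat_approx_posE)
  define \<delta> where "\<delta> = 1 / real (Suc p)"
  have \<delta>: "0 < \<delta>" "3 * \<delta> < dist l (f u)" using p by (auto simp: \<delta>_def)
  have near_left: "\<exists>a<u. \<forall>v. a < v \<longrightarrow> v < u \<longrightarrow> dist (h v) l < e"
    if "(h \<longlongrightarrow> l) (at_left u)" "0 < e" for h :: "real \<Rightarrow> 'a" and e
    using tendstoD[OF that] unfolding eventually_at_left_field by blast
  obtain a where a: "a < u" "\<And>v. a < v \<Longrightarrow> v < u \<Longrightarrow> dist (f v) l < \<delta> / 2"
    using near_left[OF lf, of "\<delta> / 2"] \<delta> by auto
  have "(f \<longlongrightarrow> f u) (at_right u)" using f u unfolding cadlag_def by simp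
  from tendstoD[OF this, of "\<delta> / 2"] \<delta> obtain b where b: "u < b"
    "\<And>v. u < v \<Longrightarrow> v < b \<Longrightarrow> dist (f v) (f u) < \<delta> / 2"
    unfolding eventually_at_right_field by auto
  obtain q1 where q1: "q1 \<in> \<rat>" "max a 0 < q1" "q1 < u"
    using Rats_dense_in_real[of "max a 0" u] a u by auto
  obtain q2 where q2: "q2 \<in> \<rat>" "u < q2" "q2 < b" using Rats_dense_in_real[OF b(1)] by auto
  have L: "dist (f v) l < \<delta> / 2" if "q1 < v" "v < u" for v using a(2)[of v] q1 that by auto
  have R: "dist (f v) (f u) < \<delta> / 2" if "u \<le> v" "v < q2" for v
    using b(2)[of v] q2 that \<delta> by (cases "v = u") auto
  have grid: "\<exists>K. \<forall>k\<ge>K. \<exists>r. grid_jumps f q1 q2 \<delta> k = {r} \<and>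
      dist (f (real r / real (Suc k))) (g (real r / real (Suc k))) < e" if e: "0 < e" for e
  proof -
    obtain a1 where a1: "a1 < u" "\<And>v. a1 < v \<Longrightarrow> v < u \<Longrightarrow> dist (f v) l < e / 2"
      using near_left[OF lf, of "e / 2"] e by auto
    obtain a2 where a2: "a2 < u" "\<And>v. a2 < v \<Longrightarrow> v < u \<Longrightarrow> dist (g v) l < e / 2"
      using near_left[OF lg, of "e / 2"] e by auto
    define h where "h = Min {u - q1, q2 - u, u - a1, u - a2}"
    have "0 < h" using q1 q2 a1 a2 by (simp add: h_def)
    have hle: "h \<le> u - q1" "h \<le> q2 - u" "h \<le> u - a1" "h \<le> u - a2" by (auto simp: h_def)
    obtain K where K: "1 / real (Suc K) < h" by (rule nat_approx_posE[OF \<open>0 < h\<close>])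
    have "\<exists>r. grid_jumps f q1 q2 \<delta> k = {r} \<and>
      dist (f (real r / real (Suc k))) (g (real r / real (Suc k))) < e" if "K \<le> k" for k
    proof -
      let ?k = "real (Suc k)"
      have k: "1 / ?k < h"
      proof -
        have "1 / ?k \<le> 1 / real (Suc K)" using that by (intro divide_left_mono) auto
        then show ?thesis using K by simp
      qed
      define r where "r = nat \<lceil>u * ?k\<rceil> - 1"
      have pos: "0 < u * ?k" using u by simp
      then have "0 < \<lceil>u * ?k\<rceil>" by (simp only: zero_less_ceiling)
      then have "real (Suc r) = of_int \<lceil>u * ?k\<rceil>" unfolding r_def by linarith
      then have rb: "real r < u * ?k" "u * ?k \<le> real (Suc r)" by linarith+
      then have r1: "real r / ?k < u" and r2: "u \<le> real (Suc r) / ?k"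
        by (auto simp: divide_less_eq le_divide_eq)
      have "real (Suc r) / ?k = real r / ?k + 1 / ?k" by (simp add: add_divide_distrib)
      then have r3: "real (Suc r) / ?k < u + h" "u - h < real r / ?k" using r1 r2 k by linarith+
      have "grid_jumps f q1 q2 \<delta> k = {r}"
      proof (intro equalityI subsetI)
        fix r' assume "r' \<in> {r}"
        then have "r' = r" by simp
        have "dist (f (real r / ?k)) l < \<delta> / 2" by (rule L) (use r1 r3 hle in auto)
        moreover have "dist (f (real (Suc r) / ?k)) (f u) < \<delta> / 2"
          by (rule R) (use r2 r3 hle in auto)
        moreover have "dist l (f u) \<le> dist (f (real r / ?k)) l
            + dist (f (real r / ?k)) (f (real (Suc r) / ?k)) + dist (f (real (Suc r) / ?k)) (f u)"
          by (smt (verit) dist_commute dist_triangle)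
        ultimately have "\<delta> < dist (f (real r / ?k)) (f (real (Suc r) / ?k))" using \<delta> by linarith
        then show "r' \<in> grid_jumps f q1 q2 \<delta> k" unfolding grid_jumps_def \<open>r' = r\<close>
          using r1 r2 r3 hle by auto
      next
        fix r' assume r': "r' \<in> grid_jumps f q1 q2 \<delta> k"
        let ?v = "real r' / ?k" and ?w = "real (Suc r') / ?k"
        have vw: "q1 < ?v" "?w < q2" "\<delta> < dist (f ?v) (f ?w)"
          using r' by (auto simp only: grid_jumps_def mem_Collect_eq)
        have "?v < ?w" by (intro divide_strict_right_mono) auto
        show "r' \<in> {r}"
        proof (cases r' r rule: linorder_cases)
          case less
          then have "?w \<le> real r / ?k" by (intro divide_right_mono) auto
          then have "?w < u" using r1 by simp
          then have "dist (f ?v) l < \<delta> / 2" "dist (f ?w) l < \<delta> / 2"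
            using L[OF vw(1)] L[of ?w] vw(1) \<open>?v < ?w\<close> by linarith+
          then have "dist (f ?v) (f ?w) < \<delta>" by (rule dist_triangle_half_l)
          then show ?thesis using vw by simp
        next
          case greater
          then have "real (Suc r) / ?k \<le> ?v" by (intro divide_right_mono) auto
          then have "u \<le> ?v" using r2 by linarith
          then have "dist (f ?v) (f u) < \<delta> / 2" "dist (f ?w) (f u) < \<delta> / 2"
            using R[OF _ vw(2)] R[of ?v] vw(2) \<open>?v < ?w\<close> by linarith+
          then have "dist (f ?v) (f ?w) < \<delta>" by (rule dist_triangle_half_l)
          then show ?thesis using vw by simp
        qed simp
      qed
      moreover have "dist (f (real r / ?k)) (g (real r / ?k)) < e"
        by (rule dist_triangle_half_l[of _ l]) (use a1 a2 r1 r3 hle in auto)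
      ultimately show ?thesis by blast
    qed
    then show ?thesis by blast
  qed
  show ?thesis
    by (rule bexI[OF _ q1(1)], rule bexI[OF _ q2(1)], rule exI[of _ p])
       (use grid q1 in \<open>simp add: \<delta>_def\<close>)
qed

context stable_like_copies begin

text \<open>Given the path of particle \<open>j\<close>, the independent particle \<open>i\<close> does not sit at its left limit
  at a jump: the grid step of the jump depends on particle \<open>j\<close> alone, and particle \<open>i\<close> is within \<open>\<eta>\<close> of
  a given point with probability of order \<open>\<eta> powr d\<close>.\<close>

lemma AE_jump_apart:
  assumes ij: "i \<noteq> j"
  shows "AE \<omega> in M. \<forall>u>0. \<forall>l. ((\<lambda>t. \<xi> j t \<omega>) \<longlongrightarrow> l) (at_left u) \<and>
    ((\<lambda>t. \<xi> i t \<omega>) \<longlongrightarrow> l) (at_left u) \<longrightarrow> \<xi> j u \<omega> = l"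
proof -
  define J where "J q1 q2 p k r = {\<omega>\<in>space M.
      grid_jumps (\<lambda>t. \<xi> j t \<omega>) q1 q2 (1 / real (Suc p)) k = {r}}" for q1 q2 p k r
  define C where "C q1 q2 p k n = (\<Union>r. J q1 q2 p k r \<inter> close i j (1 / real (Suc n)) (real r / real (Suc k)))"
    for q1 q2 p k n
  define Z where "Z q1 q2 p = (\<Inter>n. \<Union>K. \<Inter>k\<in>{K..}. C q1 q2 p k n)" for q1 q2 p
  have JH: "J q1 q2 p k r \<in> sets (H i 0)" for q1 q2 p k r
  proof -
    have [measurable]: "\<xi> j (real r / real (Suc k)) \<in> H i 0 \<rightarrow>\<^sub>M borel" for r k
      by (rule measurable_info) (use ij in auto)
    have "J q1 q2 p k r = {\<omega>\<in>space (H i 0). \<forall>r'. (q1 < real r' / real (Suc k) \<and> real (Suc r') / real (Suc k) < q2 \<and>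
     1 / real (Suc p) < dist (\<xi> j (real r' / real (Suc k)) \<omega>) (\<xi> j (real (Suc r') / real (Suc k)) \<omega>)) \<longleftrightarrow> r' = r}"
      unfolding J_def grid_jumps_def set_eq_iff space_info by auto
    also have "\<dots> \<in> sets (H i 0)" by measurable
    finally show ?thesis .
  qed
  have JHt: "J q1 q2 p k r \<in> sets (H i t)" if "0 \<le> t" for q1 q2 p k r t
    by (rule info_mono[OF _ JH]) (use that in auto)
  have Jev: "J q1 q2 p k r \<in> events" for q1 q2 p k r using H_events[OF JH] .
  have clev: "close i j \<eta> u \<in> events" if "0 \<le> u" for \<eta> u
    using F_events[OF close_F[OF that order.refl]] .
  have Cev: "C q1 q2 p k n \<in> events" for q1 q2 p k n
    unfolding C_def by (intro sets.countable_UN image_subsetI sets.Int Jev clev) simp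
  have Cle: "emeasure M (C q1 q2 p k n) \<le> ennreal (U * (min q1 1) powr (- (d / \<alpha>)) * (1 / real (Suc n)) powr d)"
    if q1: "0 < q1" for q1 q2 p k n
  proof -
    define c where "c = U * (min q1 1) powr (- (d / \<alpha>)) * (1 / real (Suc n)) powr d"
    have c0: "0 \<le> c" using U_pos by (simp add: c_def)
    have le: "emeasure M (J q1 q2 p k r \<inter> close i j (1 / real (Suc n)) (real r / real (Suc k)))
        \<le> ennreal c * emeasure M (J q1 q2 p k r)" for r
    proof (cases "q1 < real r / real (Suc k)")
      case True
      let ?t = "real r / real (Suc k)"
      \<comment> \<open>the upper bound is applied over the last \<open>min q1 1\<close> before the time \<open>?t > q1\<close>\<close>
      have "prob (J q1 q2 p k r \<inter> close i j (1 / real (Suc n)) (?t - min q1 1 + min q1 1)) \<le> c * prob (J q1 q2 p k r)"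
        unfolding c_def
        by (rule prob_close_le) (use True q1 ij in \<open>auto intro!: JHt\<close>)
      then show ?thesis using c0 by (simp add: emeasure_eq_measure flip: ennreal_mult)
    next
      case False
      then have "J q1 q2 p k r = {}" by (auto simp: J_def grid_jumps_def set_eq_iff)
      then show ?thesis by simp
    qed
    have "emeasure M (C q1 q2 p k n) \<le> (\<Sum>r. emeasure M (J q1 q2 p k r \<inter> close i j (1 / real (Suc n)) (real r / real (Suc k))))"
      unfolding C_def by (intro emeasure_subadditive_countably image_subsetI sets.Int Jev clev) simp
    also have "\<dots> \<le> (\<Sum>r. ennreal c * emeasure M (J q1 q2 p k r))"
      using le by (intro suminf_le) auto
    also have "\<dots> = ennreal c * emeasure M (\<Union>r. J q1 q2 p k r)"
    proof -
      have "disjoint_family (J q1 q2 p k)" by (auto simp: disjoint_family_on_def J_def)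
      then have "(\<Sum>r. emeasure M (J q1 q2 p k r)) = emeasure M (\<Union>r. J q1 q2 p k r)"
        using Jev by (intro suminf_emeasure) auto
      then show ?thesis by simp
    qed
    also have "\<dots> \<le> ennreal c * 1" by (intro mult_left_mono emeasure_le_1) auto
    finally show ?thesis by (simp add: c_def)
  qed
  have Zev: "Z q1 q2 p \<in> events" for q1 q2 p
    unfolding Z_def using Cev
    by (intro sets.countable_INT image_subsetI sets.countable_UN) auto
  have Znull: "Z q1 q2 p \<in> null_sets M" if q1: "0 < q1" for q1 q2 p
  proof -
    define c where "c n = U * (min q1 1) powr (- (d / \<alpha>)) * (1 / real (Suc n)) powr d" for n
    have le: "emeasure M (Z q1 q2 p) \<le> ennreal (c n)" for n
    proof -
      let ?I = "\<lambda>K. \<Inter>k\<in>{K..}. C q1 q2 p k n"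
      have Iev: "?I K \<in> events" for K
        using Cev by (intro sets.countable_INT image_subsetI) auto
      have "emeasure M (Z q1 q2 p) \<le> emeasure M (\<Union>K. ?I K)"
        using Iev by (intro emeasure_mono) (auto simp: Z_def)
      also have "\<dots> = (SUP K. emeasure M (?I K))"
        using Iev by (intro SUP_emeasure_incseq[symmetric]) (auto simp: incseq_def)
      also have "\<dots> \<le> ennreal (c n)"
      proof (rule SUP_least)
        fix K
        have "emeasure M (?I K) \<le> emeasure M (C q1 q2 p K n)" using Cev by (intro emeasure_mono) auto
        also have "\<dots> \<le> ennreal (c n)" using Cle[OF q1] by (simp add: c_def)
        finally show "emeasure M (?I K) \<le> ennreal (c n)" .
      qed
      finally show ?thesis .
    qed
    have "(\<lambda>n. (1 / real (Suc n)) powr d) \<longlonglongrightarrow> 0"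
      by (rule tendsto_zero_powrI[OF LIMSEQ_Suc[OF lim_1_over_n] tendsto_const]) (use d_pos in auto)
    then have "c \<longlonglongrightarrow> 0" unfolding c_def by (rule tendsto_mult_right_zero)
    then have "(\<lambda>n. ennreal (c n)) \<longlonglongrightarrow> ennreal 0" by (rule tendsto_ennrealI)
    then have "emeasure M (Z q1 q2 p) \<le> ennreal 0"
      by (rule tendsto_lowerbound) (use le in auto)
    then show ?thesis using Zev by (auto simp: null_sets_def)
  qed
  have "AE \<omega> in M. \<forall>q1\<in>\<rat>. \<forall>q2\<in>\<rat>. \<forall>p. 0 < q1 \<longrightarrow> \<omega> \<notin> Z q1 q2 p"
    using AE_not_in[OF Znull] countable_rat by (intro AE_ball_countable' AE_all_countable[THEN iffD2] allI) auto
  then show ?thesis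
  proof (rule AE_mp, intro AE_I2 impI allI)
    fix \<omega> u l assume w: "\<omega> \<in> space M" and Z: "\<forall>q1\<in>\<rat>. \<forall>q2\<in>\<rat>. \<forall>p. 0 < q1 \<longrightarrow> \<omega> \<notin> Z q1 q2 p"
      and u: "(0::real) < u"
      and l: "((\<lambda>t. \<xi> j t \<omega>) \<longlongrightarrow> l) (at_left u) \<and> ((\<lambda>t. \<xi> i t \<omega>) \<longlongrightarrow> l) (at_left u)"
    show "\<xi> j u \<omega> = l"
    proof (rule ccontr)
      assume ne: "\<xi> j u \<omega> \<noteq> l"
      obtain q1 q2 p where q: "q1 \<in> \<rat>" "q2 \<in> \<rat>" "0 < q1" and
        K: "\<And>n. \<exists>K. \<forall>k\<ge>K. \<exists>r. grid_jumps (\<lambda>t. \<xi> j t \<omega>) q1 q2 (1 / real (Suc p)) k = {r} \<and>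
            dist (\<xi> j (real r / real (Suc k)) \<omega>) (\<xi> i (real r / real (Suc k)) \<omega>) < 1 / real (Suc n)"
        using jump_on_grid[OF cadlag_\<xi>[OF w] u conjunct1[OF l] conjunct2[OF l] ne] by blast
      have "\<omega> \<in> Z q1 q2 p" unfolding Z_def
      proof
        fix n
        obtain K where K: "\<forall>k\<ge>K. \<exists>r. grid_jumps (\<lambda>t. \<xi> j t \<omega>) q1 q2 (1 / real (Suc p)) k = {r} \<and>
            dist (\<xi> j (real r / real (Suc k)) \<omega>) (\<xi> i (real r / real (Suc k)) \<omega>) < 1 / real (Suc n)"
          using K by blast
        have "\<omega> \<in> C q1 q2 p k n" if "K \<le> k" for k
          using K that w unfolding C_def J_def close_def by (auto simp: dist_commute)
        then show "\<omega> \<in> (\<Union>K. \<Inter>k\<in>{K..}. C q1 q2 p k n)" by auto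
      qed
      then show False using Z q by blast
    qed
  qed
qed

lemma AE_no_jump_off: "AE \<omega> in M. \<forall>i j. i \<noteq> j \<longrightarrow> no_jump_off (\<lambda>t. \<xi> i t \<omega>) (\<lambda>t. \<xi> j t \<omega>)"
proof -
  have "AE \<omega> in M. i \<noteq> j \<longrightarrow> no_jump_off (\<lambda>t. \<xi> i t \<omega>) (\<lambda>t. \<xi> j t \<omega>)" for i j
  proof (cases "i = j")
    case False
    show ?thesis using AE_jump_apart[OF False] AE_jump_apart[OF False[symmetric]]
      by eventually_elim (auto simp: no_jump_off_def)
  qed simp
  then show ?thesis by (simp add: AE_all_countable)
qed

section \<open>Activity as an event of the past\<close>

text \<open>Activity of particle \<open>i\<close> at time \<open>t\<close> is an uncountable condition on the paths. Off the null set on which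
  particles jump away from a common left limit it is equivalent to a condition on countably many
  times.\<close>

lemma active_measurable:
  assumes "0 \<le> t"
  shows "\<exists>B\<in>sets (F t). \<forall>\<omega>\<in>space M. (\<forall>i j. i \<noteq> j \<longrightarrow> no_jump_off (\<lambda>t. \<xi> i t \<omega>) (\<lambda>t. \<xi> j t \<omega>)) \<longrightarrow>
    (active (\<lambda>i s. \<xi> i s \<omega>) i t \<longleftrightarrow> \<omega> \<in> B)"
  using assms
proof (induction i arbitrary: t rule: less_induct)
  case (less i)
  let ?good = "\<lambda>\<omega>. \<forall>i j. i \<noteq> j \<longrightarrow> no_jump_off (\<lambda>t. \<xi> i t \<omega>) (\<lambda>t. \<xi> j t \<omega>)"
  let ?S = "\<lambda>j q B. B \<in> sets (F q) \<and> (\<forall>\<omega>\<in>space M. ?good \<omega> \<longrightarrow>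
      (active (\<lambda>i s. \<xi> i s \<omega>) j q \<longleftrightarrow> \<omega> \<in> B))"
  define A where "A j q = (SOME B. ?S j q B)" for j q
  have AS: "?S j q (A j q)" if "j < i" "0 \<le> q" for j q
    unfolding A_def by (rule someI_ex) (rule less.IH[OF that, unfolded Bex_def])
  have A: "A j q \<in> sets (F q)" if "j < i" "0 \<le> q" for j q
    using AS[OF that] by (rule conjunct1)
  have A': "active (\<lambda>i s. \<xi> i s \<omega>) j q \<longleftrightarrow> \<omega> \<in> A j q"
    if "j < i" "0 \<le> q" "\<omega> \<in> space M" "?good \<omega>" for j q \<omega>
    using mp[OF bspec[OF conjunct2[OF AS[OF that(1,2)]] that(3)] that(4)] .
  let ?T = "insert t (\<rat> \<inter> {0..t})"
  define B where "B = space M - (\<Union>j\<in>{..<i}. \<Union>q\<in>?T. near i j 0 q \<inter> A j q)"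
  have "near i j 0 q \<inter> A j q \<in> sets (F t)" if "j < i" "q \<in> ?T" for j q
  proof -
    have "0 \<le> q" "q \<le> t" using that less.prems by auto
    then show ?thesis using F_mono[OF \<open>q \<le> t\<close>] near_F A[OF that(1)] by (intro sets.Int) auto
  qed
  moreover have "countable ?T" using countable_rat by (auto intro: countable_subset)
  moreover have "space M \<in> sets (F t)" using sets.top[of "F t"] by simp
  ultimately have "B \<in> sets (F t)"
    unfolding B_def by (intro sets.Diff sets.finite_UN sets.countable_UN'') auto
  moreover have "active (\<lambda>i s. \<xi> i s \<omega>) i t \<longleftrightarrow> \<omega> \<in> B" if w: "\<omega> \<in> space M" "?good \<omega>" for \<omega>
  proof -
    let ?\<xi> = "\<lambda>i s. \<xi> i s \<omega>"
    have cad: "cadlag (?\<xi> i)" for i using cadlag_\<xi>[OF w(1)] .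
    have "(\<exists>u\<in>{0..q}. ?\<xi> i u = ?\<xi> j u) \<and> active ?\<xi> j q \<longleftrightarrow> \<omega> \<in> near i j 0 q \<inter> A j q"
      if "j < i" "q \<in> ?T" for j q
    proof -
      have q: "0 \<le> q" using that less.prems by auto
      have "i \<noteq> j" using that by simp
      then have "no_jump_off (?\<xi> i) (?\<xi> j)" using w(2) by blast
      then have "(\<exists>u\<in>{0..q}. ?\<xi> i u = ?\<xi> j u) \<longleftrightarrow> \<omega> \<in> near i j 0 q"
        using meeting_iff_close[OF cad[of i] cad[of j], of 0 q] q w(1) by (simp add: near_def)
      then show ?thesis using A'[OF that(1) q w] by blast
    qed
    then have "(\<exists>j<i. \<exists>q\<in>?T. (\<exists>u\<in>{0..q}. ?\<xi> i u = ?\<xi> j u) \<and> active ?\<xi> j q)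
        \<longleftrightarrow> (\<exists>j<i. \<exists>q\<in>?T. \<omega> \<in> near i j 0 q \<inter> A j q)" by blast
    moreover have "\<not> active ?\<xi> i t
        \<longleftrightarrow> (\<exists>j<i. \<exists>q\<in>?T. (\<exists>u\<in>{0..q}. ?\<xi> i u = ?\<xi> j u) \<and> active ?\<xi> j q)"
      by (rule not_active_iff_rat) (use cad cadlag_right_cont less.prems in auto)
    ultimately show ?thesis using w(1) unfolding B_def by auto
  qed
  ultimately show ?case by blast
qed

end

section \<open>The number of active particles decreases geometrically\<close>

text \<open>Pairs of elements of \<open>R\<close> that are consecutive within their cell.\<close>

definition adj_pairs :: "nat set \<Rightarrow> (nat \<Rightarrow> nat) \<Rightarrow> (nat \<times> nat) set" where
  "adj_pairs R c = {(j, i). j \<in> R \<and> i \<in> R \<and> j < i \<and> c j = c i \<and> (\<forall>k\<in>R. j < k \<and> k < i \<longrightarrow> c k \<noteq> c i)}"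

lemma card_le_adj_pairs:
  assumes R: "finite R" and c: "\<And>i. i \<in> R \<Longrightarrow> c i < m"
  shows "card R \<le> m + card (adj_pairs R c)"
proof -
  define R0 where "R0 = {i \<in> R. \<forall>k\<in>R. k < i \<longrightarrow> c k \<noteq> c i}"
  have fin: "finite (adj_pairs R c)"
    by (rule finite_subset[of _ "R \<times> R"]) (use R in \<open>auto simp: adj_pairs_def\<close>)
  have "inj_on c R0"
  proof (rule inj_onI)
    fix i k assume "i \<in> R0" "k \<in> R0" "c i = c k"
    then show "i = k" unfolding R0_def by (cases i k rule: linorder_cases) auto
  qed
  moreover have "c ` R0 \<subseteq> {..<m}" using c by (auto simp: R0_def)
  ultimately have "card R0 \<le> m" using card_inj_on_le[of c R0 "{..<m}"] by simp
  moreover have "R - R0 \<subseteq> snd ` adj_pairs R c"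
  proof
    fix i assume i: "i \<in> R - R0"
    let ?S = "{k \<in> R. k < i \<and> c k = c i}"
    have S: "finite ?S" "?S \<noteq> {}" using R i by (auto simp: R0_def)
    then have "Max ?S \<in> ?S" by (rule Max_in)
    moreover have "c k \<noteq> c i" if "k \<in> R" "Max ?S < k" "k < i" for k
    proof
      assume "c k = c i"
      then have "k \<le> Max ?S" using that S(1) by (intro Max_ge) auto
      then show False using that by simp
    qed
    ultimately have "(Max ?S, i) \<in> adj_pairs R c"
      using i unfolding adj_pairs_def by blast
    then show "i \<in> snd ` adj_pairs R c" by (rule image_eqI[rotated]) simp
  qed
  then have "card (R - R0) \<le> card (adj_pairs R c)" using fin by (rule surj_card_le[rotated])
  moreover have "R0 \<subseteq> R" by (auto simp: R0_def)
  then have "card (R - R0) = card R - card R0" "card R0 \<le> card R"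
    using R by (simp_all add: card_Diff_subset card_mono finite_subset[OF _ R])
  ultimately show ?thesis by simp
qed

lemma card_adj_pairs_le_removed:
  assumes R: "finite R" and R': "R' \<subseteq> R" and G: "G \<subseteq> adj_pairs R c"
    and kill: "\<And>i j. (j, i) \<in> G \<Longrightarrow> j \<notin> R' \<or> i \<notin> R'"
  shows "card G + 2 * card R' \<le> 2 * card R"
proof -
  define G1 where "G1 = {z \<in> G. snd z \<notin> R'}"
  define G2 where "G2 = {z \<in> G. fst z \<notin> R'}"
  have fin: "finite G"
    by (rule finite_subset[OF G], rule finite_subset[of _ "R \<times> R"]) (use R in \<open>auto simp: adj_pairs_def\<close>)
  have "inj_on snd G1"
  proof (rule inj_onI)
    fix z z' assume z: "z \<in> G1" "z' \<in> G1" "snd z = snd z'"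
    obtain j i j' where jj: "z = (j, i)" "z' = (j', i)" using z(3) by (metis prod.collapse)
    have "(j, i) \<in> adj_pairs R c" "(j', i) \<in> adj_pairs R c" using z G jj by (auto simp: G1_def)
    then show "z = z'" unfolding jj by (cases j j' rule: linorder_cases) (auto simp: adj_pairs_def)
  qed
  moreover have "snd ` G1 \<subseteq> R - R'" using G by (auto simp: G1_def adj_pairs_def)
  ultimately have 1: "card G1 \<le> card (R - R')" using R card_inj_on_le[of snd G1 "R - R'"] by auto
  have "inj_on fst G2"
  proof (rule inj_onI)
    fix z z' assume z: "z \<in> G2" "z' \<in> G2" "fst z = fst z'"
    obtain j i i' where jj: "z = (j, i)" "z' = (j, i')" using z(3) by (metis prod.collapse)
    have "(j, i) \<in> adj_pairs R c" "(j, i') \<in> adj_pairs R c" using z G jj by (auto simp: G2_def)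
    then show "z = z'" unfolding jj by (cases i i' rule: linorder_cases) (auto simp: adj_pairs_def)
  qed
  moreover have "fst ` G2 \<subseteq> R - R'" using G by (auto simp: G2_def adj_pairs_def)
  ultimately have 2: "card G2 \<le> card (R - R')" using R card_inj_on_le[of fst G2 "R - R'"] by auto
  have "G = G1 \<union> G2" using kill by (fastforce simp: G1_def G2_def)
  then have "card G \<le> card G1 + card G2" by (metis card_Un_le)
  moreover have "card (R - R') = card R - card R'" using R R' by (meson card_Diff_subset finite_subset)
  moreover have "card R' \<le> card R" using R R' by (rule card_mono)
  ultimately show ?thesis using 1 2 by linarith
qed

text \<open>A finite cover by balls of radius \<open>\<epsilon>\<close>, made disjoint: each point is assigned the first ball that
  contains it.\<close>

lemma cell_function:
  fixes C :: "'a::polish_space set"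
  assumes "finite C" and cover: "\<forall>y. \<exists>z\<in>C. dist y z < \<epsilon>"
  shows "\<exists>cell::'a \<Rightarrow> nat. cell \<in> borel \<rightarrow>\<^sub>M count_space UNIV \<and>
    (\<forall>y. cell y < card C) \<and> (\<forall>y y'. cell y = cell y' \<longrightarrow> dist y y' \<le> 2 * \<epsilon>)"
proof -
  obtain zs where zs: "set zs = C" "length zs = card C"
    using \<open>finite C\<close> by (metis finite_distinct_list distinct_card)
  define cell where "cell y = (LEAST k. k < length zs \<and> dist y (zs ! k) < \<epsilon>)" for y
  have "cell \<in> borel \<rightarrow>\<^sub>M count_space UNIV" unfolding cell_def by measurable
  moreover have cell: "cell y < length zs \<and> dist y (zs ! cell y) < \<epsilon>" for y
  proof -
    obtain z where "z \<in> C" "dist y z < \<epsilon>" using cover by blast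
    then obtain k where "k < length zs \<and> dist y (zs ! k) < \<epsilon>" using zs by (metis in_set_conv_nth)
    then show ?thesis unfolding cell_def by (rule LeastI)
  qed
  moreover have "dist y y' \<le> 2 * \<epsilon>" if "cell y = cell y'" for y y'
    using dist_triangle2[of y y' "zs ! cell y"] cell[of y] cell[of y'] that by simp
  ultimately show ?thesis using zs by (intro exI[of _ cell]) auto
qed

lemma (in prob_space) expectation_card:
  assumes "finite I" "\<And>z. z \<in> I \<Longrightarrow> E z \<in> events"
  shows "integrable M (\<lambda>\<omega>. real (card {z\<in>I. \<omega> \<in> E z}))"
    and "(\<integral>\<omega>. real (card {z\<in>I. \<omega> \<in> E z}) \<partial>M) = (\<Sum>z\<in>I. prob (E z))"
proof -
  have eq: "real (card {z\<in>I. \<omega> \<in> E z}) = (\<Sum>z\<in>I. indicat_real (E z) \<omega>)" for \<omega>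
    using \<open>finite I\<close> by (simp add: indicator_def sum.If_cases Int_def)
  have int: "integrable M (indicat_real (E z))" if "z \<in> I" for z
    using assms(2)[OF that] by (auto simp: integrable_indicator_iff emeasure_eq_measure less_top[symmetric])
  show "integrable M (\<lambda>\<omega>. real (card {z\<in>I. \<omega> \<in> E z}))"
    unfolding eq using int by (rule Bochner_Integration.integrable_sum)
  show "(\<integral>\<omega>. real (card {z\<in>I. \<omega> \<in> E z}) \<partial>M) = (\<Sum>z\<in>I. prob (E z))"
    unfolding eq using int assms(2) by (subst Bochner_Integration.integral_sum) auto
qed

context stable_like_copies begin

text \<open>An event of \<open>F t\<close> that agrees almost surely with the activity of particle \<open>i\<close> at time \<open>t\<close>.\<close>

definition act :: "nat \<Rightarrow> real \<Rightarrow> 'b set" where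
  "act i t = (SOME B. B \<in> sets (F t) \<and> (\<forall>\<omega>\<in>space M.
     (\<forall>i j. i \<noteq> j \<longrightarrow> no_jump_off (\<lambda>t. \<xi> i t \<omega>) (\<lambda>t. \<xi> j t \<omega>)) \<longrightarrow>
     (active (\<lambda>i s. \<xi> i s \<omega>) i t \<longleftrightarrow> \<omega> \<in> B)))"

lemma act:
  assumes "0 \<le> t"
  shows "act i t \<in> sets (F t)"
    and "AE \<omega> in M. active (\<lambda>i s. \<xi> i s \<omega>) i t \<longleftrightarrow> \<omega> \<in> act i t"
proof -
  have act: "act i t \<in> sets (F t) \<and> (\<forall>\<omega>\<in>space M.
     (\<forall>i j. i \<noteq> j \<longrightarrow> no_jump_off (\<lambda>t. \<xi> i t \<omega>) (\<lambda>t. \<xi> j t \<omega>)) \<longrightarrow>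
     (active (\<lambda>i s. \<xi> i s \<omega>) i t \<longleftrightarrow> \<omega> \<in> act i t))"
    unfolding act_def by (rule someI_ex) (rule active_measurable[OF assms, unfolded Bex_def])
  then show "act i t \<in> sets (F t)" by (rule conjunct1)
  show "AE \<omega> in M. active (\<lambda>i s. \<xi> i s \<omega>) i t \<longleftrightarrow> \<omega> \<in> act i t"
    using AE_no_jump_off
  proof (rule AE_mp, intro AE_I2 impI)
    fix \<omega> assume w: "\<omega> \<in> space M" "\<forall>i j. i \<noteq> j \<longrightarrow> no_jump_off (\<lambda>t. \<xi> i t \<omega>) (\<lambda>t. \<xi> j t \<omega>)"
    show "active (\<lambda>i s. \<xi> i s \<omega>) i t \<longleftrightarrow> \<omega> \<in> act i t"
      using mp[OF bspec[OF conjunct2[OF act] w(1)] w(2)] .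
  qed
qed

lemma act_events: "0 \<le> t \<Longrightarrow> act i t \<in> events"
  using act(1) F_events by blast

text \<open>The expected number of active particles among the first \<open>n\<close>.\<close>

definition mean_active :: "nat \<Rightarrow> real \<Rightarrow> real" where
  "mean_active n t = (\<Sum>i<n. prob (act i t))"

lemma mean_active_antimono:
  assumes "0 \<le> s" "s \<le> t"
  shows "mean_active n t \<le> mean_active n s"
  unfolding mean_active_def
proof (rule sum_mono)
  fix i
  have "AE \<omega> in M. \<omega> \<in> act i t \<longrightarrow> \<omega> \<in> act i s"
    using act(2)[OF assms(1)] act(2)[OF order_trans[OF assms]]
    by eventually_elim (auto dest: active_mono[OF _ assms(2)])
  then show "prob (act i t) \<le> prob (act i s)"
    using act_events assms by (intro finite_measure_mono_AE) auto
qed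

lemma near_meeting:
  assumes ij: "i \<noteq> j" and ab: "0 \<le> a" "a \<le> b"
  shows "AE \<omega> in M. \<omega> \<in> near i j a b \<longrightarrow> (\<exists>u\<in>{a..b}. \<xi> i u \<omega> = \<xi> j u \<omega>)"
  using AE_no_jump_off
proof (rule AE_mp, intro AE_I2 impI)
  fix \<omega> assume w: "\<omega> \<in> space M" "\<forall>i j. i \<noteq> j \<longrightarrow> no_jump_off (\<lambda>t. \<xi> i t \<omega>) (\<lambda>t. \<xi> j t \<omega>)"
    "\<omega> \<in> near i j a b"
  then have "no_jump_off (\<lambda>t. \<xi> i t \<omega>) (\<lambda>t. \<xi> j t \<omega>)" using ij by blast
  from meeting_iff_close[OF cadlag_\<xi>[OF w(1)] cadlag_\<xi>[OF w(1)] this ab] w(3)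
  show "\<exists>u\<in>{a..b}. \<xi> i u \<omega> = \<xi> j u \<omega>" by (simp add: near_def)
qed

text \<open>Among the active particles, all but one per cell of diameter \<open>2 * \<epsilon>\<close> have a predecessor in
  their cell, which they meet within time \<open>\<epsilon> powr \<alpha>\<close> with probability at least \<open>\<beta>\<close>. Each such
  meeting deactivates one of the two, and each particle belongs to at most two of these pairs.\<close>

lemma mean_active_step:
  assumes t: "0 \<le> t" and \<epsilon>: "0 < \<epsilon>" "\<epsilon> \<le> 1" and C: "finite (C :: 'a set)" "\<forall>y. \<exists>z\<in>C. dist y z < \<epsilon>"
    and \<beta>: "\<beta> \<le> L ^ 4 / second_moment_const" "0 \<le> \<beta>"
  shows "mean_active n (t + \<epsilon> powr \<alpha>) \<le> mean_active n t - \<beta> / 2 * (mean_active n t - real (card C))"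
proof -
  define t' where "t' = t + \<epsilon> powr \<alpha>"
  have t': "0 \<le> t'" "t \<le> t'" using t by (auto simp: t'_def)
  obtain cell :: "'a \<Rightarrow> nat" where cell[measurable]: "cell \<in> borel \<rightarrow>\<^sub>M count_space UNIV"
    and cell_less: "\<And>y. cell y < card C" and cell_dist: "\<And>y y'. cell y = cell y' \<Longrightarrow> dist y y' \<le> 2 * \<epsilon>"
    using cell_function[OF C] by blast
  define R where "R \<omega> = {i\<in>{..<n}. \<omega> \<in> act i t}" for \<omega>
  define R' where "R' \<omega> = {i\<in>{..<n}. \<omega> \<in> act i t'}" for \<omega>
  define c where "c \<omega> i = cell (\<xi> i t \<omega>)" for \<omega> i
  define I where "I = {..<n} \<times> {..<n}"
  define A where "A z = {\<omega>\<in>space M. z \<in> adj_pairs (R \<omega>) (c \<omega>)}" for z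
  define N where "N z = near (fst z) (snd z) t t'" for z
  have finI: "finite I" "finite {..<n}" by (auto simp: I_def)
  have AF: "A z \<in> sets (F t)" if zI: "z \<in> I" for z
  proof -
    have [measurable]: "\<xi> i t \<in> F t \<rightarrow>\<^sub>M borel" for i by (rule measurable_info) (use t in auto)
    obtain j i where z: "z = (j, i)" "j < n" "i < n" using zI by (auto simp: I_def)
    define E where "E k = {\<omega>\<in>space (F t). cell (\<xi> k t \<omega>) = cell (\<xi> i t \<omega>)}" for k
    have cm: "(\<lambda>\<omega>. cell (\<xi> k t \<omega>)) \<in> F t \<rightarrow>\<^sub>M count_space UNIV" for k
      by (rule measurable_compose[OF _ cell]) measurable
    have EF: "E k \<in> sets (F t)" for k
    proof -
      have "E k = (\<Union>m. ((\<lambda>\<omega>. cell (\<xi> k t \<omega>)) -` {m} \<inter> space (F t))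
          \<inter> ((\<lambda>\<omega>. cell (\<xi> i t \<omega>)) -` {m} \<inter> space (F t)))"
        by (auto simp: E_def)
      also have "\<dots> \<in> sets (F t)"
        by (intro sets.countable_UN image_subsetI sets.Int measurable_sets[OF cm]) auto
      finally show ?thesis .
    qed
    have "A z = (if j < i then act j t \<inter> act i t \<inter> E j - (\<Union>k\<in>{j<..<i}. act k t \<inter> E k) else {})"
      using z sets.sets_into_space[OF act(1)[OF t, of i]]
      by (auto simp: A_def adj_pairs_def R_def c_def E_def)
    also have "\<dots> \<in> sets (F t)" using EF act(1)[OF t] by auto
    finally show ?thesis .
  qed
  then have Aev: "A z \<in> events" if "z \<in> I" for z using F_events that by blast
  have Nev: "N z \<in> events" for z unfolding N_def using near_F[OF t t'(2)] F_events by blast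
  have actev: "act i t \<in> events" "act i t' \<in> events" for i using act_events t t' by auto
  \<comment> \<open>all but at most \<open>card C\<close> of the active particles have a predecessor in their cell\<close>
  have "(\<integral>\<omega>. real (card {i\<in>{..<n}. \<omega> \<in> act i t}) \<partial>M) \<le> (\<integral>\<omega>. real (card C) + real (card {z\<in>I. \<omega> \<in> A z}) \<partial>M)"
  proof (rule integral_mono)
    show "integrable M (\<lambda>\<omega>. real (card {i\<in>{..<n}. \<omega> \<in> act i t}))"
      by (rule expectation_card) (use actev in auto)
    show "integrable M (\<lambda>\<omega>. real (card C) + real (card {z\<in>I. \<omega> \<in> A z}))"
      using expectation_card(1)[OF finI(1) Aev] by simp
    fix \<omega> assume w: "\<omega> \<in> space M"
    have "adj_pairs (R \<omega>) (c \<omega>) = {z\<in>I. \<omega> \<in> A z}"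
      using w by (auto simp: A_def I_def adj_pairs_def R_def)
    moreover have "card (R \<omega>) \<le> card C + card (adj_pairs (R \<omega>) (c \<omega>))"
      by (rule card_le_adj_pairs) (auto simp: R_def c_def cell_less)
    ultimately show "real (card {i\<in>{..<n}. \<omega> \<in> act i t}) \<le> real (card C) + real (card {z\<in>I. \<omega> \<in> A z})"
      by (simp add: R_def)
  qed
  then have 1: "mean_active n t \<le> real (card C) + (\<Sum>z\<in>I. prob (A z))"
    using expectation_card[OF finI(1) Aev] expectation_card[OF finI(2) actev(1)]
    by (simp add: mean_active_def prob_space)
  have "\<beta> * prob (A z) \<le> prob (A z \<inter> N z)" if z: "z \<in> I" for z
  proof (cases "fst z = snd z")
    case True
    then have "A z = {}" by (auto simp: A_def adj_pairs_def)
    then show ?thesis by simp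
  next
    case False
    have "L ^ 4 / second_moment_const * prob (A z) \<le> prob (A z \<inter> near (fst z) (snd z) t (t + \<epsilon> powr \<alpha>))"
      by (rule prob_near_ge[OF t \<epsilon> AF[OF z]])
         (use False cell_dist in \<open>auto simp: A_def adj_pairs_def c_def\<close>)
    moreover have "\<beta> * prob (A z) \<le> L ^ 4 / second_moment_const * prob (A z)" using \<beta> by (intro mult_right_mono) auto
    ultimately show ?thesis by (simp add: N_def t'_def)
  qed
  then have 2: "\<beta> * (\<Sum>z\<in>I. prob (A z)) \<le> (\<Sum>z\<in>I. prob (A z \<inter> N z))"
    by (simp add: sum_distrib_left sum_mono)
  \<comment> \<open>of two particles that meet, at most one stays active, so \<open>card_adj_pairs_le_removed\<close> applies\<close>
  have "(\<integral>\<omega>. real (card {z\<in>I. \<omega> \<in> A z \<inter> N z}) + 2 * real (card {i\<in>{..<n}. \<omega> \<in> act i t'}) \<partial>M)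
      \<le> (\<integral>\<omega>. 2 * real (card {i\<in>{..<n}. \<omega> \<in> act i t}) \<partial>M)"
  proof (rule integral_mono_AE)
    show "integrable M (\<lambda>\<omega>. real (card {z\<in>I. \<omega> \<in> A z \<inter> N z}) + 2 * real (card {i\<in>{..<n}. \<omega> \<in> act i t'}))"
      using expectation_card(1)[OF finI(1), of "\<lambda>z. A z \<inter> N z"] expectation_card(1)[OF finI(2) actev(2)] Aev Nev
      by auto
    show "integrable M (\<lambda>\<omega>. 2 * real (card {i\<in>{..<n}. \<omega> \<in> act i t}))"
      using expectation_card(1)[OF finI(2) actev(1)] by simp
    have "AE \<omega> in M. \<forall>i. active (\<lambda>i s. \<xi> i s \<omega>) i t \<longleftrightarrow> \<omega> \<in> act i t"
      "AE \<omega> in M. \<forall>i. active (\<lambda>i s. \<xi> i s \<omega>) i t' \<longleftrightarrow> \<omega> \<in> act i t'"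
      using act(2)[OF t] act(2)[OF t'(1)] by (simp_all add: AE_all_countable)
    moreover have "AE \<omega> in M. \<forall>j i. j \<noteq> i \<longrightarrow> \<omega> \<in> near j i t t' \<longrightarrow> (\<exists>u\<in>{t..t'}. \<xi> j u \<omega> = \<xi> i u \<omega>)"
    proof -
      have "AE \<omega> in M. j \<noteq> i \<longrightarrow> \<omega> \<in> near j i t t' \<longrightarrow> (\<exists>u\<in>{t..t'}. \<xi> j u \<omega> = \<xi> i u \<omega>)" for i j
        by (cases "j = i") (use near_meeting[OF _ t t'(2), of j i] in auto)
      then show ?thesis by (simp add: AE_all_countable)
    qed
    ultimately show "AE \<omega> in M. real (card {z\<in>I. \<omega> \<in> A z \<inter> N z}) + 2 * real (card {i\<in>{..<n}. \<omega> \<in> act i t'})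
      \<le> 2 * real (card {i\<in>{..<n}. \<omega> \<in> act i t})"
    proof (eventually_elim, goal_cases)
      case (1 \<omega>)
      let ?\<xi> = "\<lambda>i s. \<xi> i s \<omega>"
      show ?case
      proof (cases "\<omega> \<in> space M")
        case w: True
        have "card {z\<in>I. \<omega> \<in> A z \<inter> N z} + 2 * card (R' \<omega>) \<le> 2 * card (R \<omega>)"
        proof (rule card_adj_pairs_le_removed)
          show "finite (R \<omega>)" by (simp add: R_def)
          show "R' \<omega> \<subseteq> R \<omega>"
            using 1(1,2) active_mono[of ?\<xi> _ t' t] t' by (auto simp: R_def R'_def)
          show "{z\<in>I. \<omega> \<in> A z \<inter> N z} \<subseteq> adj_pairs (R \<omega>) (c \<omega>)" by (auto simp: A_def)
          fix j i assume ji: "(j, i) \<in> {z\<in>I. \<omega> \<in> A z \<inter> N z}"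
          then have "j \<noteq> i" "\<omega> \<in> near j i t t'" by (auto simp: A_def adj_pairs_def N_def)
          then have "\<exists>u\<in>{t..t'}. \<xi> j u \<omega> = \<xi> i u \<omega>" using 1(3) by blast
          then obtain u where u: "t \<le> u" "u \<le> t'" "\<xi> j u \<omega> = \<xi> i u \<omega>" by auto
          have "\<forall>i. right_cont (?\<xi> i)" using cadlag_right_cont[OF cadlag_\<xi>[OF w]] by blast
          then have "\<not> (active ?\<xi> j t' \<and> active ?\<xi> i t')"
            using active_pair_not_meeting[of ?\<xi> j t' i u] u t \<open>j \<noteq> i\<close> by auto
          then show "j \<notin> R' \<omega> \<or> i \<notin> R' \<omega>" using 1(2) by (auto simp: R'_def)
        qed
        then show ?thesis by (simp add: R_def R'_def)
      next
        case False
        then have "\<omega> \<notin> A z" "\<omega> \<notin> act i t'" for z i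
          using sets.sets_into_space[OF actev(2)] by (auto simp: A_def)
        then show ?thesis by simp
      qed
    qed
  qed
  then have "(\<Sum>z\<in>I. prob (A z \<inter> N z)) + 2 * mean_active n t' \<le> 2 * mean_active n t"
    using expectation_card[OF finI(1), of "\<lambda>z. A z \<inter> N z"] expectation_card[OF finI(2) actev(1)]
      expectation_card[OF finI(2) actev(2)] Aev Nev
    by (simp add: mean_active_def)
  moreover have "\<beta> * (mean_active n t - real (card C)) \<le> \<beta> * (\<Sum>z\<in>I. prob (A z))"
    using 1 \<beta> by (intro mult_left_mono) auto
  ultimately show ?thesis using 2 unfolding t'_def by linarith
qed

end

text \<open>A nonincreasing function that loses a fixed proportion of its excess over \<open>K * \<epsilon> powr (- d)\<close>
  during a time \<open>\<epsilon> powr \<alpha>\<close>, for every scale \<open>\<epsilon>\<close>, is bounded at time \<open>T\<close> irrespective of its initial value: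
  the times needed to pass from one power of \<open>1 / q\<close> to the next form a convergent geometric
  series.\<close>

lemma comes_down_from_infinity:
  fixes \<beta> K d \<alpha> T :: real
  assumes \<beta>: "0 < \<beta>" "\<beta> \<le> 1" and K: "0 < K" and d: "0 < d" and \<alpha>: "0 < \<alpha>" and T: "0 < T"
  shows "\<exists>b. \<forall>a. (\<forall>s t. 0 \<le> s \<longrightarrow> s \<le> t \<longrightarrow> a t \<le> a s) \<longrightarrow>
    (\<forall>t \<epsilon>. 0 \<le> t \<longrightarrow> 0 < \<epsilon> \<longrightarrow> \<epsilon> \<le> 1 \<longrightarrow>
       a (t + \<epsilon> powr \<alpha>) \<le> a t - \<beta> / 2 * (a t - K * \<epsilon> powr (- d))) \<longrightarrow> a T \<le> b"
proof -
  define q where "q = 1 - \<beta> / 4"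
  have q: "0 < q" "q < 1" "1 - \<beta> / 2 \<le> q * q"
    using \<beta> by (auto simp: q_def algebra_simps)
  define \<rho> where "\<rho> = q powr (\<alpha> / d)"
  have \<rho>: "0 < \<rho>" "\<rho> < 1" using q \<alpha> d powr_less_mono2[of "\<alpha> / d" q 1] by (auto simp: \<rho>_def)
  define e where "e = min 1 ((T * (1 - \<rho>)) powr (1 / \<alpha>))"
  have e: "0 < e" "e \<le> 1" using T \<rho> by (auto simp: e_def)
  have eT: "e powr \<alpha> \<le> T * (1 - \<rho>)"
  proof -
    have "e powr \<alpha> \<le> ((T * (1 - \<rho>)) powr (1 / \<alpha>)) powr \<alpha>"
      using e \<alpha> by (intro powr_mono2) (auto simp: e_def)
    then show ?thesis using \<alpha> T \<rho> by (simp add: powr_powr)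
  qed
  define b where "b = 2 * K * e powr (- d)"
  have b: "0 < b" using K e by (simp add: b_def)
  show ?thesis
  proof (intro exI[of _ b] allI impI)
    fix a :: "real \<Rightarrow> real"
    assume anti: "\<forall>s t. 0 \<le> s \<longrightarrow> s \<le> t \<longrightarrow> a t \<le> a s"
      and step: "\<forall>t \<epsilon>. 0 \<le> t \<longrightarrow> 0 < \<epsilon> \<longrightarrow> \<epsilon> \<le> 1 \<longrightarrow>
        a (t + \<epsilon> powr \<alpha>) \<le> a t - \<beta> / 2 * (a t - K * \<epsilon> powr (- d))"
    have descend: "a (t + e powr \<alpha> * (\<Sum>j<k. \<rho> ^ j)) \<le> b" if "0 \<le> t" "a t \<le> b / q ^ k" for k t
      using that
    proof (induction k arbitrary: t)
      case 0
      then show ?case by simp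
    next
      case (Suc k)
      \<comment> \<open>the scale at which the equilibrium level \<open>K * \<epsilon> powr (- d)\<close> is half the target \<open>X\<close>\<close>
      define \<epsilon> where "\<epsilon> = e * q powr (real k / d)"
      define X where "X = b / q ^ k"
      have X: "0 < X" using b q by (simp add: X_def)
      have qk: "q powr (real k / d) \<le> 1" using q d by (intro powr_le1) auto
      have \<epsilon>: "0 < \<epsilon>" "\<epsilon> \<le> 1" using e q mult_mono[OF e(2) qk] by (auto simp: \<epsilon>_def)
      have "\<epsilon> powr \<alpha> = e powr \<alpha> * q powr (real k * (\<alpha> / d))"
        using e q by (simp add: \<epsilon>_def powr_mult powr_powr)
      also have "q powr (real k * (\<alpha> / d)) = \<rho> ^ k"
        using q by (simp add: \<rho>_def powr_powr mult.commute flip: powr_realpow)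
      finally have \<epsilon>\<alpha>: "\<epsilon> powr \<alpha> = e powr \<alpha> * \<rho> ^ k" .
      have "\<epsilon> powr (- d) = e powr (- d) * q powr (- real k)"
        using e q d by (simp add: \<epsilon>_def powr_mult powr_powr)
      also have "q powr (- real k) = 1 / q ^ k" using q by (simp add: powr_minus_divide powr_realpow)
      finally have K\<epsilon>: "K * \<epsilon> powr (- d) = X / 2" by (simp add: X_def b_def)
      have "a (t + \<epsilon> powr \<alpha>) \<le> a t - \<beta> / 2 * (a t - K * \<epsilon> powr (- d))"
        using step Suc.prems(1) \<epsilon> by blast
      also have "\<dots> = (1 - \<beta> / 2) * a t + \<beta> / 4 * X" unfolding K\<epsilon> by (simp add: algebra_simps)
      also have "(1 - \<beta> / 2) * a t \<le> (1 - \<beta> / 2) * (X / q)"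
        using Suc.prems(2) \<beta> q by (intro mult_left_mono) (auto simp: X_def mult.commute)
      also have "\<dots> \<le> (q * q) * (X / q)" using q X by (intro mult_right_mono) auto
      also have "\<dots> = q * X" using q by simp
      finally have "a (t + \<epsilon> powr \<alpha>) \<le> X" by (simp add: q_def algebra_simps)
      then have "a ((t + \<epsilon> powr \<alpha>) + e powr \<alpha> * (\<Sum>j<k. \<rho> ^ j)) \<le> b"
        using Suc.prems(1) by (intro Suc.IH) (auto simp: X_def)
      then show ?case unfolding \<epsilon>\<alpha> by (simp add: algebra_simps)
    qed
    obtain k where "a 0 / b < (1 / q) ^ k" using real_arch_pow[of "1 / q" "a 0 / b"] q by auto
    then have "a 0 \<le> b / q ^ k" using b by (simp add: field_simps power_divide)
    from descend[OF _ this] have "a (e powr \<alpha> * (\<Sum>j<k. \<rho> ^ j)) \<le> b" by simp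
    moreover have "e powr \<alpha> * (\<Sum>j<k. \<rho> ^ j) \<le> T"
    proof -
      have "(\<Sum>j<k. \<rho> ^ j) = (1 - \<rho> ^ k) / (1 - \<rho>)"
        using \<rho> by (subst sum_gp_strict) auto
      also have "\<dots> \<le> 1 / (1 - \<rho>)" using \<rho> by (intro divide_right_mono) auto
      finally have "e powr \<alpha> * (\<Sum>j<k. \<rho> ^ j) \<le> (T * (1 - \<rho>)) * (1 / (1 - \<rho>))"
        using eT \<rho> T by (intro mult_mono) (auto intro!: sum_nonneg)
      then show ?thesis using \<rho> by simp
    qed
    moreover have "0 \<le> e powr \<alpha> * (\<Sum>j<k. \<rho> ^ j)" using \<rho> by (auto intro!: sum_nonneg mult_nonneg_nonneg)
    ultimately show "a T \<le> b" using anti by (meson order_trans)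
  qed
qed

context stable_like_copies begin

text \<open>The expected number of active particles at time \<open>T\<close> is bounded uniformly in the number of particles,
  so that by Borel--Cantelli only finitely many are active.\<close>

lemma AE_finite_active:
  assumes T: "0 < T" and K: "0 < K"
    and cover: "\<And>\<epsilon>. 0 < \<epsilon> \<Longrightarrow> \<epsilon> \<le> 1 \<Longrightarrow>
      \<exists>C. finite C \<and> real (card C) \<le> K * \<epsilon> powr (- d) \<and> (\<forall>y::'a. \<exists>z\<in>C. dist y z < \<epsilon>)"
  shows "AE \<omega> in M. finite {i. active (\<lambda>i s. \<xi> i s \<omega>) i T}"
proof -
  define \<beta> where "\<beta> = min 1 (L ^ 4 / second_moment_const)"
  have \<beta>: "0 < \<beta>" "\<beta> \<le> 1" "\<beta> \<le> L ^ 4 / second_moment_const" using L_pos second_moment_const_pos by (auto simp: \<beta>_def)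
  obtain b where b: "\<And>a. (\<forall>s t. 0 \<le> s \<longrightarrow> s \<le> t \<longrightarrow> a t \<le> a s) \<Longrightarrow>
    (\<forall>t \<epsilon>. 0 \<le> t \<longrightarrow> 0 < \<epsilon> \<longrightarrow> \<epsilon> \<le> 1 \<longrightarrow>
       a (t + \<epsilon> powr \<alpha>) \<le> a t - \<beta> / 2 * (a t - K * \<epsilon> powr (- d))) \<Longrightarrow> a T \<le> b"
    using comes_down_from_infinity[OF \<beta>(1,2) K d_pos exponent(1) T] by blast
  have bound: "mean_active n T \<le> b" for n
  proof (rule b)
    show "\<forall>s t. 0 \<le> s \<longrightarrow> s \<le> t \<longrightarrow> mean_active n t \<le> mean_active n s"
      using mean_active_antimono by blast
    show "\<forall>t \<epsilon>. 0 \<le> t \<longrightarrow> 0 < \<epsilon> \<longrightarrow> \<epsilon> \<le> 1 \<longrightarrow> mean_active n (t + \<epsilon> powr \<alpha>)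
        \<le> mean_active n t - \<beta> / 2 * (mean_active n t - K * \<epsilon> powr (- d))"
    proof (intro allI impI)
      fix t \<epsilon> :: real assume t: "0 \<le> t" and \<epsilon>: "0 < \<epsilon>" "\<epsilon> \<le> 1"
      obtain C where C: "finite C" "real (card C) \<le> K * \<epsilon> powr (- d)" "\<forall>y::'a. \<exists>z\<in>C. dist y z < \<epsilon>"
        using cover[OF \<epsilon>] by blast
      have "mean_active n (t + \<epsilon> powr \<alpha>) \<le> mean_active n t - \<beta> / 2 * (mean_active n t - real (card C))"
        by (rule mean_active_step[OF t \<epsilon> C(1,3) \<beta>(3)]) (use \<beta> in auto)
      also have "\<dots> \<le> mean_active n t - \<beta> / 2 * (mean_active n t - K * \<epsilon> powr (- d))"
        using C(2) \<beta> by (intro diff_mono mult_left_mono) auto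
      finally show "mean_active n (t + \<epsilon> powr \<alpha>)
        \<le> mean_active n t - \<beta> / 2 * (mean_active n t - K * \<epsilon> powr (- d))" .
    qed
  qed
  have "summable (\<lambda>i. prob (act i T))"
    by (rule bounded_imp_summable[of _ b])
       (use bound[unfolded mean_active_def, of "Suc _"] in \<open>auto simp: lessThan_Suc_atMost\<close>)
  then have "AE \<omega> in M. eventually (\<lambda>i. \<omega> \<in> space M - act i T) sequentially"
    using act_events T by (intro borel_cantelli_AE1) (auto simp: emeasure_eq_measure)
  moreover have "AE \<omega> in M. \<forall>i. active (\<lambda>i s. \<xi> i s \<omega>) i T \<longleftrightarrow> \<omega> \<in> act i T"
    using act(2)[of T] T by (simp add: AE_all_countable)
  ultimately show ?thesis
  proof eventually_elim
    case (elim \<omega>)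
    then obtain m where "\<And>i. m \<le> i \<Longrightarrow> \<omega> \<notin> act i T" unfolding eventually_sequentially by auto
    then have "{i. active (\<lambda>i s. \<xi> i s \<omega>) i T} \<subseteq> {..<m}" using elim(2) by (auto simp: not_le[symmetric])
    then show ?case using finite_subset by blast
  qed
qed

lemma AE_finite_coalescing_set:
  assumes K: "0 < K"
    and cover: "\<And>\<epsilon>. 0 < \<epsilon> \<Longrightarrow> \<epsilon> \<le> 1 \<Longrightarrow>
      \<exists>C. finite C \<and> real (card C) \<le> K * \<epsilon> powr (- d) \<and> (\<forall>y::'a. \<exists>z\<in>C. dist y z < \<epsilon>)"
  shows "AE \<omega> in M. \<forall>t>0. finite (coalescing_set \<infinity> (\<lambda>i s. \<xi> i s \<omega>) t)"
proof -
  have "AE \<omega> in M. \<forall>n. finite {i. active (\<lambda>i s. \<xi> i s \<omega>) i (1 / real (Suc n))}"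
    unfolding AE_all_countable by (intro allI AE_finite_active[OF _ K cover]) auto
  then show ?thesis
  proof (rule AE_mp, intro AE_I2 impI allI)
    fix \<omega> t assume w: "\<omega> \<in> space M" and fin: "\<forall>n. finite {i. active (\<lambda>i s. \<xi> i s \<omega>) i (1 / real (Suc n))}"
      and t: "(0::real) < t"
    obtain n where n: "1 / real (Suc n) < t" by (rule nat_approx_posE[OF t])
    have rc: "\<forall>i. right_cont (\<lambda>s. \<xi> i s \<omega>)" using cadlag_right_cont[OF cadlag_\<xi>[OF w]] by blast
    show "finite (coalescing_set \<infinity> (\<lambda>i s. \<xi> i s \<omega>) t)"
      by (rule finite_coalescing_set[OF rc spec[OF fin, of n]]) (use n in simp)
  qed
qed

end

section \<open>Volume growth and heat kernel bounds\<close>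

text \<open>A separated set of largest cardinality is a net, and the volume bound limits its size.\<close>

lemma small_cover:
  fixes \<mu> :: "'a::polish_space measure"
  assumes "prob_space \<mu>" and \<mu>: "sets \<mu> = sets borel" and d: "0 < d" and C1: "0 < C1"
    and vol: "\<And>x \<epsilon>. 0 < \<epsilon> \<Longrightarrow> \<epsilon> \<le> 1 \<Longrightarrow> C1 * \<epsilon> powr d \<le> measure \<mu> (ball x \<epsilon>)"
    and \<epsilon>: "0 < \<epsilon>" "\<epsilon> \<le> 1"
  shows "\<exists>C. finite C \<and> real (card C) \<le> 2 powr d / C1 * \<epsilon> powr (- d) \<and> (\<forall>y::'a. \<exists>z\<in>C. dist y z < \<epsilon>)"
proof -
  interpret prob_space \<mu> by fact
  define sep where "sep C \<longleftrightarrow> finite C \<and> (\<forall>y\<in>C. \<forall>z\<in>C. y \<noteq> z \<longrightarrow> \<epsilon> \<le> dist y z)" for C :: "'a set"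
  have bound: "real (card C) \<le> 2 powr d / C1 * \<epsilon> powr (- d)" if "sep C" for C
  proof -
    have fin: "finite C" using that by (simp add: sep_def)
    have "ball y (\<epsilon> / 2) \<inter> ball z (\<epsilon> / 2) = {}" if "y \<in> C" "z \<in> C" "y \<noteq> z" for y z
    proof -
      have "\<epsilon> \<le> dist y z" using \<open>sep C\<close> that by (simp add: sep_def)
      then show ?thesis by (intro disjoint_ballI) simp
    qed
    then have disj: "disjoint_family_on (\<lambda>y. ball y (\<epsilon> / 2)) C" by (auto simp: disjoint_family_on_def)
    have "real (card C) * (C1 * (\<epsilon> / 2) powr d) = (\<Sum>y\<in>C. C1 * (\<epsilon> / 2) powr d)" by simp
    also have "\<dots> \<le> (\<Sum>y\<in>C. prob (ball y (\<epsilon> / 2)))" using \<epsilon> by (intro sum_mono vol) auto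
    also have "\<dots> = prob (\<Union>y\<in>C. ball y (\<epsilon> / 2))"
      by (rule finite_measure_finite_Union[symmetric, OF fin _ disj]) (simp add: \<mu> image_subset_iff)
    also have "\<dots> \<le> 1" by (rule prob_le_1)
    finally show ?thesis using C1 \<epsilon> by (simp add: powr_divide powr_minus field_simps)
  qed
  define B where "B = nat \<lceil>2 powr d / C1 * \<epsilon> powr (- d)\<rceil>"
  have "sep {}" by (simp add: sep_def)
  moreover have "\<forall>C. sep C \<longrightarrow> card C < Suc B"
  proof (intro allI impI)
    fix C assume "sep C"
    then have "real (card C) \<le> real B"
      unfolding B_def using bound real_nat_ceiling_ge order_trans by blast
    then show "card C < Suc B" by simp
  qed
  ultimately obtain C where C: "sep C" "\<And>D. sep D \<Longrightarrow> card D \<le> card C"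
    using Lattices_Big.ex_has_greatest_nat[of sep "{}" card "Suc B"] by blast
  have "\<exists>z\<in>C. dist y z < \<epsilon>" for y
  proof (rule ccontr)
    assume no: "\<not> (\<exists>z\<in>C. dist y z < \<epsilon>)"
    then have "y \<notin> C" using \<epsilon> by force
    moreover have "sep (insert y C)" using C(1) no by (auto simp: sep_def dist_commute not_less)
    ultimately show False using C(2)[of "insert y C"] C(1) by (simp add: sep_def)
  qed
  then show ?thesis using C(1) bound by (auto simp: sep_def)
qed

lemma profile_le: "0 < t \<Longrightarrow> profile d \<alpha> t r \<le> t powr (- (d / \<alpha>))"
  by (auto simp: profile_def)

lemma profile_ge:
  assumes d: "0 < d" "d < \<alpha>" and \<epsilon>: "0 < \<epsilon>" and t: "\<epsilon> powr \<alpha> / 2 \<le> t" "t \<le> \<epsilon> powr \<alpha>"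
    and r: "0 \<le> r" "r \<le> 4 * \<epsilon>"
  shows "4 powr (- (d + \<alpha>)) / 2 * \<epsilon> powr (- d) \<le> profile d \<alpha> t r"
proof -
  have t0: "0 < t" using \<epsilon> t(1) by (smt (verit) powr_gt_zero divide_pos_pos)
  have "\<epsilon> powr (- d) = (\<epsilon> powr \<alpha>) powr (- d / \<alpha>)" using d by (simp add: powr_powr)
  also have "\<dots> \<le> t powr (- d / \<alpha>)"
    using t0 t(2) d by (intro powr_mono2') (auto simp: divide_nonpos_pos)
  finally have 1: "\<epsilon> powr (- d) \<le> t powr (- d / \<alpha>)" .
  have k: "4 powr (- (d + \<alpha>)) / 2 \<le> (1::real)"
    using powr_mono[of "- (d + \<alpha>)" 0 4] d by simp
  have 2: "4 powr (- (d + \<alpha>)) / 2 * \<epsilon> powr (- d) \<le> t powr (- d / \<alpha>)"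
    using mult_right_mono[OF k, of "\<epsilon> powr (- d)"] 1 by simp
  have 3: "4 powr (- (d + \<alpha>)) / 2 * \<epsilon> powr (- d) \<le> t / r powr (d + \<alpha>)" if "r \<noteq> 0"
  proof -
    have "4 powr (- (d + \<alpha>)) / 2 * \<epsilon> powr (- d) = (\<epsilon> powr \<alpha> / 2) / (4 * \<epsilon>) powr (d + \<alpha>)"
      using \<epsilon> by (simp add: powr_mult powr_minus powr_add powr_diff field_simps)
    also have "\<dots> \<le> t / (4 * \<epsilon>) powr (d + \<alpha>)" using t(1) by (intro divide_right_mono) auto
    also have "\<dots> \<le> t / r powr (d + \<alpha>)"
      using r that t0 d by (intro divide_left_mono powr_mono2) (auto intro!: mult_pos_pos)
    finally show ?thesis .
  qed
  show ?thesis using 2 3 by (auto simp: profile_def)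
qed

lemma measure_density_ball:
  fixes \<mu> :: "'a::polish_space measure" and f :: "'a \<Rightarrow> real"
  assumes "prob_space \<mu>" and \<mu>: "sets \<mu> = sets borel" and f: "f \<in> borel_measurable borel"
    and a: "0 \<le> a" "\<And>y. y \<in> ball z \<eta> \<Longrightarrow> a \<le> f y" and b: "0 \<le> b" "\<And>y. y \<in> ball z \<eta> \<Longrightarrow> f y \<le> b"
  shows "a * measure \<mu> (ball z \<eta>) \<le> measure (density \<mu> (\<lambda>y. ennreal (f y))) (ball z \<eta>)"
    and "measure (density \<mu> (\<lambda>y. ennreal (f y))) (ball z \<eta>) \<le> b * measure \<mu> (ball z \<eta>)"
proof -
  interpret prob_space \<mu> by fact
  have [measurable]: "f \<in> borel_measurable \<mu>" "ball z \<eta> \<in> sets \<mu>"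
    using f \<mu> by (auto cong: measurable_cong_sets)
  let ?D = "density \<mu> (\<lambda>y. ennreal (f y))"
  have D: "emeasure ?D (ball z \<eta>) = (\<integral>\<^sup>+y. ennreal (f y) * indicator (ball z \<eta>) y \<partial>\<mu>)"
    by (rule emeasure_density) auto
  have up: "emeasure ?D (ball z \<eta>) \<le> ennreal (b * measure \<mu> (ball z \<eta>))"
  proof -
    have "emeasure ?D (ball z \<eta>) \<le> (\<integral>\<^sup>+y. ennreal b * indicator (ball z \<eta>) y \<partial>\<mu>)"
      unfolding D using b(2) by (intro nn_integral_mono) (auto simp: indicator_def intro!: ennreal_leI)
    also have "\<dots> = ennreal b * emeasure \<mu> (ball z \<eta>)"
      by (rule nn_integral_cmult_indicator) auto
    finally show ?thesis using b by (simp add: emeasure_eq_measure ennreal_mult)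
  qed
  have low: "ennreal (a * measure \<mu> (ball z \<eta>)) \<le> emeasure ?D (ball z \<eta>)"
  proof -
    have "ennreal (a * measure \<mu> (ball z \<eta>)) = ennreal a * emeasure \<mu> (ball z \<eta>)"
      using a by (simp add: emeasure_eq_measure ennreal_mult)
    also have "\<dots> = (\<integral>\<^sup>+y. ennreal a * indicator (ball z \<eta>) y \<partial>\<mu>)"
      by (rule nn_integral_cmult_indicator[symmetric]) auto
    also have "\<dots> \<le> emeasure ?D (ball z \<eta>)"
      unfolding D using a(2) by (intro nn_integral_mono) (auto simp: indicator_def intro!: ennreal_leI)
    finally show ?thesis .
  qed
  have "emeasure ?D (ball z \<eta>) < \<infinity>" using up by (auto intro: le_less_trans)
  then have eq: "emeasure ?D (ball z \<eta>) = ennreal (measure ?D (ball z \<eta>))"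
    by (intro emeasure_eq_ennreal_measure) auto
  show "a * measure \<mu> (ball z \<eta>) \<le> measure ?D (ball z \<eta>)" using low eq by simp
  show "measure ?D (ball z \<eta>) \<le> b * measure \<mu> (ball z \<eta>)" using up eq b by simp
qed

theorem theorem3p1:
  fixes \<mu> :: "'a::polish_space measure"
    and P :: "real \<Rightarrow> 'a \<Rightarrow> 'a measure"
    and p :: "real \<Rightarrow> 'a \<Rightarrow> 'a \<Rightarrow> real"
    and M :: "'b measure"
    and Q :: "'a set"
    and \<Xi> :: "real \<Rightarrow> 'b \<Rightarrow> 'a set"
    and C1 C2 c1 c2 d \<alpha> :: real
  assumes "compact (UNIV :: 'a set)"
    and "prob_space \<mu>" and "sets \<mu> = sets borel"
    and "0 < d" and "0 < C1" and "C1 < C2"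
    and "\<And>x \<epsilon>. 0 < \<epsilon> \<Longrightarrow> \<epsilon> \<le> 1 \<Longrightarrow>
           C1 * \<epsilon> powr d \<le> measure \<mu> (ball x \<epsilon>) \<and> measure \<mu> (ball x \<epsilon>) \<le> C2 * \<epsilon> powr d"
    and "feller_semigroup P"
    and "transition_densities \<mu> P p"
    and "continuous_on ({0<..} \<times> UNIV \<times> UNIV) (\<lambda>(t, x, y). p t x y)"
    and "symmetric_semigroup \<mu> P"
    and "d < \<alpha>" and "0 < c1" and "c1 < c2"
    and "\<And>t x y. 0 < t \<Longrightarrow> t \<le> 1 \<Longrightarrow>
           c1 * profile d \<alpha> t (dist x y) \<le> p t x y \<and> p t x y \<le> c2 * profile d \<alpha> t (dist x y)"
    and "prob_space M"
    and "closed Q" and "Q \<noteq> {}"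
    and "coalescing_system M P Q \<Xi>"
  shows "AE \<omega> in M. \<forall>t>0. finite (\<Xi> t \<omega>)"
proof -
  note vol = assms(7) and hk = assms(15)
  obtain N x \<xi> where proc: "\<And>i. enat i < N \<Longrightarrow> process_from M P (x i) (\<xi> i)"
    and indep: "prob_space.indep_vars M (\<lambda>i. \<Pi>\<^sub>M t\<in>{0..}. borel) (\<lambda>i \<omega>. \<lambda>t\<in>{0..}. \<xi> i t \<omega>) {i. enat i < N}"
    and \<Xi>: "\<And>t \<omega>. 0 \<le> t \<Longrightarrow> \<omega> \<in> space M \<Longrightarrow> \<Xi> t \<omega> = coalescing_set N (\<lambda>i s. \<xi> i s \<omega>) t"
    using \<open>coalescing_system M P Q \<Xi>\<close> unfolding coalescing_system_def by blast
  show ?thesis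
  proof (cases N)
    case (enat n)
    have "finite (\<Xi> t \<omega>)" if "0 < t" "\<omega> \<in> space M" for t \<omega>
    proof -
      have "finite {coalesced (\<lambda>i s. \<xi> i s \<omega>) i t |i. enat i < N}"
        by (rule finite_subset[of _ "(\<lambda>i. coalesced (\<lambda>i s. \<xi> i s \<omega>) i t) ` {..<n}"]) (auto simp: enat)
      then show ?thesis using that by (simp add: \<Xi> coalescing_set_def finite_imp_closed)
    qed
    then show ?thesis by (intro AE_I2) auto
  next
    case infinity
    \<comment> \<open>the constant of \<open>profile_ge\<close>\<close>
    define k where "k = 4 powr (- (d + \<alpha>)) / (2::real)"
    have k: "0 < k" by (simp add: k_def)
    have dens: "P t y = density \<mu> (\<lambda>z. ennreal (p t y z))" if "0 < t" for t y
      using \<open>transition_densities \<mu> P p\<close> that by (simp add: transition_densities_def)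
    have meas: "p t y \<in> borel_measurable borel" if "0 < t" for t y
    proof -
      have "continuous_on UNIV (\<lambda>z. (\<lambda>(t, x, y). p t x y) (t, y, z))"
        by (rule continuous_on_compose2[OF assms(10)]) (use that in \<open>auto intro!: continuous_intros\<close>)
      then show ?thesis by (intro borel_measurable_continuous_onI) simp
    qed
    interpret prob_space M by fact
    interpret stable_like_copies M P x \<xi> d \<alpha> "c2 * C2" "c1 * k * C1"
    proof unfold_locales
      show "P t \<in> borel \<rightarrow>\<^sub>M prob_algebra borel" if "0 \<le> t" for t
        using \<open>feller_semigroup P\<close> that by (simp add: feller_semigroup_def)
      show "process_from M P (x i) (\<xi> i)" for i using proc infinity by simp
      show "indep_vars (\<lambda>i. \<Pi>\<^sub>M t\<in>{0..}. borel) (\<lambda>i \<omega>. \<lambda>t\<in>{0..}. \<xi> i t \<omega>) UNIV"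
        using indep infinity by simp
      show "0 < d" "d < \<alpha>" "0 < c2 * C2" "0 < c1 * k * C1" using assms k by auto
    next
      fix w \<eta> :: real and y z :: 'a
      assume w: "0 < w" "w \<le> 1" and \<eta>: "0 < \<eta>" "\<eta> \<le> 1"
      have "p w y v \<le> c2 * w powr (- (d / \<alpha>))" for v
      proof -
        have "p w y v \<le> c2 * profile d \<alpha> w (dist y v)" using hk w by blast
        also have "\<dots> \<le> c2 * w powr (- (d / \<alpha>))"
          using profile_le[OF w(1)] assms(13,14) by (intro mult_left_mono) auto
        finally show ?thesis .
      qed
      moreover have "0 \<le> p w y v" for v
        using \<open>transition_densities \<mu> P p\<close> w by (simp add: transition_densities_def)
      ultimately have "measure (P w y) (ball z \<eta>) \<le> c2 * w powr (- (d / \<alpha>)) * measure \<mu> (ball z \<eta>)"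
        unfolding dens[OF w(1)] using assms(13,14)
        by (intro measure_density_ball(2)[OF assms(2,3) meas[OF w(1)], where a = 0]) auto
      also have "\<dots> \<le> c2 * w powr (- (d / \<alpha>)) * (C2 * \<eta> powr d)"
        using vol \<eta> assms(13,14) by (intro mult_left_mono) auto
      finally show "measure (P w y) (ball z \<eta>) \<le> c2 * C2 * w powr (- (d / \<alpha>)) * \<eta> powr d"
        by (simp add: mult_ac)
    next
      fix w \<epsilon> \<eta> :: real and y z :: 'a
      assume \<epsilon>: "0 < \<epsilon>" "\<epsilon> \<le> 1" and w: "\<epsilon> powr \<alpha> / 2 \<le> w" "w \<le> \<epsilon> powr \<alpha>"
        and \<eta>: "0 < \<eta>" "\<eta> \<le> \<epsilon>" and yz: "dist y z \<le> 3 * \<epsilon>"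
      have "0 < \<epsilon> powr \<alpha>" using \<epsilon> by simp
      then have w0: "0 < w" using w by linarith
      have w1: "w \<le> 1" using w(2) powr_le1[of \<alpha> \<epsilon>] \<epsilon> assms(4,12) by linarith
      have "c1 * (k * \<epsilon> powr (- d)) \<le> p w y v" if "v \<in> ball z \<eta>" for v
      proof -
        have "dist y v \<le> 4 * \<epsilon>" using that \<eta> yz dist_triangle[of y v z] by simp
        then have "k * \<epsilon> powr (- d) \<le> profile d \<alpha> w (dist y v)"
          unfolding k_def using assms(4,12) \<epsilon> w by (intro profile_ge) auto
        then have "c1 * (k * \<epsilon> powr (- d)) \<le> c1 * profile d \<alpha> w (dist y v)"
          using assms(13) by (intro mult_left_mono) auto
        then show ?thesis using hk[OF w0 w1, of y v] by linarith
      qed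
      moreover have "p w y v \<le> c2 * w powr (- (d / \<alpha>))" for v
      proof -
        have "p w y v \<le> c2 * profile d \<alpha> w (dist y v)" using hk w0 w1 by blast
        also have "\<dots> \<le> c2 * w powr (- (d / \<alpha>))"
          using profile_le[OF w0] assms(13,14) by (intro mult_left_mono) auto
        finally show ?thesis .
      qed
      ultimately have "c1 * (k * \<epsilon> powr (- d)) * measure \<mu> (ball z \<eta>) \<le> measure (P w y) (ball z \<eta>)"
        unfolding dens[OF w0] using assms(13,14) k
        by (intro measure_density_ball(1)[OF assms(2,3) meas[OF w0], where b = "c2 * w powr (- (d / \<alpha>))"]) auto
      moreover have "c1 * (k * \<epsilon> powr (- d)) * (C1 * \<eta> powr d) \<le> c1 * (k * \<epsilon> powr (- d)) * measure \<mu> (ball z \<eta>)"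
        using vol \<eta> \<epsilon> k assms(13) by (intro mult_left_mono) auto
      moreover have "c1 * (k * \<epsilon> powr (- d)) * (C1 * \<eta> powr d) = c1 * k * C1 * (\<eta> / \<epsilon>) powr d"
        using \<eta> \<epsilon> by (simp add: powr_divide powr_minus field_simps)
      ultimately show "c1 * k * C1 * (\<eta> / \<epsilon>) powr d \<le> measure (P w y) (ball z \<eta>)" by linarith
    qed
    have "AE \<omega> in M. \<forall>t>0. finite (coalescing_set \<infinity> (\<lambda>i s. \<xi> i s \<omega>) t)"
    proof (rule AE_finite_coalescing_set)
      show "0 < 2 powr d / C1" using assms(5) by simp
      show "\<exists>C. finite C \<and> real (card C) \<le> 2 powr d / C1 * \<epsilon> powr (- d) \<and> (\<forall>y::'a. \<exists>z\<in>C. dist y z < \<epsilon>)"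
        if "0 < \<epsilon>" "\<epsilon> \<le> 1" for \<epsilon>
        by (rule small_cover[OF assms(2-5)]) (use vol that in auto)
    qed
    then show ?thesis
      by (rule AE_mp) (intro AE_I2, simp add: \<Xi> infinity)
  qed
qed

end
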